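(* Let $R$ and $L$ be monoids in $\mathcal{V}$. (1) Let $\mathcal{H}_L=(H,\mu_H,\eta_H,\alpha_L,\beta_L,\Delta_L,\epsilon_L)$ be an internal left $L$-bialgebroid in $\mathcal{V}$. Let $\alpha_R\colon R\to H$ and $\beta_R\colon R^{\mathrm{op}}\to H$ be monoid morphisms that commute, i.e. $\mu_H\circ\tau_{H,H}\circ(\alpha_R\otimes\beta_R)=\mu_H\circ(\alpha_R\otimes\beta_R)$, and equip $H$ with the $R$-bimodule structure given by multiplication on the right: right action $\mu_H\circ(\mathrm{id}_H\otimes\alpha_R)$ and left action $\mu_H\circ\tau_{H,H}\circ(\beta_R\otimes\mathrm{id}_H)$. If $$\alpha_L\circ\epsilon_L\circ\beta_R=\beta_R,\qquad \beta_L\circ\epsilon_L\circ\alpha_R=\alpha_R,$$ then $\Delta_L\colon H\to H\otimes_L H$ is an $R$-bimodule morphism. (2) Let $\mathcal{H}_R=(H,\mu_H,\eta_H,\alpha_R,\beta_R,\Delta_R,\epsilon_R)$ be an internal right $R$-bialgebroid in $\mathcal{V}$. Let $\alpha_L\colon L\to H$ and $\beta_L\colon L^{\mathrm{op}}\to H$ be monoid morphisms that commute, i.e. $\mu_H\circ\tau_{H,H}\circ(\alpha_L\otimes\beta_L)=\mu_H\circ(\alpha_L\otimes\beta_L)$, and equip $H$ with the $L$-bimodule structure given by multiplication on the left: left action $\mu_H\circ(\alpha_L\otimes\mathrm{id}_H)$ and right action $\mu_H\circ\tau_{H,H}\circ(\mathrm{id}_H\otimes\beta_L)$. If $$\alpha_R\circ\epsilon_R\circ\beta_L=\beta_L,\qquad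 \beta_R\circ\epsilon_R\circ\alpha_L=\alpha_L,$$ then $\Delta_R\colon H\to H\otimes_R H$ is an $L$-bimodule morphism.
   Context: $\mathcal{V}=(\mathcal{V},\otimes,k,a,l,r,\tau)$ is a symmetric monoidal category (unit $k$, associator $a$, left and right unitors $l,r$, symmetry $\tau$) in which every parallel pair of morphisms has a coequalizer, and coequalizers commute with $\otimes$: if $\xi$ is a coequalizer of $f,g$, then for every object $W$, $\xi\otimes\mathrm{id}_W$ is a coequalizer of $f\otimes\mathrm{id}_W,g\otimes\mathrm{id}_W$ and $\mathrm{id}_W\otimes\xi$ is a coequalizer of $\mathrm{id}_W\otimes f,\mathrm{id}_W\otimes g$. Associators are suppressed. For a monoid $(M,\mu,\eta)$, $M^{\mathrm{op}}$ is $(M,\mu\circ\tau_{M,M},\eta)$. For a monoid $L$, $({}_L\mathcal{V}_L,\otimes_L,L)$ is the monoidal category of internal $L$-bimodules; $X\otimes_L Y$ is the coequalizer of the two morphisms $X\otimes L\otimes Y\to X\otimes Y$ given by the right action on $X$ and the left action on $Y$. For a monoid $H$, $H\otimes H$ is a monoid with $\mu_{H\otimes H}=(\mu_H\otimes\mu_H)\circ(\mathrm{id}_H\otimes\tau_{H,H}\otimes\mathrm{id}_H)$ and $\eta_{H\otimes H}=(\eta_H\otimes\eta_H)\circ l_k^{-1}$. **Internal left $L$-bialgebroid** $(H,\mu_H,\eta_H,\alpha,\beta,\Delta,\epsilon)$ in $\mathcal{V}$. Data: a monoid $(H,\mu_H,\eta_H)$; monoid morphisms $\alpha\colon L\to H$,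 $\beta\colon L^{\mathrm{op}}\to H$ with $\mu_H\circ\tau_{H,H}\circ(\alpha\otimes\beta)=\mu_H\circ(\alpha\otimes\beta)$; a comonoid $(H,\Delta,\epsilon)$ in $({}_L\mathcal{V}_L,\otimes_L,L)$, where $H$ is an $L$-bimodule by left action $\mu_H\circ(\alpha\otimes\mathrm{id}_H)$ and right action $\mu_H\circ\tau_{H,H}\circ(\mathrm{id}_H\otimes\beta)$. Let $\pi\colon H\otimes H\to H\otimes_L H$ be the canonical coequalizer morphism. Conditions: (i) the unique morphism (a right action) $\rho\colon(H\otimes_L H)\otimes(H\otimes H)\to H\otimes_L H$ with $\rho\circ(\pi\otimes\mathrm{id})=\pi\circ\mu_{H\otimes H}$ satisfies $\rho\circ(\Delta\otimes\beta\otimes\eta_H)\circ(\mathrm{id}_H\otimes r_L^{-1})=\rho\circ(\Delta\otimes\eta_H\otimes\alpha)\circ(\mathrm{id}_H\otimes l_L^{-1})$; (ii) the unique morphism $\lambda\colon H\otimes(H\otimes_L H)\to H\otimes_L H$ with $\lambda\circ(\mathrm{id}_H\otimes\pi)=\rho\circ(\Delta\otimes\mathrm{id}_{H\otimes H})$ (it exists by (i)) is a left action; equivalently, $\Delta\circ\eta_H=\pi\circ\eta_{H\otimes H}$ and $\Delta\circ\mu_H=\lambda\circ(\mathrm{id}_H\otimes\Delta)$; (iii) $\epsilon\circ\eta_H=\eta_L$ and $\epsilon\circ\mu_H\circ(\mathrm{id}_H\otimes(\alpha\circ\epsilon))=\epsilon\circ\mu_H=\epsilon\circ\mu_H\circ(\mathrm{id}_H\otimes(\beta\circ\epsilon))$.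 **Internal right $R$-bialgebroid** $(H,\mu_H,\eta_H,\alpha,\beta,\Delta,\epsilon)$ in $\mathcal{V}$. Data: a monoid $(H,\mu_H,\eta_H)$; monoid morphisms $\alpha\colon R\to H$, $\beta\colon R^{\mathrm{op}}\to H$ with $\mu_H\circ\tau_{H,H}\circ(\alpha\otimes\beta)=\mu_H\circ(\alpha\otimes\beta)$; a comonoid $(H,\Delta,\epsilon)$ in $({}_R\mathcal{V}_R,\otimes_R,R)$, where $H$ is an $R$-bimodule by right action $\mu_H\circ(\mathrm{id}_H\otimes\alpha)$ and left action $\mu_H\circ\tau_{H,H}\circ(\beta\otimes\mathrm{id}_H)$. Let $\pi\colon H\otimes H\to H\otimes_R H$ be the canonical coequalizer morphism. Conditions: (i) the unique morphism (a left action) $\lambda\colon(H\otimes H)\otimes(H\otimes_R H)\to H\otimes_R H$ with $\lambda\circ(\mathrm{id}\otimes\pi)=\pi\circ\mu_{H\otimes H}$ satisfies $\lambda\circ(\eta_H\otimes\beta\otimes\Delta)\circ(l_R^{-1}\otimes\mathrm{id}_H)=\lambda\circ(\alpha\otimes\eta_H\otimes\Delta)\circ(r_R^{-1}\otimes\mathrm{id}_H)$; (ii) the unique morphism $\rho\colon(H\otimes_R H)\otimes H\to H\otimes_R H$ with $\rho\circ(\pi\otimes\mathrm{id}_H)=\lambda\circ(\mathrm{id}_{H\otimes H}\otimes\Delta)$ is a right action; equivalently, $\Delta\circ\eta_H=\pi\circ\eta_{H\otimes H}$ and $\Delta\circ\mu_H=\rho\circ(\Delta\otimes\mathrm{id}_H)$;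 (iii) $\epsilon\circ\eta_H=\eta_R$ and $\epsilon\circ\mu_H\circ((\alpha\circ\epsilon)\otimes\mathrm{id}_H)=\epsilon\circ\mu_H=\epsilon\circ\mu_H\circ((\beta\circ\epsilon)\otimes\mathrm{id}_H)$. **Bimodule structures on the tensor products.** In (1), $H\otimes_L H$ carries the $R$-bimodule structure induced by that of $H$: the right $R$-action is induced by the right $R$-action on the second factor, i.e. it is the unique $\nu_R$ with $\nu_R\circ(\pi\otimes\mathrm{id}_R)=\pi\circ(\mathrm{id}_H\otimes(\mu_H\circ(\mathrm{id}_H\otimes\alpha_R)))$; the left $R$-action is induced by the left $R$-action on the first factor. In (2), $H\otimes_R H$ carries the $L$-bimodule structure whose left action is induced by the left $L$-action on the first factor and whose right action is induced by the right $L$-action on the second factor. *)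

theory Defs
  imports Main
begin

section \<open>Symmetric monoidal categories\<close>

text \<open>
  A category is given by a set of objects and a set of arrows with domain and codomain maps; all
  operations are total functions, constrained only on objects and (composable) arrows.
  \<open>g \<cdot> f\<close> is the composite ``\<open>g\<close> after \<open>f\<close>'', \<open>x \<odot> y\<close> is the tensor product of objects and
  \<open>f \<otimes> g\<close> that of arrows.
\<close>

record ('o, 'm) smcat =
  Obj :: "'o set"
  Arr :: "'m set"
  Dom :: "'m \<Rightarrow> 'o"
  Cod :: "'m \<Rightarrow> 'o"
  Idn :: "'o \<Rightarrow> 'm" ("\<iota>\<index>")
  Comp :: "'m \<Rightarrow> 'm \<Rightarrow> 'm" (infixr "\<cdot>\<index>" 60)
  TensO :: "'o \<Rightarrow> 'o \<Rightarrow> 'o" (infixr "\<odot>\<index>" 75)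
  TensA :: "'m \<Rightarrow> 'm \<Rightarrow> 'm" (infixr "\<otimes>\<index>" 70)
  Unt :: "'o" ("\<k>\<index>")
  Assoc :: "'o \<Rightarrow> 'o \<Rightarrow> 'o \<Rightarrow> 'm" ("\<a>\<index>")
  LUnit :: "'o \<Rightarrow> 'm" ("\<l>\<index>")
  RUnit :: "'o \<Rightarrow> 'm" ("\<r>\<index>")
  Symm :: "'o \<Rightarrow> 'o \<Rightarrow> 'm" ("\<tau>\<index>")

definition Hom :: "('o, 'm) smcat \<Rightarrow> 'o \<Rightarrow> 'o \<Rightarrow> 'm set" where
  "Hom V x y = {f \<in> Arr V. Dom V f = x \<and> Cod V f = y}"

definition inverse_arrows :: "('o, 'm) smcat \<Rightarrow> 'm \<Rightarrow> 'm \<Rightarrow> bool" where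
  "inverse_arrows V f g \<longleftrightarrow>
     f \<in> Arr V \<and> g \<in> Hom V (Cod V f) (Dom V f) \<and> g \<cdot> f = \<iota> (Dom V f) \<and> f \<cdot> g = \<iota> (Cod V f)"
  for V (structure)

definition iso_arrow :: "('o, 'm) smcat \<Rightarrow> 'm \<Rightarrow> bool" where
  "iso_arrow V f \<longleftrightarrow> (\<exists>g. inverse_arrows V f g)"

definition Inv :: "('o, 'm) smcat \<Rightarrow> 'm \<Rightarrow> 'm" where
  "Inv V f = (THE g. inverse_arrows V f g)"

locale cat =
  fixes V :: "('o, 'm) smcat" (structure)
  assumes Dom_closed: "f \<in> Arr V \<Longrightarrow> Dom V f \<in> Obj V"
    and Cod_closed: "f \<in> Arr V \<Longrightarrow> Cod V f \<in> Obj V"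
    and Idn_in_Hom: "x \<in> Obj V \<Longrightarrow> \<iota> x \<in> Hom V x x"
    and Comp_in_Hom: "\<lbrakk>f \<in> Hom V x y; g \<in> Hom V y z\<rbrakk> \<Longrightarrow> g \<cdot> f \<in> Hom V x z"
    and Comp_Idn_right: "f \<in> Hom V x y \<Longrightarrow> f \<cdot> \<iota> x = f"
    and Comp_Idn_left: "f \<in> Hom V x y \<Longrightarrow> \<iota> y \<cdot> f = f"
    and Comp_assoc: "\<lbrakk>f \<in> Hom V w x; g \<in> Hom V x y; h \<in> Hom V y z\<rbrakk> \<Longrightarrow> (h \<cdot> g) \<cdot> f = h \<cdot> (g \<cdot> f)"

locale monoidal_cat = cat V for V :: "('o, 'm) smcat" (structure) +
  assumes Unt_closed: "\<k> \<in> Obj V"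
    and TensO_closed: "\<lbrakk>x \<in> Obj V; y \<in> Obj V\<rbrakk> \<Longrightarrow> x \<odot> y \<in> Obj V"
    and TensA_in_Hom:
      "\<lbrakk>f \<in> Hom V x x'; g \<in> Hom V y y'\<rbrakk> \<Longrightarrow> f \<otimes> g \<in> Hom V (x \<odot> y) (x' \<odot> y')"
    and TensA_Idn: "\<lbrakk>x \<in> Obj V; y \<in> Obj V\<rbrakk> \<Longrightarrow> \<iota> x \<otimes> \<iota> y = \<iota> (x \<odot> y)"
    and TensA_Comp:
      "\<lbrakk>f \<in> Hom V x x'; f' \<in> Hom V x' x''; g \<in> Hom V y y'; g' \<in> Hom V y' y''\<rbrakk>
        \<Longrightarrow> (f' \<cdot> f) \<otimes> (g' \<cdot> g) = (f' \<otimes> g') \<cdot> (f \<otimes> g)"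
    and Assoc_in_Hom:
      "\<lbrakk>x \<in> Obj V; y \<in> Obj V; z \<in> Obj V\<rbrakk> \<Longrightarrow> \<a> x y z \<in> Hom V ((x \<odot> y) \<odot> z) (x \<odot> (y \<odot> z))"
    and Assoc_iso: "\<lbrakk>x \<in> Obj V; y \<in> Obj V; z \<in> Obj V\<rbrakk> \<Longrightarrow> iso_arrow V (\<a> x y z)"
    and Assoc_natural:
      "\<lbrakk>f \<in> Hom V x x'; g \<in> Hom V y y'; h \<in> Hom V z z'\<rbrakk>
        \<Longrightarrow> \<a> x' y' z' \<cdot> ((f \<otimes> g) \<otimes> h) = (f \<otimes> (g \<otimes> h)) \<cdot> \<a> x y z"
    and LUnit_in_Hom: "x \<in> Obj V \<Longrightarrow> \<l> x \<in> Hom V (\<k> \<odot> x) x"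
    and LUnit_iso: "x \<in> Obj V \<Longrightarrow> iso_arrow V (\<l> x)"
    and LUnit_natural: "f \<in> Hom V x y \<Longrightarrow> \<l> y \<cdot> (\<iota> \<k> \<otimes> f) = f \<cdot> \<l> x"
    and RUnit_in_Hom: "x \<in> Obj V \<Longrightarrow> \<r> x \<in> Hom V (x \<odot> \<k>) x"
    and RUnit_iso: "x \<in> Obj V \<Longrightarrow> iso_arrow V (\<r> x)"
    and RUnit_natural: "f \<in> Hom V x y \<Longrightarrow> \<r> y \<cdot> (f \<otimes> \<iota> \<k>) = f \<cdot> \<r> x"
    and pentagon:
      "\<lbrakk>w \<in> Obj V; x \<in> Obj V; y \<in> Obj V; z \<in> Obj V\<rbrakk>
        \<Longrightarrow> (\<iota> w \<otimes> \<a> x y z) \<cdot> \<a> w (x \<odot> y) z \<cdot> (\<a> w x y \<otimes> \<iota> z)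
            = \<a> w x (y \<odot> z) \<cdot> \<a> (w \<odot> x) y z"
    and triangle:
      "\<lbrakk>x \<in> Obj V; y \<in> Obj V\<rbrakk> \<Longrightarrow> (\<iota> x \<otimes> \<l> y) \<cdot> \<a> x \<k> y = \<r> x \<otimes> \<iota> y"

locale symmetric_monoidal_cat = monoidal_cat V for V :: "('o, 'm) smcat" (structure) +
  assumes Symm_in_Hom: "\<lbrakk>x \<in> Obj V; y \<in> Obj V\<rbrakk> \<Longrightarrow> \<tau> x y \<in> Hom V (x \<odot> y) (y \<odot> x)"
    and Symm_natural:
      "\<lbrakk>f \<in> Hom V x x'; g \<in> Hom V y y'\<rbrakk> \<Longrightarrow> \<tau> x' y' \<cdot> (f \<otimes> g) = (g \<otimes> f) \<cdot> \<tau> x y"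
    and Symm_involutive: "\<lbrakk>x \<in> Obj V; y \<in> Obj V\<rbrakk> \<Longrightarrow> \<tau> y x \<cdot> \<tau> x y = \<iota> (x \<odot> y)"
    and hexagon:
      "\<lbrakk>x \<in> Obj V; y \<in> Obj V; z \<in> Obj V\<rbrakk>
        \<Longrightarrow> \<a> y z x \<cdot> \<tau> x (y \<odot> z) \<cdot> \<a> x y z
            = (\<iota> y \<otimes> \<tau> x z) \<cdot> \<a> y x z \<cdot> (\<tau> x y \<otimes> \<iota> z)"


section \<open>Coequalizers\<close>

definition parallel :: "('o, 'm) smcat \<Rightarrow> 'm \<Rightarrow> 'm \<Rightarrow> bool" where
  "parallel V f g \<longleftrightarrow> f \<in> Arr V \<and> g \<in> Arr V \<and> Dom V f = Dom V g \<and> Cod V f = Cod V g"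

definition is_coequalizer :: "('o, 'm) smcat \<Rightarrow> 'm \<Rightarrow> 'm \<Rightarrow> 'm \<Rightarrow> bool" where
  "is_coequalizer V f g q \<longleftrightarrow>
     parallel V f g \<and> q \<in> Arr V \<and> Dom V q = Cod V f \<and> q \<cdot> f = q \<cdot> g \<and>
     (\<forall>h \<in> Arr V. Dom V h = Cod V f \<and> h \<cdot> f = h \<cdot> g \<longrightarrow>
        (\<exists>!u. u \<in> Hom V (Cod V q) (Cod V h) \<and> u \<cdot> q = h))"
  for V (structure)

definition has_coequalizers :: "('o, 'm) smcat \<Rightarrow> bool" where
  "has_coequalizers V \<longleftrightarrow> (\<forall>f g. parallel V f g \<longrightarrow> (\<exists>q. is_coequalizer V f g q))"

definition coequalizers_commute_with_tensor :: "('o, 'm) smcat \<Rightarrow> bool" where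
  "coequalizers_commute_with_tensor V \<longleftrightarrow>
     (\<forall>f g q. \<forall>w \<in> Obj V. is_coequalizer V f g q \<longrightarrow>
        is_coequalizer V (f \<otimes> \<iota> w) (g \<otimes> \<iota> w) (q \<otimes> \<iota> w) \<and>
        is_coequalizer V (\<iota> w \<otimes> f) (\<iota> w \<otimes> g) (\<iota> w \<otimes> q))"
  for V (structure)

definition coeq :: "('o, 'm) smcat \<Rightarrow> 'm \<Rightarrow> 'm \<Rightarrow> 'm" where
  "coeq V f g = (SOME q. is_coequalizer V f g q)"


section \<open>Internal monoids\<close>

record ('o, 'm) imon =
  mobj :: 'o
  mmul :: 'm
  mone :: 'm

definition internal_monoid :: "('o, 'm) smcat \<Rightarrow> ('o, 'm, 'z) imon_scheme \<Rightarrow> bool" where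
  "internal_monoid V M \<longleftrightarrow>
     mobj M \<in> Obj V \<and>
     mmul M \<in> Hom V (mobj M \<odot> mobj M) (mobj M) \<and>
     mone M \<in> Hom V \<k> (mobj M) \<and>
     mmul M \<cdot> (mmul M \<otimes> \<iota> (mobj M))
       = mmul M \<cdot> (\<iota> (mobj M) \<otimes> mmul M) \<cdot> \<a> (mobj M) (mobj M) (mobj M) \<and>
     mmul M \<cdot> (mone M \<otimes> \<iota> (mobj M)) = \<l> (mobj M) \<and>
     mmul M \<cdot> (\<iota> (mobj M) \<otimes> mone M) = \<r> (mobj M)"
  for V (structure)

definition op_monoid :: "('o, 'm) smcat \<Rightarrow> ('o, 'm, 'z) imon_scheme \<Rightarrow> ('o, 'm) imon" where
  "op_monoid V M = \<lparr>mobj = mobj M, mmul = mmul M \<cdot> \<tau> (mobj M) (mobj M), mone = mone M\<rparr>"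
  for V (structure)

definition monoid_morphism ::
  "('o, 'm) smcat \<Rightarrow> ('o, 'm, 'y) imon_scheme \<Rightarrow> ('o, 'm, 'z) imon_scheme \<Rightarrow> 'm \<Rightarrow> bool" where
  "monoid_morphism V M N f \<longleftrightarrow>
     f \<in> Hom V (mobj M) (mobj N) \<and>
     f \<cdot> mmul M = mmul N \<cdot> (f \<otimes> f) \<and>
     f \<cdot> mone M = mone N"
  for V (structure)

definition middle_swap :: "('o, 'm) smcat \<Rightarrow> 'o \<Rightarrow> 'o \<Rightarrow> 'o \<Rightarrow> 'o \<Rightarrow> 'm" where
  \<comment> \<open>the arrow \<open>id \<otimes> \<tau> \<otimes> id\<close> from \<open>(w \<odot> x) \<odot> (y \<odot> z)\<close> to \<open>(w \<odot> y) \<odot> (x \<odot> z)\<close>\<close>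
  "middle_swap V w x y z =
     Inv V (\<a> w y (x \<odot> z)) \<cdot>
     (\<iota> w \<otimes> (\<a> y x z \<cdot> (\<tau> x y \<otimes> \<iota> z) \<cdot> Inv V (\<a> x y z))) \<cdot>
     \<a> w x (y \<odot> z)"
  for V (structure)

definition tensor_square_mult :: "('o, 'm) smcat \<Rightarrow> ('o, 'm, 'z) imon_scheme \<Rightarrow> 'm" where
  "tensor_square_mult V H =
     (mmul H \<otimes> mmul H) \<cdot> middle_swap V (mobj H) (mobj H) (mobj H) (mobj H)"
  for V (structure)


section \<open>Actions and internal bimodules\<close>

definition left_action :: "('o, 'm) smcat \<Rightarrow> ('o, 'm, 'z) imon_scheme \<Rightarrow> 'o \<Rightarrow> 'm \<Rightarrow> bool" where
  "left_action V M x n \<longleftrightarrow>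
     x \<in> Obj V \<and> n \<in> Hom V (mobj M \<odot> x) x \<and>
     n \<cdot> (mmul M \<otimes> \<iota> x) = n \<cdot> (\<iota> (mobj M) \<otimes> n) \<cdot> \<a> (mobj M) (mobj M) x \<and>
     n \<cdot> (mone M \<otimes> \<iota> x) = \<l> x"
  for V (structure)

definition right_action :: "('o, 'm) smcat \<Rightarrow> ('o, 'm, 'z) imon_scheme \<Rightarrow> 'o \<Rightarrow> 'm \<Rightarrow> bool" where
  "right_action V M x n \<longleftrightarrow>
     x \<in> Obj V \<and> n \<in> Hom V (x \<odot> mobj M) x \<and>
     n \<cdot> (n \<otimes> \<iota> (mobj M)) = n \<cdot> (\<iota> x \<otimes> mmul M) \<cdot> \<a> x (mobj M) (mobj M) \<and>
     n \<cdot> (\<iota> x \<otimes> mone M) = \<r> x"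
  for V (structure)

record ('o, 'm) bimod =
  bobj :: 'o
  lact :: 'm
  ract :: 'm

definition bimodule :: "('o, 'm) smcat \<Rightarrow> ('o, 'm, 'z) imon_scheme \<Rightarrow> ('o, 'm) bimod \<Rightarrow> bool" where
  "bimodule V M X \<longleftrightarrow>
     left_action V M (bobj X) (lact X) \<and>
     right_action V M (bobj X) (ract X) \<and>
     ract X \<cdot> (lact X \<otimes> \<iota> (mobj M))
       = lact X \<cdot> (\<iota> (mobj M) \<otimes> ract X) \<cdot> \<a> (mobj M) (bobj X) (mobj M)"
  for V (structure)

definition bimodule_morphism ::
  "('o, 'm) smcat \<Rightarrow> ('o, 'm, 'z) imon_scheme \<Rightarrow> ('o, 'm) bimod \<Rightarrow> ('o, 'm) bimod \<Rightarrow> 'm \<Rightarrow> bool" where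
  "bimodule_morphism V M X Y f \<longleftrightarrow>
     bimodule V M X \<and> bimodule V M Y \<and> f \<in> Hom V (bobj X) (bobj Y) \<and>
     f \<cdot> lact X = lact Y \<cdot> (\<iota> (mobj M) \<otimes> f) \<and>
     f \<cdot> ract X = ract Y \<cdot> (f \<otimes> \<iota> (mobj M))"
  for V (structure)

definition regular_bimodule :: "('o, 'm, 'z) imon_scheme \<Rightarrow> ('o, 'm) bimod" where
  "regular_bimodule M = \<lparr>bobj = mobj M, lact = mmul M, ract = mmul M\<rparr>"

definition bal_proj ::
  "('o, 'm) smcat \<Rightarrow> ('o, 'm, 'z) imon_scheme \<Rightarrow> ('o, 'm) bimod \<Rightarrow> ('o, 'm) bimod \<Rightarrow> 'm" where
  \<comment> \<open>the canonical arrow \<open>\<pi>\<close> from \<open>X \<otimes> Y\<close> to the tensor product of \<open>X\<close> and \<open>Y\<close> over \<open>M\<close>\<close>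
  "bal_proj V M X Y =
     coeq V (ract X \<otimes> \<iota> (bobj Y)) ((\<iota> (bobj X) \<otimes> lact Y) \<cdot> \<a> (bobj X) (mobj M) (bobj Y))"
  for V (structure)

definition induced_bimodule ::
  "('o, 'm) smcat \<Rightarrow> ('o, 'm, 'z) imon_scheme \<Rightarrow> 'm \<Rightarrow> ('o, 'm) bimod \<Rightarrow> ('o, 'm) bimod \<Rightarrow> ('o, 'm) bimod" where
  \<comment> \<open>the \<open>N\<close>-bimodule structure on the codomain of \<open>p\<close>, where \<open>p\<close> starts at \<open>bobj X \<odot> bobj Y\<close>,
     induced by the left \<open>N\<close>-action on \<open>X\<close> and the right \<open>N\<close>-action on \<open>Y\<close>\<close>
  "induced_bimodule V N p X Y =
     \<lparr>bobj = Cod V p,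
      lact = (THE n. n \<in> Hom V (mobj N \<odot> Cod V p) (Cod V p) \<and>
                n \<cdot> (\<iota> (mobj N) \<otimes> p)
                  = p \<cdot> (lact X \<otimes> \<iota> (bobj Y)) \<cdot> Inv V (\<a> (mobj N) (bobj X) (bobj Y))),
      ract = (THE n. n \<in> Hom V (Cod V p \<odot> mobj N) (Cod V p) \<and>
                n \<cdot> (p \<otimes> \<iota> (mobj N))
                  = p \<cdot> (\<iota> (bobj X) \<otimes> ract Y) \<cdot> \<a> (bobj X) (bobj Y) (mobj N))\<rparr>"
  for V (structure)


section \<open>Comonoids in the monoidal category of internal bimodules\<close>

definition bal_tensor ::
  "('o, 'm) smcat \<Rightarrow> ('o, 'm, 'z) imon_scheme \<Rightarrow> ('o, 'm) bimod \<Rightarrow> ('o, 'm) bimod \<Rightarrow> ('o, 'm) bimod"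
  where
  "bal_tensor V M X Y = induced_bimodule V M (bal_proj V M X Y) X Y"

definition bal_tensor_arr ::
  "('o, 'm) smcat \<Rightarrow> ('o, 'm, 'z) imon_scheme \<Rightarrow> ('o, 'm) bimod \<Rightarrow> ('o, 'm) bimod \<Rightarrow>
   ('o, 'm) bimod \<Rightarrow> ('o, 'm) bimod \<Rightarrow> 'm \<Rightarrow> 'm \<Rightarrow> 'm" where
  \<comment> \<open>for \<open>f\<close> from \<open>X\<close> to \<open>X'\<close> and \<open>g\<close> from \<open>Y\<close> to \<open>Y'\<close>\<close>
  "bal_tensor_arr V M X X' Y Y' f g =
     (THE u. u \<in> Hom V (bobj (bal_tensor V M X Y)) (bobj (bal_tensor V M X' Y')) \<and>
        u \<cdot> bal_proj V M X Y = bal_proj V M X' Y' \<cdot> (f \<otimes> g))"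
  for V (structure)

definition bal_assoc ::
  "('o, 'm) smcat \<Rightarrow> ('o, 'm, 'z) imon_scheme \<Rightarrow> ('o, 'm) bimod \<Rightarrow> ('o, 'm) bimod \<Rightarrow> ('o, 'm) bimod \<Rightarrow> 'm" where
  "bal_assoc V M X Y Z =
     (THE u. u \<in> Hom V (bobj (bal_tensor V M (bal_tensor V M X Y) Z))
                       (bobj (bal_tensor V M X (bal_tensor V M Y Z))) \<and>
        u \<cdot> bal_proj V M (bal_tensor V M X Y) Z \<cdot> (bal_proj V M X Y \<otimes> \<iota> (bobj Z))
          = bal_proj V M X (bal_tensor V M Y Z) \<cdot> (\<iota> (bobj X) \<otimes> bal_proj V M Y Z)
              \<cdot> \<a> (bobj X) (bobj Y) (bobj Z))"
  for V (structure)

definition bal_lunit ::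
  "('o, 'm) smcat \<Rightarrow> ('o, 'm, 'z) imon_scheme \<Rightarrow> ('o, 'm) bimod \<Rightarrow> 'm" where
  "bal_lunit V M X =
     (THE u. u \<in> Hom V (bobj (bal_tensor V M (regular_bimodule M) X)) (bobj X) \<and>
        u \<cdot> bal_proj V M (regular_bimodule M) X = lact X)"
  for V (structure)

definition bal_runit ::
  "('o, 'm) smcat \<Rightarrow> ('o, 'm, 'z) imon_scheme \<Rightarrow> ('o, 'm) bimod \<Rightarrow> 'm" where
  "bal_runit V M X =
     (THE u. u \<in> Hom V (bobj (bal_tensor V M X (regular_bimodule M))) (bobj X) \<and>
        u \<cdot> bal_proj V M X (regular_bimodule M) = ract X)"
  for V (structure)

definition bimodule_comonoid ::
  "('o, 'm) smcat \<Rightarrow> ('o, 'm, 'z) imon_scheme \<Rightarrow> ('o, 'm) bimod \<Rightarrow> 'm \<Rightarrow> 'm \<Rightarrow> bool" where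
  "bimodule_comonoid V M X d e \<longleftrightarrow>
     bimodule_morphism V M X (bal_tensor V M X X) d \<and>
     bimodule_morphism V M X (regular_bimodule M) e \<and>
     bal_assoc V M X X X \<cdot> bal_tensor_arr V M X (bal_tensor V M X X) X X d (\<iota> (bobj X)) \<cdot> d
       = bal_tensor_arr V M X X X (bal_tensor V M X X) (\<iota> (bobj X)) d \<cdot> d \<and>
     bal_lunit V M X \<cdot> bal_tensor_arr V M X (regular_bimodule M) X X e (\<iota> (bobj X)) \<cdot> d
       = \<iota> (bobj X) \<and>
     bal_runit V M X \<cdot> bal_tensor_arr V M X X X (regular_bimodule M) (\<iota> (bobj X)) e \<cdot> d
       = \<iota> (bobj X)"
  for V (structure)


section \<open>Internal bialgebroids\<close>

definition commuting_pair ::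
  "('o, 'm) smcat \<Rightarrow> ('o, 'm, 'y) imon_scheme \<Rightarrow> ('o, 'm, 'z) imon_scheme \<Rightarrow> 'm \<Rightarrow> 'm \<Rightarrow> bool" where
  "commuting_pair V M H al be \<longleftrightarrow>
     monoid_morphism V M H al \<and>
     monoid_morphism V (op_monoid V M) H be \<and>
     mmul H \<cdot> \<tau> (mobj H) (mobj H) \<cdot> (al \<otimes> be) = mmul H \<cdot> (al \<otimes> be)"
  for V (structure)

definition left_mult_bimodule ::
  "('o, 'm) smcat \<Rightarrow> ('o, 'm, 'z) imon_scheme \<Rightarrow> 'm \<Rightarrow> 'm \<Rightarrow> ('o, 'm) bimod" where
  "left_mult_bimodule V H al be =
     \<lparr>bobj = mobj H,
      lact = mmul H \<cdot> (al \<otimes> \<iota> (mobj H)),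
      ract = mmul H \<cdot> \<tau> (mobj H) (mobj H) \<cdot> (\<iota> (mobj H) \<otimes> be)\<rparr>"
  for V (structure)

definition right_mult_bimodule ::
  "('o, 'm) smcat \<Rightarrow> ('o, 'm, 'z) imon_scheme \<Rightarrow> 'm \<Rightarrow> 'm \<Rightarrow> ('o, 'm) bimod" where
  "right_mult_bimodule V H al be =
     \<lparr>bobj = mobj H,
      lact = mmul H \<cdot> \<tau> (mobj H) (mobj H) \<cdot> (be \<otimes> \<iota> (mobj H)),
      ract = mmul H \<cdot> (\<iota> (mobj H) \<otimes> al)\<rparr>"
  for V (structure)

record ('o, 'm) bialgd = "('o, 'm) imon" +
  alpha :: 'm
  beta :: 'm
  comul :: 'm
  counit :: 'm

abbreviation left_bimod :: "('o, 'm) smcat \<Rightarrow> ('o, 'm) bialgd \<Rightarrow> ('o, 'm) bimod" where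
  "left_bimod V H \<equiv> left_mult_bimodule V H (alpha H) (beta H)"

abbreviation right_bimod :: "('o, 'm) smcat \<Rightarrow> ('o, 'm) bialgd \<Rightarrow> ('o, 'm) bimod" where
  "right_bimod V H \<equiv> right_mult_bimodule V H (alpha H) (beta H)"

text \<open>
  Below, \<open>p\<close> stands for the canonical arrow \<open>\<pi>\<close>. The arrows \<open>rho\<close> and \<open>lam\<close> are determined
  uniquely by their defining equations, because tensoring preserves the coequalizer \<open>p\<close>; the
  existential quantifiers in the definitions of the bialgebroids therefore only name them.
\<close>

definition left_bialgebroid_rho :: "('o, 'm) smcat \<Rightarrow> ('o, 'm) bialgd \<Rightarrow> 'm \<Rightarrow> 'm \<Rightarrow> bool" where
  "left_bialgebroid_rho V H p rho \<longleftrightarrow>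
     rho \<in> Hom V (Cod V p \<odot> (mobj H \<odot> mobj H)) (Cod V p) \<and>
     rho \<cdot> (p \<otimes> \<iota> (mobj H \<odot> mobj H)) = p \<cdot> tensor_square_mult V H"
  for V (structure)

definition left_bialgebroid_lam :: "('o, 'm) smcat \<Rightarrow> ('o, 'm) bialgd \<Rightarrow> 'm \<Rightarrow> 'm \<Rightarrow> 'm \<Rightarrow> bool" where
  "left_bialgebroid_lam V H p rho lam \<longleftrightarrow>
     lam \<in> Hom V (mobj H \<odot> Cod V p) (Cod V p) \<and>
     lam \<cdot> (\<iota> (mobj H) \<otimes> p) = rho \<cdot> (comul H \<otimes> \<iota> (mobj H \<odot> mobj H))"
  for V (structure)

definition left_bialgebroid ::
  "('o, 'm) smcat \<Rightarrow> ('o, 'm, 'z) imon_scheme \<Rightarrow> ('o, 'm) bialgd \<Rightarrow> bool" where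
  "left_bialgebroid V L H \<longleftrightarrow>
     internal_monoid V L \<and>
     internal_monoid V H \<and>
     commuting_pair V L H (alpha H) (beta H) \<and>
     bimodule_comonoid V L (left_bimod V H) (comul H) (counit H) \<and>
     (\<exists>p rho lam.
        p = bal_proj V L (left_bimod V H) (left_bimod V H) \<and>
        left_bialgebroid_rho V H p rho \<and>
        rho \<cdot> (comul H \<otimes> (beta H \<otimes> mone H)) \<cdot> (\<iota> (mobj H) \<otimes> Inv V (\<r> (mobj L)))
          = rho \<cdot> (comul H \<otimes> (mone H \<otimes> alpha H)) \<cdot> (\<iota> (mobj H) \<otimes> Inv V (\<l> (mobj L))) \<and>
        left_bialgebroid_lam V H p rho lam \<and>
        left_action V H (Cod V p) lam) \<and>
     counit H \<cdot> mone H = mone L \<and>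
     counit H \<cdot> mmul H \<cdot> (\<iota> (mobj H) \<otimes> (alpha H \<cdot> counit H)) = counit H \<cdot> mmul H \<and>
     counit H \<cdot> mmul H = counit H \<cdot> mmul H \<cdot> (\<iota> (mobj H) \<otimes> (beta H \<cdot> counit H))"
  for V (structure)

definition right_bialgebroid_lam :: "('o, 'm) smcat \<Rightarrow> ('o, 'm) bialgd \<Rightarrow> 'm \<Rightarrow> 'm \<Rightarrow> bool" where
  "right_bialgebroid_lam V H p lam \<longleftrightarrow>
     lam \<in> Hom V ((mobj H \<odot> mobj H) \<odot> Cod V p) (Cod V p) \<and>
     lam \<cdot> (\<iota> (mobj H \<odot> mobj H) \<otimes> p) = p \<cdot> tensor_square_mult V H"
  for V (structure)

definition right_bialgebroid_rho :: "('o, 'm) smcat \<Rightarrow> ('o, 'm) bialgd \<Rightarrow> 'm \<Rightarrow> 'm \<Rightarrow> 'm \<Rightarrow> bool" where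
  "right_bialgebroid_rho V H p lam rho \<longleftrightarrow>
     rho \<in> Hom V (Cod V p \<odot> mobj H) (Cod V p) \<and>
     rho \<cdot> (p \<otimes> \<iota> (mobj H)) = lam \<cdot> (\<iota> (mobj H \<odot> mobj H) \<otimes> comul H)"
  for V (structure)

definition right_bialgebroid ::
  "('o, 'm) smcat \<Rightarrow> ('o, 'm, 'z) imon_scheme \<Rightarrow> ('o, 'm) bialgd \<Rightarrow> bool" where
  "right_bialgebroid V R H \<longleftrightarrow>
     internal_monoid V R \<and>
     internal_monoid V H \<and>
     commuting_pair V R H (alpha H) (beta H) \<and>
     bimodule_comonoid V R (right_bimod V H) (comul H) (counit H) \<and>
     (\<exists>p lam rho.
        p = bal_proj V R (right_bimod V H) (right_bimod V H) \<and>
        right_bialgebroid_lam V H p lam \<and>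
        lam \<cdot> ((mone H \<otimes> beta H) \<otimes> comul H) \<cdot> (Inv V (\<l> (mobj R)) \<otimes> \<iota> (mobj H))
          = lam \<cdot> ((alpha H \<otimes> mone H) \<otimes> comul H) \<cdot> (Inv V (\<r> (mobj R)) \<otimes> \<iota> (mobj H)) \<and>
        right_bialgebroid_rho V H p lam rho \<and>
        right_action V H (Cod V p) rho) \<and>
     counit H \<cdot> mone H = mone R \<and>
     counit H \<cdot> mmul H \<cdot> ((alpha H \<cdot> counit H) \<otimes> \<iota> (mobj H)) = counit H \<cdot> mmul H \<and>
     counit H \<cdot> mmul H = counit H \<cdot> mmul H \<cdot> ((beta H \<cdot> counit H) \<otimes> \<iota> (mobj H))"
  for V (structure)

end

theory Submission
  imports Defs
begin

text \<open>
  In Sweedler notation, let \<open>\<Delta>\<close> be the comultiplication of a left bialgebroid. Since \<open>\<Delta>\<close> is unital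
  and \<open>L\<close>-bilinear, \<open>\<Delta> (\<beta> l) = 1 \<otimes> \<beta> l\<close> and \<open>\<Delta> (\<alpha> l) = \<alpha> l \<otimes> 1\<close>. The hypotheses say that
  \<open>\<alpha>\<^sub>R r = \<beta> (\<epsilon> (\<alpha>\<^sub>R r))\<close> and \<open>\<beta>\<^sub>R r = \<alpha> (\<epsilon> (\<beta>\<^sub>R r))\<close>, hence \<open>\<Delta> (\<alpha>\<^sub>R r) = 1 \<otimes> \<alpha>\<^sub>R r\<close> and
  \<open>\<Delta> (\<beta>\<^sub>R r) = \<beta>\<^sub>R r \<otimes> 1\<close>. Multiplicativity of \<open>\<Delta>\<close> then yields
  \<open>\<Delta> (h \<alpha>\<^sub>R r) = h\<^sub>1 \<otimes> h\<^sub>2 \<alpha>\<^sub>R r\<close> and \<open>\<Delta> (h \<beta>\<^sub>R r) = h\<^sub>1 \<beta>\<^sub>R r \<otimes> h\<^sub>2\<close>, which is the \<open>R\<close>-bilinearity.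
  The statement for right bialgebroids is the one for left bialgebroids in the category with reversed
  tensor product.
\<close>

section \<open>Monoidal categories and the reversed tensor product\<close>

text \<open>Associators and unitors are explicit arrows throughout, so the coherence facts in use
  (unitors on products, symmetry against unitors, reversal of three factors) are derived from
  pentagon, triangle and hexagon. An element r of the overview becomes an arrow \<open>f\<close> out
  of an arbitrary object \<open>x\<close>, and an equation between elements picks up a unitor, as in
  \<open>\<Delta> \<cdot> f \<cdot> \<l> x = p \<cdot> (\<eta> \<otimes> f)\<close>; being an
  isomorphism, it can be cancelled at the end. The claim also contains that the target is an
  R-bimodule. Its actions are definite descriptions, so they must be constructed by factoring
  through \<open>p\<close>, and their laws are checked after precomposing with tensor multiples of
  \<open>p\<close>, which are again coequalizers. Reversal is delicate at one point:
  \<open>bal_proj\<close> is a chosen coequalizer, and the choice made for the reversed pair may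
  differ. The central argument therefore speaks of an arbitrary coequalizer \<open>p\<close>, a
  notion that survives reversal.\<close>

context cat
begin

lemma Idn_simps [simp]:
  assumes "x \<in> Obj V"
  shows "\<iota> x \<in> Arr V" "Dom V (\<iota> x) = x" "Cod V (\<iota> x) = x"
  using Idn_in_Hom[OF assms] by (auto simp: Hom_def)

lemma Comp_simps [simp]:
  assumes "f \<in> Arr V" "g \<in> Arr V" "Dom V g = Cod V f"
  shows "g \<cdot> f \<in> Arr V" "Dom V (g \<cdot> f) = Dom V f" "Cod V (g \<cdot> f) = Cod V g"
  using Comp_in_Hom[of f "Dom V f" "Cod V f" g "Cod V g"] assms by (auto simp: Hom_def)

lemma Dom_Cod_Obj [simp]: "f \<in> Arr V \<Longrightarrow> Dom V f \<in> Obj V" "f \<in> Arr V \<Longrightarrow> Cod V f \<in> Obj V"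
  by (simp_all add: Dom_closed Cod_closed)

lemma Comp_Idn [simp]:
  "\<lbrakk>f \<in> Arr V; Dom V f = x\<rbrakk> \<Longrightarrow> f \<cdot> \<iota> x = f"
  "\<lbrakk>f \<in> Arr V; Cod V f = x\<rbrakk> \<Longrightarrow> \<iota> x \<cdot> f = f"
  using Comp_Idn_right[of f] Comp_Idn_left[of f] by (auto simp: Hom_def)

lemma comp_assoc:
  "\<lbrakk>f \<in> Arr V; g \<in> Arr V; h \<in> Arr V; Dom V g = Cod V f; Dom V h = Cod V g\<rbrakk>
    \<Longrightarrow> (h \<cdot> g) \<cdot> f = h \<cdot> g \<cdot> f"
  using Comp_assoc[of f "Dom V f" "Cod V f" g "Cod V g" h "Cod V h"] by (auto simp: Hom_def)

text \<open>In right-nested normal form a product \<open>g \<cdot> f\<close> stops being a subterm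
  as soon as another factor follows; this carries an equation between two-fold composites into such
  a context.\<close>

lemma comp_extend:
  "\<lbrakk>g \<cdot> f = g' \<cdot> f'; f \<in> Arr V; g \<in> Arr V; Dom V g = Cod V f;
    f' \<in> Arr V; g' \<in> Arr V; Dom V g' = Cod V f'; e \<in> Arr V; Dom V f = Cod V e; Dom V f' = Cod V e\<rbrakk>
    \<Longrightarrow> g \<cdot> f \<cdot> e = g' \<cdot> f' \<cdot> e"
  using comp_assoc[of e f g] comp_assoc[of e f' g'] by simp

section \<open>Isomorphisms, inverses and cancellation\<close>

lemma inverse_arrows_unique:
  assumes "inverse_arrows V f g" "inverse_arrows V f g'"
  shows "g = g'"
proof -
  note * = assms[unfolded inverse_arrows_def Hom_def, simplified]
  have "g = g \<cdot> f \<cdot> g'" using * by simp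
  also have "\<dots> = g'" using * comp_assoc[of g' f g] by simp
  finally show ?thesis .
qed

lemma Inv_eqI: "inverse_arrows V f g \<Longrightarrow> Inv V f = g"
  unfolding Inv_def using inverse_arrows_unique by blast

lemma inverse_arrows_Inv: "iso_arrow V f \<Longrightarrow> inverse_arrows V f (Inv V f)"
  unfolding iso_arrow_def using Inv_eqI by auto

lemma inverse_arrows_sym: "inverse_arrows V f g \<Longrightarrow> inverse_arrows V g f"
  by (auto simp: inverse_arrows_def Hom_def)

lemma iso_Arr: "iso_arrow V f \<Longrightarrow> f \<in> Arr V"
  by (auto simp: iso_arrow_def inverse_arrows_def)

lemma Inv_simps [simp]:
  assumes "iso_arrow V f"
  shows "Inv V f \<in> Arr V" "Dom V (Inv V f) = Cod V f" "Cod V (Inv V f) = Dom V f"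
    "Inv V f \<cdot> f = \<iota> (Dom V f)" "f \<cdot> Inv V f = \<iota> (Cod V f)"
    "iso_arrow V (Inv V f)" "Inv V (Inv V f) = f"
  using inverse_arrows_Inv[OF assms] inverse_arrows_sym[OF inverse_arrows_Inv[OF assms]] Inv_eqI
  by (auto simp: inverse_arrows_def Hom_def iso_arrow_def)

lemma Inv_simps_tail [simp]:
  assumes f: "iso_arrow V f" and g: "g \<in> Arr V"
  shows "Cod V g = Dom V f \<Longrightarrow> Inv V f \<cdot> f \<cdot> g = g"
    "Cod V g = Cod V f \<Longrightarrow> f \<cdot> Inv V f \<cdot> g = g"
proof -
  show "Inv V f \<cdot> f \<cdot> g = g" if "Cod V g = Dom V f"
  proof -
    have "Inv V f \<cdot> f \<cdot> g = (Inv V f \<cdot> f) \<cdot> g"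
      by (rule comp_assoc[symmetric]) (use f g that in \<open>simp_all add: iso_Arr\<close>)
    then show ?thesis using f g that by simp
  qed
  show "f \<cdot> Inv V f \<cdot> g = g" if "Cod V g = Cod V f"
  proof -
    have "f \<cdot> Inv V f \<cdot> g = (f \<cdot> Inv V f) \<cdot> g"
      by (rule comp_assoc[symmetric]) (use f g that in \<open>simp_all add: iso_Arr\<close>)
    then show ?thesis using f g that by simp
  qed
qed

lemma inverse_arrows_Comp:
  assumes "inverse_arrows V f f'" "inverse_arrows V g g'" "Dom V g = Cod V f"
  shows "inverse_arrows V (g \<cdot> f) (f' \<cdot> g')"
proof -
  note * = assms[unfolded inverse_arrows_def Hom_def, simplified]
  have "g' \<cdot> g \<cdot> f = f" "f \<cdot> f' \<cdot> g' = g'"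
    using * comp_assoc[of f g g'] comp_assoc[of g' f' f] by simp_all
  then show ?thesis using * by (simp add: inverse_arrows_def Hom_def comp_assoc)
qed

lemma iso_Comp [simp]: "\<lbrakk>iso_arrow V f; iso_arrow V g; Dom V g = Cod V f\<rbrakk> \<Longrightarrow> iso_arrow V (g \<cdot> f)"
  unfolding iso_arrow_def using inverse_arrows_Comp by blast

lemma Inv_Comp:
  "\<lbrakk>iso_arrow V f; iso_arrow V g; Dom V g = Cod V f\<rbrakk> \<Longrightarrow> Inv V (g \<cdot> f) = Inv V f \<cdot> Inv V g"
  by (intro Inv_eqI inverse_arrows_Comp inverse_arrows_Inv)

lemma iso_Idn [simp]: "x \<in> Obj V \<Longrightarrow> iso_arrow V (\<iota> x)"
  by (auto simp: iso_arrow_def inverse_arrows_def Hom_def intro!: exI[of _ "\<iota> x"])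

lemma Inv_Idn [simp]: "x \<in> Obj V \<Longrightarrow> Inv V (\<iota> x) = \<iota> x"
  by (rule Inv_eqI) (simp add: inverse_arrows_def Hom_def)

lemma iso_cancel_right:
  assumes "g \<cdot> e = h \<cdot> e" "iso_arrow V e" "g \<in> Arr V" "h \<in> Arr V"
    "Dom V g = Cod V e" "Dom V h = Cod V e"
  shows "g = h"
proof -
  have "g = (g \<cdot> e) \<cdot> Inv V e" using assms(2-) iso_Arr[OF assms(2)] by (simp add: comp_assoc)
  also have "\<dots> = (h \<cdot> e) \<cdot> Inv V e" by (simp add: assms(1))
  also have "\<dots> = h" using assms(2-) iso_Arr[OF assms(2)] by (simp add: comp_assoc)
  finally show ?thesis .
qed

lemma iso_cancel_left:
  assumes "e \<cdot> g = e \<cdot> h" "iso_arrow V e" "g \<in> Arr V" "h \<in> Arr V"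
    "Cod V g = Dom V e" "Cod V h = Dom V e"
  shows "g = h"
proof -
  have "g = Inv V e \<cdot> e \<cdot> g" using assms(2-) iso_Arr[OF assms(2)] by simp
  also have "\<dots> = Inv V e \<cdot> e \<cdot> h" by (simp add: assms(1))
  also have "\<dots> = h" using assms(2-) iso_Arr[OF assms(2)] by simp
  finally show ?thesis .
qed

lemma coequalizer_Arr:
  "is_coequalizer V f g q \<Longrightarrow> f \<in> Arr V \<and> g \<in> Arr V \<and> Dom V f = Dom V g \<and> Cod V f = Cod V g \<and>
     q \<in> Arr V \<and> Dom V q = Cod V f \<and> q \<cdot> f = q \<cdot> g"
  by (auto simp: is_coequalizer_def parallel_def)

lemma coequalizer_factor:
  assumes "is_coequalizer V f g q" "h \<in> Arr V" "Dom V h = Cod V f" "h \<cdot> f = h \<cdot> g"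
  obtains u where "u \<in> Arr V" "Dom V u = Cod V q" "Cod V u = Cod V h" "u \<cdot> q = h"
  using assms unfolding is_coequalizer_def Hom_def by blast

text \<open>Both arrows factor the same composite \<open>u \<cdot> q\<close>, so uniqueness of the
  factorization identifies them. That the codomains agree is read off from the two
  composites.\<close>

lemma coequalizer_epi:
  assumes q: "is_coequalizer V f g q" and "u \<in> Arr V" "v \<in> Arr V"
    "Dom V u = Cod V q" "Dom V v = Cod V q" "u \<cdot> q = v \<cdot> q"
  shows "u = v"
proof -
  note * = coequalizer_Arr[OF q]
  have cod: "Cod V u = Cod V v" using assms * by (metis Comp_simps(3))
  have h: "(u \<cdot> q) \<cdot> f = (u \<cdot> q) \<cdot> g" using * assms by (simp add: comp_assoc)
  then have "\<exists>!w. w \<in> Hom V (Cod V q) (Cod V (u \<cdot> q)) \<and> w \<cdot> q = u \<cdot> q"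
    using q[unfolded is_coequalizer_def] * assms by (metis Comp_simps(1,2))
  then show ?thesis using assms cod * by (auto simp: Hom_def)
qed

end

section \<open>Tensor calculus and coherence of the unitors\<close>

context monoidal_cat
begin

lemma TensO_Unt_closed [simp]: "\<k> \<in> Obj V" "\<lbrakk>x \<in> Obj V; y \<in> Obj V\<rbrakk> \<Longrightarrow> x \<odot> y \<in> Obj V"
  by (simp_all add: Unt_closed TensO_closed)

lemma TensA_simps [simp]:
  assumes "f \<in> Arr V" "g \<in> Arr V"
  shows "f \<otimes> g \<in> Arr V" "Dom V (f \<otimes> g) = Dom V f \<odot> Dom V g" "Cod V (f \<otimes> g) = Cod V f \<odot> Cod V g"
  using TensA_in_Hom[of f "Dom V f" "Cod V f" g "Dom V g" "Cod V g"] assms by (auto simp: Hom_def)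

lemma TensA_Idn' [simp]: "\<lbrakk>x \<in> Obj V; y \<in> Obj V\<rbrakk> \<Longrightarrow> \<iota> x \<otimes> \<iota> y = \<iota> (x \<odot> y)"
  by (rule TensA_Idn)

lemma interchange:
  "\<lbrakk>f \<in> Arr V; f' \<in> Arr V; g \<in> Arr V; g' \<in> Arr V; Dom V f' = Cod V f; Dom V g' = Cod V g\<rbrakk>
    \<Longrightarrow> (f' \<otimes> g') \<cdot> (f \<otimes> g) = (f' \<cdot> f) \<otimes> (g' \<cdot> g)"
  by (rule TensA_Comp[symmetric]) (auto simp: Hom_def)

lemma interchange_tail:
  "\<lbrakk>f \<in> Arr V; f' \<in> Arr V; g \<in> Arr V; g' \<in> Arr V; Dom V f' = Cod V f; Dom V g' = Cod V g;
    h \<in> Arr V; Cod V h = Dom V f \<odot> Dom V g\<rbrakk>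
    \<Longrightarrow> (f' \<otimes> g') \<cdot> (f \<otimes> g) \<cdot> h = ((f' \<cdot> f) \<otimes> (g' \<cdot> g)) \<cdot> h"
  by (simp add: comp_assoc[symmetric] interchange)

lemma assoc_simps [simp]:
  assumes "x \<in> Obj V" "y \<in> Obj V" "z \<in> Obj V"
  shows "\<a> x y z \<in> Arr V" "Dom V (\<a> x y z) = (x \<odot> y) \<odot> z" "Cod V (\<a> x y z) = x \<odot> y \<odot> z"
    "iso_arrow V (\<a> x y z)"
  using Assoc_in_Hom[OF assms] Assoc_iso[OF assms] by (auto simp: Hom_def)

lemma unitor_simps [simp]:
  assumes "x \<in> Obj V"
  shows "\<l> x \<in> Arr V" "Dom V (\<l> x) = \<k> \<odot> x" "Cod V (\<l> x) = x" "iso_arrow V (\<l> x)"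
    "\<r> x \<in> Arr V" "Dom V (\<r> x) = x \<odot> \<k>" "Cod V (\<r> x) = x" "iso_arrow V (\<r> x)"
  using LUnit_in_Hom[OF assms] LUnit_iso[OF assms] RUnit_in_Hom[OF assms] RUnit_iso[OF assms]
  by (auto simp: Hom_def)

lemma assoc_natural:
  "\<lbrakk>f \<in> Arr V; g \<in> Arr V; h \<in> Arr V\<rbrakk>
    \<Longrightarrow> \<a> (Cod V f) (Cod V g) (Cod V h) \<cdot> ((f \<otimes> g) \<otimes> h) = (f \<otimes> g \<otimes> h) \<cdot> \<a> (Dom V f) (Dom V g) (Dom V h)"
  by (rule Assoc_natural) (auto simp: Hom_def)

lemma assoc_inv_natural:
  assumes "f \<in> Arr V" "g \<in> Arr V" "h \<in> Arr V"
  shows "Inv V (\<a> (Cod V f) (Cod V g) (Cod V h)) \<cdot> (f \<otimes> g \<otimes> h)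
    = ((f \<otimes> g) \<otimes> h) \<cdot> Inv V (\<a> (Dom V f) (Dom V g) (Dom V h))"
proof (rule iso_cancel_left[where e = "\<a> (Cod V f) (Cod V g) (Cod V h)"])
  have "\<a> (Cod V f) (Cod V g) (Cod V h) \<cdot> ((f \<otimes> g) \<otimes> h) \<cdot> Inv V (\<a> (Dom V f) (Dom V g) (Dom V h))
    = (f \<otimes> g \<otimes> h) \<cdot> \<a> (Dom V f) (Dom V g) (Dom V h) \<cdot> Inv V (\<a> (Dom V f) (Dom V g) (Dom V h))"
    using assms by (intro comp_extend assoc_natural) auto
  then show "\<a> (Cod V f) (Cod V g) (Cod V h) \<cdot> Inv V (\<a> (Cod V f) (Cod V g) (Cod V h)) \<cdot> (f \<otimes> g \<otimes> h)
    = \<a> (Cod V f) (Cod V g) (Cod V h) \<cdot> ((f \<otimes> g) \<otimes> h) \<cdot> Inv V (\<a> (Dom V f) (Dom V g) (Dom V h))"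
    using assms by simp
qed (use assms in auto)

lemma lunit_natural: "f \<in> Arr V \<Longrightarrow> \<l> (Cod V f) \<cdot> (\<iota> \<k> \<otimes> f) = f \<cdot> \<l> (Dom V f)"
  by (rule LUnit_natural) (auto simp: Hom_def)

lemma runit_natural: "f \<in> Arr V \<Longrightarrow> \<r> (Cod V f) \<cdot> (f \<otimes> \<iota> \<k>) = f \<cdot> \<r> (Dom V f)"
  by (rule RUnit_natural) (auto simp: Hom_def)

lemma inverse_arrows_TensA:
  "\<lbrakk>inverse_arrows V f f'; inverse_arrows V g g'\<rbrakk> \<Longrightarrow> inverse_arrows V (f \<otimes> g) (f' \<otimes> g')"
  by (auto simp: inverse_arrows_def Hom_def interchange)

lemma iso_TensA [simp]: "\<lbrakk>iso_arrow V f; iso_arrow V g\<rbrakk> \<Longrightarrow> iso_arrow V (f \<otimes> g)"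
  unfolding iso_arrow_def using inverse_arrows_TensA by blast

lemma Inv_TensA: "\<lbrakk>iso_arrow V f; iso_arrow V g\<rbrakk> \<Longrightarrow> Inv V (f \<otimes> g) = Inv V f \<otimes> Inv V g"
  by (intro Inv_eqI inverse_arrows_TensA inverse_arrows_Inv)

text \<open>Naturality of the left unitor conjugates \<open>\<iota> \<k> \<otimes> f\<close> into
  \<open>f\<close>, so tensoring with the unit loses nothing. Unit coherences below are proved after
  such a tensoring.\<close>

lemma unit_tensor_left_cancel:
  assumes "\<iota> \<k> \<otimes> f = \<iota> \<k> \<otimes> g" "f \<in> Arr V" "g \<in> Arr V" "Dom V f = Dom V g" "Cod V f = Cod V g"
  shows "f = g"
proof (rule iso_cancel_right[where e = "\<l> (Dom V f)"])
  show "f \<cdot> \<l> (Dom V f) = g \<cdot> \<l> (Dom V f)"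
    using assms lunit_natural[of f] lunit_natural[of g] by simp
qed (use assms in auto)

lemma unit_tensor_right_cancel:
  assumes "f \<otimes> \<iota> \<k> = g \<otimes> \<iota> \<k>" "f \<in> Arr V" "g \<in> Arr V" "Dom V f = Dom V g" "Cod V f = Cod V g"
  shows "f = g"
proof (rule iso_cancel_right[where e = "\<r> (Dom V f)"])
  show "f \<cdot> \<r> (Dom V f) = g \<cdot> \<r> (Dom V f)"
    using assms runit_natural[of f] runit_natural[of g] by simp
qed (use assms in auto)

lemma triangle_inv:
  assumes "x \<in> Obj V" "y \<in> Obj V"
  shows "(\<r> x \<otimes> \<iota> y) \<cdot> Inv V (\<a> x \<k> y) = \<iota> x \<otimes> \<l> y"
  using assms by (simp add: triangle[symmetric] comp_assoc)

text \<open>Kelly's argument: after tensoring with \<open>\<k>\<close> on the left, the identity is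
  what remains of the pentagon on \<open>\<k>\<close>, \<open>\<k>\<close>, \<open>x\<close>,
  \<open>y\<close> once triangles and naturality squares are filled in.\<close>

lemma lunit_tensor:
  assumes [simp]: "x \<in> Obj V" "y \<in> Obj V"
  shows "\<l> (x \<odot> y) \<cdot> \<a> \<k> x y = \<l> x \<otimes> \<iota> y"
proof (rule unit_tensor_left_cancel)
  \<comment> \<open>The two associators applied first on the three-arrow side of that pentagon; this
    isomorphism is cancelled at the end.\<close>
  let ?E = "\<a> \<k> (\<k> \<odot> x) y \<cdot> (\<a> \<k> \<k> x \<otimes> \<iota> y)"
  have "(\<iota> \<k> \<otimes> (\<l> (x \<odot> y) \<cdot> \<a> \<k> x y)) \<cdot> ?E = (\<iota> \<k> \<otimes> \<l> (x \<odot> y)) \<cdot> (\<iota> \<k> \<otimes> \<a> \<k> x y) \<cdot> ?E"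
    by (simp add: interchange_tail)
  also have "\<dots> = (\<iota> \<k> \<otimes> \<l> (x \<odot> y)) \<cdot> \<a> \<k> \<k> (x \<odot> y) \<cdot> \<a> (\<k> \<odot> \<k>) x y"
    by (simp add: pentagon)
  also have "\<dots> = (\<r> \<k> \<otimes> \<iota> (x \<odot> y)) \<cdot> \<a> (\<k> \<odot> \<k>) x y"
    by (simp add: comp_assoc[symmetric] triangle)
  also have "\<dots> = \<a> \<k> x y \<cdot> ((\<r> \<k> \<otimes> \<iota> x) \<otimes> \<iota> y)"
    using assoc_natural[of "\<r> \<k>" "\<iota> x" "\<iota> y"] by simp
  also have "\<dots> = \<a> \<k> x y \<cdot> ((\<iota> \<k> \<otimes> \<l> x) \<otimes> \<iota> y) \<cdot> (\<a> \<k> \<k> x \<otimes> \<iota> y)"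
    by (simp add: interchange triangle)
  also have "\<dots> = (\<iota> \<k> \<otimes> \<l> x \<otimes> \<iota> y) \<cdot> ?E"
    using assoc_natural[of "\<iota> \<k>" "\<l> x" "\<iota> y"] by (intro comp_extend) simp_all
  finally show "\<iota> \<k> \<otimes> (\<l> (x \<odot> y) \<cdot> \<a> \<k> x y) = \<iota> \<k> \<otimes> \<l> x \<otimes> \<iota> y"
    by (rule iso_cancel_right) simp_all
qed simp_all

text \<open>Naturality of \<open>\<l>\<close> at the arrow \<open>\<l> \<k>\<close> itself, with the
  isomorphism cancelled.\<close>

lemma lunit_unit_tensor: "\<l> (\<k> \<odot> \<k>) = \<iota> \<k> \<otimes> \<l> \<k>"
  by (rule iso_cancel_left[where e = "\<l> \<k>"]) (use lunit_natural[of "\<l> \<k>"] in simp_all)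

text \<open>After tensoring with \<open>\<k>\<close> on the right both sides become \<open>(\<iota>
  \<k> \<otimes> \<l> \<k>) \<cdot> \<a> \<k> \<k> \<k>\<close>: one by the two preceding lemmas,
  the other by the triangle.\<close>

lemma lunit_unit: "\<l> \<k> = \<r> \<k>"
proof (rule unit_tensor_right_cancel)
  show "\<l> \<k> \<otimes> \<iota> \<k> = \<r> \<k> \<otimes> \<iota> \<k>"
    using lunit_tensor[of \<k> \<k>] triangle[of \<k> \<k>] by (simp add: lunit_unit_tensor)
qed simp_all

end

text \<open>Only tensor data change, so homs, isomorphisms and coequalizers are literally those of
  \<open>V\<close>. The reversed associator runs the other way and hence is an inverse, and the
  unitors trade places. A monoid keeps its multiplication arrow, yet multiplication from the left
  becomes multiplication from the right; this is what turns right bialgebroids into left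
  ones.\<close>

definition rev_cat :: "('o, 'm) smcat \<Rightarrow> ('o, 'm) smcat" where
  "rev_cat V = V\<lparr>TensO := \<lambda>x y. TensO V y x, TensA := \<lambda>f g. TensA V g f,
     Assoc := \<lambda>x y z. Inv V (Assoc V z y x), LUnit := RUnit V, RUnit := LUnit V,
     Symm := \<lambda>x y. Symm V y x\<rparr>"

lemma rev_cat_simps [simp]:
  "Obj (rev_cat V) = Obj V" "Arr (rev_cat V) = Arr V" "Dom (rev_cat V) = Dom V"
  "Cod (rev_cat V) = Cod V" "Idn (rev_cat V) = Idn V" "Comp (rev_cat V) = Comp V"
  "TensO (rev_cat V) x y = TensO V y x" "TensA (rev_cat V) f g = TensA V g f"
  "Unt (rev_cat V) = Unt V" "Assoc (rev_cat V) x y z = Inv V (Assoc V z y x)"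
  "LUnit (rev_cat V) = RUnit V" "RUnit (rev_cat V) = LUnit V" "Symm (rev_cat V) x y = Symm V y x"
  by (simp_all add: rev_cat_def)

lemma rev_cat_defs [simp]:
  "Hom (rev_cat V) = Hom V" "inverse_arrows (rev_cat V) = inverse_arrows V"
  "iso_arrow (rev_cat V) = iso_arrow V" "Inv (rev_cat V) = Inv V"
  "parallel (rev_cat V) = parallel V" "is_coequalizer (rev_cat V) = is_coequalizer V"
  by (simp_all add: fun_eq_iff Hom_def inverse_arrows_def iso_arrow_def Inv_def parallel_def
      is_coequalizer_def)

section \<open>Symmetric monoidal axioms for the reversed tensor product\<close>

context monoidal_cat
begin

lemma pentagon_inv:
  assumes [simp]: "w \<in> Obj V" "x \<in> Obj V" "y \<in> Obj V" "z \<in> Obj V"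
  shows "(Inv V (\<a> w x y) \<otimes> \<iota> z) \<cdot> Inv V (\<a> w (x \<odot> y) z) \<cdot> (\<iota> w \<otimes> Inv V (\<a> x y z))
    = Inv V (\<a> (w \<odot> x) y z) \<cdot> Inv V (\<a> w x (y \<odot> z))"
  using arg_cong[OF pentagon[of w x y z], of "Inv V"]
  by (simp add: Inv_Comp Inv_TensA comp_assoc)

lemma monoidal_rev_cat: "monoidal_cat (rev_cat V)"
  by unfold_locales
    (auto simp: Hom_def interchange assoc_inv_natural[simplified]
      lunit_natural runit_natural pentagon_inv triangle_inv comp_assoc)

end

context symmetric_monoidal_cat
begin

lemma symm_simps [simp]:
  assumes "x \<in> Obj V" "y \<in> Obj V"
  shows "\<tau> x y \<in> Arr V" "Dom V (\<tau> x y) = x \<odot> y" "Cod V (\<tau> x y) = y \<odot> x"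
    "\<tau> y x \<cdot> \<tau> x y = \<iota> (x \<odot> y)" "iso_arrow V (\<tau> x y)" "Inv V (\<tau> x y) = \<tau> y x"
proof -
  note * = Symm_in_Hom[OF assms] Symm_in_Hom[OF assms(2,1)] Symm_involutive[OF assms]
    Symm_involutive[OF assms(2,1)]
  then have "inverse_arrows V (\<tau> x y) (\<tau> y x)" by (simp add: inverse_arrows_def Hom_def)
  then show "iso_arrow V (\<tau> x y)" "Inv V (\<tau> x y) = \<tau> y x"
    by (auto simp: iso_arrow_def intro: Inv_eqI)
qed (use Symm_in_Hom[OF assms] Symm_involutive[OF assms] in \<open>auto simp: Hom_def\<close>)

lemma symm_involutive_tail [simp]:
  assumes "x \<in> Obj V" "y \<in> Obj V" "f \<in> Arr V" "Cod V f = x \<odot> y"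
  shows "\<tau> y x \<cdot> \<tau> x y \<cdot> f = f"
proof -
  have "\<tau> y x \<cdot> \<tau> x y \<cdot> f = (\<tau> y x \<cdot> \<tau> x y) \<cdot> f"
    using assms by (intro comp_assoc[symmetric]) simp_all
  then show ?thesis using assms by simp
qed

lemma symm_natural:
  "\<lbrakk>f \<in> Arr V; g \<in> Arr V\<rbrakk>
    \<Longrightarrow> \<tau> (Cod V f) (Cod V g) \<cdot> (f \<otimes> g) = (g \<otimes> f) \<cdot> \<tau> (Dom V f) (Dom V g)"
  by (rule Symm_natural) (auto simp: Hom_def)

lemma symm_rev_cat: "symmetric_monoidal_cat (rev_cat V)"
proof -
  interpret rev: monoidal_cat "rev_cat V" by (rule monoidal_rev_cat)
  show ?thesis
  proof
    fix x y z
    assume "x \<in> Obj (rev_cat V)" "y \<in> Obj (rev_cat V)" "z \<in> Obj (rev_cat V)"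
    then have [simp]: "x \<in> Obj V" "y \<in> Obj V" "z \<in> Obj V" by simp_all
    show "\<a>\<^bsub>rev_cat V\<^esub> y z x \<cdot>\<^bsub>rev_cat V\<^esub> \<tau>\<^bsub>rev_cat V\<^esub> x (y \<odot>\<^bsub>rev_cat V\<^esub> z) \<cdot>\<^bsub>rev_cat V\<^esub> \<a>\<^bsub>rev_cat V\<^esub> x y z
      = (\<iota>\<^bsub>rev_cat V\<^esub> y \<otimes>\<^bsub>rev_cat V\<^esub> \<tau>\<^bsub>rev_cat V\<^esub> x z) \<cdot>\<^bsub>rev_cat V\<^esub> \<a>\<^bsub>rev_cat V\<^esub> y x z \<cdot>\<^bsub>rev_cat V\<^esub> (\<tau>\<^bsub>rev_cat V\<^esub> x y \<otimes>\<^bsub>rev_cat V\<^esub> \<iota>\<^bsub>rev_cat V\<^esub> z)"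
      \<comment> \<open>The reversed hexagon on \<open>x\<close>, \<open>y\<close>, \<open>z\<close>
        is the inverse of the original one with \<open>y\<close> and \<open>z\<close>
        interchanged.\<close>
      using arg_cong[OF hexagon[of x z y], of "Inv V"] 
      by (simp add: Inv_Comp Inv_TensA comp_assoc)
  qed (auto simp: Hom_def symm_natural)
qed

end

section \<open>Symmetry and the middle four interchange\<close>

context monoidal_cat
begin

text \<open>The mirror image of \<open>lunit_tensor\<close>, read off in the reversed
  category.\<close>

lemma runit_tensor:
  assumes [simp]: "x \<in> Obj V" "y \<in> Obj V"
  shows "(\<iota> x \<otimes> \<r> y) \<cdot> \<a> x y \<k> = \<r> (x \<odot> y)"
proof -
  interpret rev: monoidal_cat "rev_cat V" by (rule monoidal_rev_cat)
  have "\<r> (x \<odot> y) \<cdot> Inv V (\<a> x y \<k>) = \<iota> x \<otimes> \<r> y"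
    using rev.lunit_tensor[of y x] by simp
  from this[symmetric] show ?thesis by (simp add: comp_assoc)
qed

end

context symmetric_monoidal_cat
begin

lemma hexagon_right:
  assumes [simp]: "x \<in> Obj V" "y \<in> Obj V" "z \<in> Obj V"
  shows "\<a> y z x \<cdot> \<tau> x (y \<odot> z) = (\<iota> y \<otimes> \<tau> x z) \<cdot> \<a> y x z \<cdot> (\<tau> x y \<otimes> \<iota> z) \<cdot> Inv V (\<a> x y z)"
  by (rule iso_cancel_right[where e = "\<a> x y z"]) (simp_all add: comp_assoc hexagon)

text \<open>The second hexagon, for a product in the first argument, is the first one in the
  reversed category.\<close>

lemma hexagon_left:
  assumes [simp]: "x \<in> Obj V" "y \<in> Obj V" "z \<in> Obj V"
  shows "\<tau> (x \<odot> y) z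
    = \<a> z x y \<cdot> (\<tau> x z \<otimes> \<iota> y) \<cdot> Inv V (\<a> x z y) \<cdot> (\<iota> x \<otimes> \<tau> y z) \<cdot> \<a> x y z"
proof -
  interpret rev: symmetric_monoidal_cat "rev_cat V" by (rule symm_rev_cat)
  have "Inv V (\<a> z x y) \<cdot> \<tau> (x \<odot> y) z = (\<tau> x z \<otimes> \<iota> y) \<cdot> Inv V (\<a> x z y) \<cdot> (\<iota> x \<otimes> \<tau> y z) \<cdot> \<a> x y z"
    using rev.hexagon_right[of z y x] by simp
  from this[symmetric] show ?thesis by simp
qed

text \<open>Two routes to the permutation that reverses three factors. Naturality of the symmetry
  with respect to \<open>\<tau> y z\<close> connects them, and the two hexagons do the rest. Its
  purpose is associativity of the opposite multiplication.\<close>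

lemma symm_reverse:
  assumes [simp]: "x \<in> Obj V" "y \<in> Obj V" "z \<in> Obj V"
  shows "\<a> z y x \<cdot> (\<tau> y z \<otimes> \<iota> x) \<cdot> \<tau> x (y \<odot> z) \<cdot> \<a> x y z = (\<iota> z \<otimes> \<tau> x y) \<cdot> \<tau> (x \<odot> y) z"
proof -
  have "(\<tau> y z \<otimes> \<iota> x) \<cdot> \<tau> x (y \<odot> z) = \<tau> x (z \<odot> y) \<cdot> (\<iota> x \<otimes> \<tau> y z)"
    using symm_natural[of "\<iota> x" "\<tau> y z"] by simp
  then have "\<a> z y x \<cdot> (\<tau> y z \<otimes> \<iota> x) \<cdot> \<tau> x (y \<odot> z) \<cdot> \<a> x y z
    = (\<a> z y x \<cdot> \<tau> x (z \<odot> y)) \<cdot> (\<iota> x \<otimes> \<tau> y z) \<cdot> \<a> x y z"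
    by (simp add: comp_assoc[symmetric])
  also have "\<dots> = (\<iota> z \<otimes> \<tau> x y) \<cdot> \<tau> (x \<odot> y) z"
    by (simp add: hexagon_right hexagon_left comp_assoc)
  finally show ?thesis .
qed

text \<open>Tested after tensoring with \<open>\<k>\<close>, through the hexagon on
  \<open>x\<close>, \<open>\<k>\<close>, \<open>\<k>\<close>: the crossing
  \<open>\<tau> x (\<k> \<odot> \<k>)\<close> that it produces is absorbed by naturality against
  \<open>\<r> \<k>\<close>, and \<open>runit_tensor\<close> leads back.\<close>

lemma lunit_symm:
  assumes [simp]: "x \<in> Obj V"
  shows "\<l> x \<cdot> \<tau> x \<k> = \<r> x"
proof (rule unit_tensor_left_cancel)
  have "(\<iota> \<k> \<otimes> (\<l> x \<cdot> \<tau> x \<k>)) \<cdot> \<a> \<k> x \<k> \<cdot> (\<tau> x \<k> \<otimes> \<iota> \<k>)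
    = (\<iota> \<k> \<otimes> \<l> x) \<cdot> (\<iota> \<k> \<otimes> \<tau> x \<k>) \<cdot> \<a> \<k> x \<k> \<cdot> (\<tau> x \<k> \<otimes> \<iota> \<k>)"
    by (simp add: interchange_tail)
  also have "\<dots> = ((\<iota> \<k> \<otimes> \<l> x) \<cdot> \<a> \<k> \<k> x) \<cdot> \<tau> x (\<k> \<odot> \<k>) \<cdot> \<a> x \<k> \<k>"
    by (simp add: hexagon[symmetric] comp_assoc)
  also have "\<dots> = ((\<r> \<k> \<otimes> \<iota> x) \<cdot> \<tau> x (\<k> \<odot> \<k>)) \<cdot> \<a> x \<k> \<k>"
    by (simp add: triangle comp_assoc)
  also have "\<dots> = \<tau> x \<k> \<cdot> (\<iota> x \<otimes> \<r> \<k>) \<cdot> \<a> x \<k> \<k>"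
    using symm_natural[of "\<iota> x" "\<r> \<k>"] by (simp add: comp_assoc flip: comp_assoc)
  also have "\<dots> = \<r> (\<k> \<odot> x) \<cdot> (\<tau> x \<k> \<otimes> \<iota> \<k>)"
    using runit_natural[of "\<tau> x \<k>"] by (simp add: runit_tensor)
  also have "\<dots> = (\<iota> \<k> \<otimes> \<r> x) \<cdot> \<a> \<k> x \<k> \<cdot> (\<tau> x \<k> \<otimes> \<iota> \<k>)"
    by (simp add: runit_tensor[symmetric] comp_assoc)
  finally show "\<iota> \<k> \<otimes> (\<l> x \<cdot> \<tau> x \<k>) = \<iota> \<k> \<otimes> \<r> x"
    by (rule iso_cancel_right) simp_all
qed simp_all

lemma runit_symm: "x \<in> Obj V \<Longrightarrow> \<r> x \<cdot> \<tau> \<k> x = \<l> x"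
  by (simp add: lunit_symm[symmetric] comp_assoc)

section \<open>The middle four interchange\<close>

lemma middle_swap_simps [simp]:
  assumes "w \<in> Obj V" "x \<in> Obj V" "y \<in> Obj V" "z \<in> Obj V"
  shows "middle_swap V w x y z \<in> Arr V" "Dom V (middle_swap V w x y z) = (w \<odot> x) \<odot> y \<odot> z"
    "Cod V (middle_swap V w x y z) = (w \<odot> y) \<odot> x \<odot> z"
  using assms by (simp_all add: middle_swap_def)

lemma middle_swap_natural:
  assumes [simp]: "f \<in> Arr V" "g \<in> Arr V" "h \<in> Arr V" "k \<in> Arr V"
  shows "middle_swap V (Cod V f) (Cod V g) (Cod V h) (Cod V k) \<cdot> ((f \<otimes> g) \<otimes> h \<otimes> k)
    = ((f \<otimes> h) \<otimes> g \<otimes> k) \<cdot> middle_swap V (Dom V f) (Dom V g) (Dom V h) (Dom V k)"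
proof -
  let ?i = "Inv V (\<a> (Cod V f) (Cod V h) (Cod V g \<odot> Cod V k))"
  let ?m = "\<a> (Cod V h) (Cod V g) (Cod V k) \<cdot> (\<tau> (Cod V g) (Cod V h) \<otimes> \<iota> (Cod V k)) \<cdot> Inv V (\<a> (Cod V g) (Cod V h) (Cod V k))"
  let ?n = "\<a> (Dom V h) (Dom V g) (Dom V k) \<cdot> (\<tau> (Dom V g) (Dom V h) \<otimes> \<iota> (Dom V k)) \<cdot> Inv V (\<a> (Dom V g) (Dom V h) (Dom V k))"
  \<comment> \<open>The block that exchanges the two inner factors is natural by itself; what
    surrounds it are associators.\<close>
  have "?m \<cdot> (g \<otimes> h \<otimes> k) = \<a> (Cod V h) (Cod V g) (Cod V k) \<cdot> (\<tau> (Cod V g) (Cod V h) \<otimes> \<iota> (Cod V k))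
      \<cdot> ((g \<otimes> h) \<otimes> k) \<cdot> Inv V (\<a> (Dom V g) (Dom V h) (Dom V k))"
    by (simp add: comp_assoc assoc_inv_natural)
  also have "\<dots> = (\<a> (Cod V h) (Cod V g) (Cod V k) \<cdot> ((h \<otimes> g) \<otimes> k)) \<cdot> (\<tau> (Dom V g) (Dom V h) \<otimes> \<iota> (Dom V k))
      \<cdot> Inv V (\<a> (Dom V g) (Dom V h) (Dom V k))"
    by (simp add: comp_assoc interchange_tail symm_natural)
  also have "\<dots> = (h \<otimes> g \<otimes> k) \<cdot> ?n" by (simp add: assoc_natural comp_assoc)
  finally have m: "?m \<cdot> (g \<otimes> h \<otimes> k) = (h \<otimes> g \<otimes> k) \<cdot> ?n" .
  have "middle_swap V (Cod V f) (Cod V g) (Cod V h) (Cod V k) \<cdot> ((f \<otimes> g) \<otimes> h \<otimes> k)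
    = ?i \<cdot> (\<iota> (Cod V f) \<otimes> ?m) \<cdot> \<a> (Cod V f) (Cod V g) (Cod V h \<odot> Cod V k) \<cdot> ((f \<otimes> g) \<otimes> h \<otimes> k)"
    by (simp add: middle_swap_def comp_assoc)
  also have "\<dots> = ?i \<cdot> (\<iota> (Cod V f) \<otimes> ?m) \<cdot> (f \<otimes> g \<otimes> h \<otimes> k) \<cdot> \<a> (Dom V f) (Dom V g) (Dom V h \<odot> Dom V k)"
    using assoc_natural[of f g "h \<otimes> k"] by simp
  also have "\<dots> = ?i \<cdot> (f \<otimes> (?m \<cdot> (g \<otimes> h \<otimes> k))) \<cdot> \<a> (Dom V f) (Dom V g) (Dom V h \<odot> Dom V k)"
    by (simp add: interchange_tail)
  also have "\<dots> = (?i \<cdot> (f \<otimes> h \<otimes> g \<otimes> k)) \<cdot> (\<iota> (Dom V f) \<otimes> ?n) \<cdot> \<a> (Dom V f) (Dom V g) (Dom V h \<odot> Dom V k)"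
    by (simp only: m) (simp add: interchange_tail comp_assoc)
  also have "?i \<cdot> (f \<otimes> h \<otimes> g \<otimes> k) = ((f \<otimes> h) \<otimes> g \<otimes> k) \<cdot> Inv V (\<a> (Dom V f) (Dom V h) (Dom V g \<odot> Dom V k))"
    using assoc_inv_natural[of f h "g \<otimes> k"] by simp
  finally show ?thesis by (simp add: middle_swap_def comp_assoc)
qed

text \<open>A crossing with the unit is absorbed by the unitors, so only a reassociation is left.
  With \<open>\<eta>\<close> in that slot this computes (a \<otimes> b)(1 \<otimes> c) = a \<otimes>
  bc.\<close>

lemma middle_swap_unit_left:
  assumes [simp]: "w \<in> Obj V" "x \<in> Obj V" "z \<in> Obj V"
  shows "(\<r> w \<otimes> \<iota> (x \<odot> z)) \<cdot> middle_swap V w x \<k> z = \<a> w x z \<cdot> (\<iota> (w \<odot> x) \<otimes> \<l> z)"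
proof -
  have "(\<r> w \<otimes> \<iota> (x \<odot> z)) \<cdot> middle_swap V w x \<k> z
    = ((\<r> w \<otimes> \<iota> (x \<odot> z)) \<cdot> Inv V (\<a> w \<k> (x \<odot> z)))
      \<cdot> (\<iota> w \<otimes> (\<a> \<k> x z \<cdot> (\<tau> x \<k> \<otimes> \<iota> z) \<cdot> Inv V (\<a> x \<k> z))) \<cdot> \<a> w x (\<k> \<odot> z)"
    by (simp add: middle_swap_def comp_assoc)
  also have "\<dots> = (\<iota> w \<otimes> (\<l> (x \<odot> z) \<cdot> \<a> \<k> x z \<cdot> (\<tau> x \<k> \<otimes> \<iota> z) \<cdot> Inv V (\<a> x \<k> z))) \<cdot> \<a> w x (\<k> \<odot> z)"
    by (simp add: triangle_inv interchange_tail)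
  also have "\<l> (x \<odot> z) \<cdot> \<a> \<k> x z \<cdot> (\<tau> x \<k> \<otimes> \<iota> z) \<cdot> Inv V (\<a> x \<k> z)
    = (\<l> (x \<odot> z) \<cdot> \<a> \<k> x z) \<cdot> (\<tau> x \<k> \<otimes> \<iota> z) \<cdot> Inv V (\<a> x \<k> z)"
    by (simp add: comp_assoc)
  also have "\<dots> = \<iota> x \<otimes> \<l> z"
    by (simp add: lunit_tensor interchange_tail lunit_symm triangle_inv)
  also have "(\<iota> w \<otimes> \<iota> x \<otimes> \<l> z) \<cdot> \<a> w x (\<k> \<odot> z) = \<a> w x z \<cdot> (\<iota> (w \<odot> x) \<otimes> \<l> z)"
    using assoc_natural[of "\<iota> w" "\<iota> x" "\<l> z"] by simp
  finally show ?thesis .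
qed

text \<open>Here the unit is the last factor, but \<open>y\<close> still has to cross
  \<open>x\<close>, so one genuine symmetry survives. This computes (a \<otimes> b)(c \<otimes> 1) =
  ac \<otimes> b.\<close>

lemma middle_swap_unit_right:
  assumes [simp]: "w \<in> Obj V" "x \<in> Obj V" "y \<in> Obj V"
  shows "(\<iota> (w \<odot> y) \<otimes> \<r> x) \<cdot> middle_swap V w x y \<k>
    = Inv V (\<a> w y x) \<cdot> (\<iota> w \<otimes> \<tau> x y) \<cdot> \<a> w x y \<cdot> (\<iota> (w \<odot> x) \<otimes> \<r> y)"
proof -
  have inner: "(\<iota> y \<otimes> \<r> x) \<cdot> \<a> y x \<k> \<cdot> (\<tau> x y \<otimes> \<iota> \<k>) \<cdot> Inv V (\<a> x y \<k>)
    = \<tau> x y \<cdot> (\<iota> x \<otimes> \<r> y)"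
  proof -
    have "(\<iota> y \<otimes> \<r> x) \<cdot> \<a> y x \<k> \<cdot> (\<tau> x y \<otimes> \<iota> \<k>) \<cdot> Inv V (\<a> x y \<k>)
      = (\<r> (y \<odot> x) \<cdot> (\<tau> x y \<otimes> \<iota> \<k>)) \<cdot> Inv V (\<a> x y \<k>)"
      by (simp add: runit_tensor[symmetric] comp_assoc)
    also have "\<dots> = (\<tau> x y \<cdot> \<r> (x \<odot> y)) \<cdot> Inv V (\<a> x y \<k>)"
      using runit_natural[of "\<tau> x y"] by simp
    also have "\<dots> = \<tau> x y \<cdot> (\<iota> x \<otimes> \<r> y)"
      by (simp add: runit_tensor[symmetric] comp_assoc)
    finally show ?thesis .
  qed
  have "(\<iota> (w \<odot> y) \<otimes> \<r> x) \<cdot> middle_swap V w x y \<k>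
    = ((\<iota> (w \<odot> y) \<otimes> \<r> x) \<cdot> Inv V (\<a> w y (x \<odot> \<k>)))
      \<cdot> (\<iota> w \<otimes> (\<a> y x \<k> \<cdot> (\<tau> x y \<otimes> \<iota> \<k>) \<cdot> Inv V (\<a> x y \<k>))) \<cdot> \<a> w x (y \<odot> \<k>)"
    by (simp add: middle_swap_def comp_assoc)
  also have "(\<iota> (w \<odot> y) \<otimes> \<r> x) \<cdot> Inv V (\<a> w y (x \<odot> \<k>)) = Inv V (\<a> w y x) \<cdot> (\<iota> w \<otimes> \<iota> y \<otimes> \<r> x)"
    using assoc_inv_natural[of "\<iota> w" "\<iota> y" "\<r> x"] by simp
  also have "(Inv V (\<a> w y x) \<cdot> (\<iota> w \<otimes> \<iota> y \<otimes> \<r> x))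
      \<cdot> (\<iota> w \<otimes> (\<a> y x \<k> \<cdot> (\<tau> x y \<otimes> \<iota> \<k>) \<cdot> Inv V (\<a> x y \<k>))) \<cdot> \<a> w x (y \<odot> \<k>)
    = Inv V (\<a> w y x) \<cdot> (\<iota> w \<otimes> ((\<iota> y \<otimes> \<r> x) \<cdot> \<a> y x \<k> \<cdot> (\<tau> x y \<otimes> \<iota> \<k>) \<cdot> Inv V (\<a> x y \<k>)))
      \<cdot> \<a> w x (y \<odot> \<k>)"
    by (simp add: comp_assoc interchange_tail)
  also have "\<dots> = Inv V (\<a> w y x) \<cdot> (\<iota> w \<otimes> \<tau> x y) \<cdot> (\<iota> w \<otimes> \<iota> x \<otimes> \<r> y) \<cdot> \<a> w x (y \<odot> \<k>)"
    by (simp only: inner) (simp add: interchange_tail)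
  also have "(\<iota> w \<otimes> \<iota> x \<otimes> \<r> y) \<cdot> \<a> w x (y \<odot> \<k>) = \<a> w x y \<cdot> (\<iota> (w \<odot> x) \<otimes> \<r> y)"
    using assoc_natural[of "\<iota> w" "\<iota> x" "\<r> y"] by simp
  finally show ?thesis .
qed

text \<open>The definition reaches the inner pair by bracketing it with the last factor, its mirror
  image by bracketing it with the first; the pentagon identifies the two. Consequently the
  multiplication of H \<otimes> H is the same arrow before and after reversal.\<close>

lemma middle_swap_rev_cat:
  assumes [simp]: "w \<in> Obj V" "x \<in> Obj V" "y \<in> Obj V" "z \<in> Obj V"
  shows "middle_swap (rev_cat V) w x y z = middle_swap V z y x w"
proof (rule iso_cancel_right[where e = "\<a> (z \<odot> y) x w"])
  \<comment> \<open>A pentagon with the associator that acts under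
    \<open>\<otimes> \<iota> w\<close> moved to the other side.\<close>
  have p1: "(\<iota> z \<otimes> \<a> x y w) \<cdot> \<a> z (x \<odot> y) w = \<a> z x (y \<odot> w) \<cdot> \<a> (z \<odot> x) y w \<cdot> (Inv V (\<a> z x y) \<otimes> \<iota> w)"
  proof (rule iso_cancel_right[where e = "\<a> z x y \<otimes> \<iota> w"])
    show "((\<iota> z \<otimes> \<a> x y w) \<cdot> \<a> z (x \<odot> y) w) \<cdot> (\<a> z x y \<otimes> \<iota> w)
      = (\<a> z x (y \<odot> w) \<cdot> \<a> (z \<odot> x) y w \<cdot> (Inv V (\<a> z x y) \<otimes> \<iota> w)) \<cdot> (\<a> z x y \<otimes> \<iota> w)"
      by (simp add: comp_assoc interchange pentagon)
  qed simp_all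
  have p2: "\<a> z y (x \<odot> w) \<cdot> \<a> (z \<odot> y) x w = (\<iota> z \<otimes> \<a> y x w) \<cdot> \<a> z (y \<odot> x) w \<cdot> (\<a> z y x \<otimes> \<iota> w)"
    by (simp add: pentagon)
  have "middle_swap V z y x w \<cdot> \<a> (z \<odot> y) x w
    = Inv V (\<a> z x (y \<odot> w)) \<cdot> (\<iota> z \<otimes> (\<a> x y w \<cdot> (\<tau> y x \<otimes> \<iota> w) \<cdot> Inv V (\<a> y x w)))
      \<cdot> (\<iota> z \<otimes> \<a> y x w) \<cdot> \<a> z (y \<odot> x) w \<cdot> (\<a> z y x \<otimes> \<iota> w)"
    by (simp add: middle_swap_def comp_assoc p2)
  also have "\<dots> = Inv V (\<a> z x (y \<odot> w)) \<cdot> (\<iota> z \<otimes> \<a> x y w) \<cdot> ((\<iota> z \<otimes> \<tau> y x \<otimes> \<iota> w)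
      \<cdot> \<a> z (y \<odot> x) w) \<cdot> (\<a> z y x \<otimes> \<iota> w)"
    by (simp add: interchange_tail comp_assoc)
  also have "(\<iota> z \<otimes> \<tau> y x \<otimes> \<iota> w) \<cdot> \<a> z (y \<odot> x) w = \<a> z (x \<odot> y) w \<cdot> ((\<iota> z \<otimes> \<tau> y x) \<otimes> \<iota> w)"
    using assoc_natural[of "\<iota> z" "\<tau> y x" "\<iota> w"] by simp
  also have "Inv V (\<a> z x (y \<odot> w)) \<cdot> (\<iota> z \<otimes> \<a> x y w) \<cdot> (\<a> z (x \<odot> y) w \<cdot> ((\<iota> z \<otimes> \<tau> y x) \<otimes> \<iota> w))
      \<cdot> (\<a> z y x \<otimes> \<iota> w)
    = Inv V (\<a> z x (y \<odot> w)) \<cdot> ((\<iota> z \<otimes> \<a> x y w) \<cdot> \<a> z (x \<odot> y) w) \<cdot> ((\<iota> z \<otimes> \<tau> y x) \<otimes> \<iota> w)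
      \<cdot> (\<a> z y x \<otimes> \<iota> w)"
    by (simp add: comp_assoc)
  also have "\<dots> = \<a> (z \<odot> x) y w \<cdot> ((Inv V (\<a> z x y) \<cdot> (\<iota> z \<otimes> \<tau> y x) \<cdot> \<a> z y x) \<otimes> \<iota> w)"
    by (simp only: p1) (simp add: comp_assoc interchange_tail interchange)
  finally show "middle_swap (rev_cat V) w x y z \<cdot> \<a> (z \<odot> y) x w = middle_swap V z y x w \<cdot> \<a> (z \<odot> y) x w"
    by (simp add: middle_swap_def comp_assoc)
qed (simp_all add: middle_swap_def)

end

section \<open>Monoids, actions and multiplication bimodules\<close>

lemma op_monoid_simps [simp]:
  "mobj (op_monoid V M) = mobj M" "mone (op_monoid V M) = mone M"
  "mmul (op_monoid V M) = Comp V (mmul M) (Symm V (mobj M) (mobj M))"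
  by (simp_all add: op_monoid_def)

text \<open>The same bimodule seen from the reversed category, where the arrow of a left action is
  that of a right action and conversely.\<close>

definition swap_bimod :: "('o, 'm) bimod \<Rightarrow> ('o, 'm) bimod" where
  "swap_bimod X = \<lparr>bobj = bobj X, lact = ract X, ract = lact X\<rparr>"

lemma swap_bimod_simps [simp]:
  "bobj (swap_bimod X) = bobj X" "lact (swap_bimod X) = ract X" "ract (swap_bimod X) = lact X"
  "swap_bimod (swap_bimod X) = X"
  by (simp_all add: swap_bimod_def)

lemma mult_bimodule_simps [simp]:
  "bobj (left_mult_bimodule V H al be) = mobj H"
  "lact (left_mult_bimodule V H al be) = Comp V (mmul H) (TensA V al (Idn V (mobj H)))"
  "ract (left_mult_bimodule V H al be)
    = Comp V (mmul H) (Comp V (Symm V (mobj H) (mobj H)) (TensA V (Idn V (mobj H)) be))"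
  "bobj (right_mult_bimodule V H al be) = mobj H"
  "lact (right_mult_bimodule V H al be)
    = Comp V (mmul H) (Comp V (Symm V (mobj H) (mobj H)) (TensA V be (Idn V (mobj H))))"
  "ract (right_mult_bimodule V H al be) = Comp V (mmul H) (TensA V (Idn V (mobj H)) al)"
  by (simp_all add: left_mult_bimodule_def right_mult_bimodule_def)

lemma op_monoid_rev_cat [simp]: "op_monoid (rev_cat V) M = op_monoid V M"
  by (simp add: op_monoid_def)

lemma monoid_morphism_rev_cat [simp]: "monoid_morphism (rev_cat V) = monoid_morphism V"
  by (simp add: fun_eq_iff monoid_morphism_def)

lemma mult_bimodule_rev_cat:
  "left_mult_bimodule (rev_cat V) H al be = swap_bimod (right_mult_bimodule V H al be)"
  "right_mult_bimodule (rev_cat V) H al be = swap_bimod (left_mult_bimodule V H al be)"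
  by (simp_all add: left_mult_bimodule_def right_mult_bimodule_def swap_bimod_def)

lemma coequalizers_commute_rev_cat:
  "coequalizers_commute_with_tensor V \<Longrightarrow> coequalizers_commute_with_tensor (rev_cat V)"
  by (simp add: coequalizers_commute_with_tensor_def)

section \<open>Monoids and actions under reversal\<close>

context monoidal_cat
begin

lemma internal_monoidD:
  assumes "internal_monoid V M"
  shows "mobj M \<in> Obj V"
    "mmul M \<in> Arr V" "Dom V (mmul M) = mobj M \<odot> mobj M" "Cod V (mmul M) = mobj M"
    "mone M \<in> Arr V" "Dom V (mone M) = \<k>" "Cod V (mone M) = mobj M"
    "mmul M \<cdot> (mmul M \<otimes> \<iota> (mobj M))
       = mmul M \<cdot> (\<iota> (mobj M) \<otimes> mmul M) \<cdot> \<a> (mobj M) (mobj M) (mobj M)"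
    "mmul M \<cdot> (mone M \<otimes> \<iota> (mobj M)) = \<l> (mobj M)"
    "mmul M \<cdot> (\<iota> (mobj M) \<otimes> mone M) = \<r> (mobj M)"
  using assms by (simp_all add: internal_monoid_def Hom_def)

lemmas internal_monoid_Arr = internal_monoidD(1-7)

lemma monoid_morphismD:
  assumes "monoid_morphism V M N f"
  shows "f \<in> Arr V" "Dom V f = mobj M" "Cod V f = mobj N"
    "f \<cdot> mmul M = mmul N \<cdot> (f \<otimes> f)" "f \<cdot> mone M = mone N"
  using assms by (simp_all add: monoid_morphism_def Hom_def)

lemma internal_monoid_rev_cat:
  assumes M: "internal_monoid V M"
  shows "internal_monoid (rev_cat V) M"
proof -
  note [simp] = internal_monoid_Arr[OF M]
  have "mmul M \<cdot> (mmul M \<otimes> \<iota> (mobj M)) \<cdot> Inv V (\<a> (mobj M) (mobj M) (mobj M))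
    = (mmul M \<cdot> (mmul M \<otimes> \<iota> (mobj M))) \<cdot> Inv V (\<a> (mobj M) (mobj M) (mobj M))"
    by (simp add: comp_assoc)
  also have "\<dots> = mmul M \<cdot> (\<iota> (mobj M) \<otimes> mmul M)"
    by (simp add: internal_monoidD(8)[OF M] comp_assoc)
  finally show ?thesis
    by (simp add: internal_monoid_def Hom_def internal_monoidD(9,10)[OF M])
qed

lemma right_action_rev_cat:
  assumes "internal_monoid V M"
  shows "right_action (rev_cat V) M x n \<longleftrightarrow> left_action V M x n"
proof -
  note [simp] = internal_monoid_Arr[OF assms]
  let ?m = "mobj M"
  have "n \<cdot> (\<iota> ?m \<otimes> n) = n \<cdot> (mmul M \<otimes> \<iota> x) \<cdot> Inv V (\<a> ?m ?m x)
    \<longleftrightarrow> n \<cdot> (mmul M \<otimes> \<iota> x) = n \<cdot> (\<iota> ?m \<otimes> n) \<cdot> \<a> ?m ?m x" (is "?l \<longleftrightarrow> ?r")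
    if [simp]: "x \<in> Obj V" "n \<in> Arr V" "Dom V n = ?m \<odot> x" "Cod V n = x"
  proof
    assume l: ?l
    have "n \<cdot> (\<iota> ?m \<otimes> n) \<cdot> \<a> ?m ?m x = (n \<cdot> (\<iota> ?m \<otimes> n)) \<cdot> \<a> ?m ?m x" by (simp add: comp_assoc)
    then show ?r by (simp only: l) (simp add: comp_assoc)
  next
    assume r: ?r
    have "n \<cdot> (mmul M \<otimes> \<iota> x) \<cdot> Inv V (\<a> ?m ?m x) = (n \<cdot> (mmul M \<otimes> \<iota> x)) \<cdot> Inv V (\<a> ?m ?m x)"
      by (simp add: comp_assoc)
    then show ?l by (simp only: r) (simp add: comp_assoc)
  qed
  then show ?thesis unfolding right_action_def left_action_def by (auto simp: Hom_def)
qed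

lemma left_action_rev_cat:
  assumes "internal_monoid V M"
  shows "left_action (rev_cat V) M x n \<longleftrightarrow> right_action V M x n"
proof -
  note [simp] = internal_monoid_Arr[OF assms]
  let ?m = "mobj M"
  have "n \<cdot> (\<iota> x \<otimes> mmul M) = n \<cdot> (n \<otimes> \<iota> ?m) \<cdot> Inv V (\<a> x ?m ?m)
    \<longleftrightarrow> n \<cdot> (n \<otimes> \<iota> ?m) = n \<cdot> (\<iota> x \<otimes> mmul M) \<cdot> \<a> x ?m ?m" (is "?l \<longleftrightarrow> ?r")
    if [simp]: "x \<in> Obj V" "n \<in> Arr V" "Dom V n = x \<odot> ?m" "Cod V n = x"
  proof
    assume l: ?l
    have "n \<cdot> (\<iota> x \<otimes> mmul M) \<cdot> \<a> x ?m ?m = (n \<cdot> (\<iota> x \<otimes> mmul M)) \<cdot> \<a> x ?m ?m" by (simp add: comp_assoc)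
    then show ?r by (simp only: l) (simp add: comp_assoc)
  next
    assume r: ?r
    have "n \<cdot> (n \<otimes> \<iota> ?m) \<cdot> Inv V (\<a> x ?m ?m) = (n \<cdot> (n \<otimes> \<iota> ?m)) \<cdot> Inv V (\<a> x ?m ?m)"
      by (simp add: comp_assoc)
    then show ?l by (simp only: r) (simp add: comp_assoc)
  qed
  then show ?thesis unfolding right_action_def left_action_def by (auto simp: Hom_def)
qed

end

section \<open>Opposite monoids\<close>

context symmetric_monoidal_cat
begin

text \<open>Both bracketings of the opposite product multiply the three factors in reversed order;
  \<open>symm_reverse\<close> matches the two reversals and associativity of \<open>M\<close>
  matches the products. The symmetry exchanges the unit laws.\<close>

lemma internal_monoid_op:
  assumes M: "internal_monoid V M"
  shows "internal_monoid V (op_monoid V M)"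
proof -
  note [simp] = internal_monoid_Arr[OF M]
  let ?m = "mobj M" and ?\<mu> = "mmul M"
  let ?t = "\<tau> ?m ?m"
  have r: "\<tau> ?m ?m \<cdot> ((?\<mu> \<cdot> ?t) \<otimes> \<iota> ?m) = (\<iota> ?m \<otimes> (?\<mu> \<cdot> ?t)) \<cdot> \<tau> (?m \<odot> ?m) ?m"
    using symm_natural[of "?\<mu> \<cdot> ?t" "\<iota> ?m"] by simp
  have l: "\<tau> ?m ?m \<cdot> (\<iota> ?m \<otimes> (?\<mu> \<cdot> ?t)) = ((?\<mu> \<cdot> ?t) \<otimes> \<iota> ?m) \<cdot> \<tau> ?m (?m \<odot> ?m)"
    using symm_natural[of "\<iota> ?m" "?\<mu> \<cdot> ?t"] by simp
  have "(?\<mu> \<cdot> ?t) \<cdot> (\<iota> ?m \<otimes> (?\<mu> \<cdot> ?t)) \<cdot> \<a> ?m ?m ?m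
    = ?\<mu> \<cdot> (?t \<cdot> (\<iota> ?m \<otimes> (?\<mu> \<cdot> ?t))) \<cdot> \<a> ?m ?m ?m"
    by (simp add: comp_assoc)
  also have "\<dots> = (?\<mu> \<cdot> (?\<mu> \<otimes> \<iota> ?m)) \<cdot> (?t \<otimes> \<iota> ?m) \<cdot> \<tau> ?m (?m \<odot> ?m) \<cdot> \<a> ?m ?m ?m"
    by (simp only: l) (simp add: comp_assoc interchange_tail)
  also have "\<dots> = ?\<mu> \<cdot> (\<iota> ?m \<otimes> ?\<mu>)
      \<cdot> (\<a> ?m ?m ?m \<cdot> (?t \<otimes> \<iota> ?m) \<cdot> \<tau> ?m (?m \<odot> ?m) \<cdot> \<a> ?m ?m ?m)"
    by (simp only: internal_monoidD(8)[OF M]) (simp add: comp_assoc)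
  also have "\<dots> = ?\<mu> \<cdot> (\<iota> ?m \<otimes> (?\<mu> \<cdot> ?t)) \<cdot> \<tau> (?m \<odot> ?m) ?m"
    by (simp add: symm_reverse interchange_tail)
  also have "\<dots> = (?\<mu> \<cdot> ?t) \<cdot> ((?\<mu> \<cdot> ?t) \<otimes> \<iota> ?m)"
    by (simp add: comp_assoc r)
  finally have assoc: "(?\<mu> \<cdot> ?t) \<cdot> ((?\<mu> \<cdot> ?t) \<otimes> \<iota> ?m)
    = (?\<mu> \<cdot> ?t) \<cdot> (\<iota> ?m \<otimes> (?\<mu> \<cdot> ?t)) \<cdot> \<a> ?m ?m ?m" ..
  have "(?\<mu> \<cdot> ?t) \<cdot> (mone M \<otimes> \<iota> ?m) = (?\<mu> \<cdot> (\<iota> ?m \<otimes> mone M)) \<cdot> \<tau> \<k> ?m"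
    using symm_natural[of "mone M" "\<iota> ?m"] by (simp add: comp_assoc)
  then have "(?\<mu> \<cdot> ?t) \<cdot> (mone M \<otimes> \<iota> ?m) = \<l> ?m"
    by (simp add: internal_monoidD(10)[OF M] runit_symm)
  moreover have "(?\<mu> \<cdot> ?t) \<cdot> (\<iota> ?m \<otimes> mone M) = (?\<mu> \<cdot> (mone M \<otimes> \<iota> ?m)) \<cdot> \<tau> ?m \<k>"
    using symm_natural[of "\<iota> ?m" "mone M"] by (simp add: comp_assoc)
  then have "(?\<mu> \<cdot> ?t) \<cdot> (\<iota> ?m \<otimes> mone M) = \<r> ?m"
    by (simp add: internal_monoidD(9)[OF M] lunit_symm)
  ultimately show ?thesis using assoc by (simp add: internal_monoid_def Hom_def)
qed

text \<open>An anti-homomorphism may be read out of an opposite monoid or into one, because the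
  symmetry is natural and involutive. The second reading turns multiplication by \<open>beta\<close>
  into an ordinary restricted action of the opposite of \<open>H\<close>.\<close>

lemma monoid_morphism_op:
  assumes f: "monoid_morphism V (op_monoid V M) N f"
    and M: "internal_monoid V M" and N: "internal_monoid V N"
  shows "monoid_morphism V M (op_monoid V N) f"
proof -
  note [simp] = internal_monoid_Arr[OF M] internal_monoid_Arr[OF N] monoid_morphismD(1-3)[OF f, simplified]
  have "f \<cdot> mmul M = (f \<cdot> mmul (op_monoid V M)) \<cdot> \<tau> (mobj M) (mobj M)"
    by (simp add: comp_assoc)
  also have "\<dots> = mmul N \<cdot> (f \<otimes> f) \<cdot> \<tau> (mobj M) (mobj M)"
    by (simp only: monoid_morphismD(4)[OF f]) (simp add: comp_assoc)
  also have "(f \<otimes> f) \<cdot> \<tau> (mobj M) (mobj M) = \<tau> (mobj N) (mobj N) \<cdot> (f \<otimes> f)"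
    using symm_natural[of f f] by simp
  finally show ?thesis
    using monoid_morphismD[OF f] by (simp add: monoid_morphism_def Hom_def comp_assoc)
qed

end

context monoidal_cat
begin

lemma left_action_restrict:
  assumes M: "internal_monoid V M" and N: "internal_monoid V N" and f: "monoid_morphism V M N f"
  shows "left_action V M (mobj N) (mmul N \<cdot> (f \<otimes> \<iota> (mobj N)))"
proof -
  note [simp] = internal_monoid_Arr[OF M] internal_monoid_Arr[OF N] monoid_morphismD(1-3)[OF f]
  let ?n = "mobj N" and ?m = "mobj M"
  have "(mmul N \<cdot> (f \<otimes> \<iota> ?n)) \<cdot> (mmul M \<otimes> \<iota> ?n) = mmul N \<cdot> ((f \<cdot> mmul M) \<otimes> \<iota> ?n)"
    by (simp add: comp_assoc interchange)
  also have "\<dots> = (mmul N \<cdot> (mmul N \<otimes> \<iota> ?n)) \<cdot> ((f \<otimes> f) \<otimes> \<iota> ?n)"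
    by (simp add: monoid_morphismD(4)[OF f] comp_assoc interchange)
  also have "\<dots> = mmul N \<cdot> (\<iota> ?n \<otimes> mmul N) \<cdot> \<a> ?n ?n ?n \<cdot> ((f \<otimes> f) \<otimes> \<iota> ?n)"
    by (simp add: internal_monoidD(8)[OF N] comp_assoc)
  also have "\<a> ?n ?n ?n \<cdot> ((f \<otimes> f) \<otimes> \<iota> ?n) = (f \<otimes> f \<otimes> \<iota> ?n) \<cdot> \<a> ?m ?m ?n"
    using assoc_natural[of f f "\<iota> ?n"] by simp
  finally have "(mmul N \<cdot> (f \<otimes> \<iota> ?n)) \<cdot> (mmul M \<otimes> \<iota> ?n)
    = (mmul N \<cdot> (f \<otimes> \<iota> ?n)) \<cdot> (\<iota> ?m \<otimes> (mmul N \<cdot> (f \<otimes> \<iota> ?n))) \<cdot> \<a> ?m ?m ?n"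
    by (simp add: comp_assoc interchange_tail)
  then show ?thesis
    by (simp add: left_action_def Hom_def comp_assoc interchange monoid_morphismD(5)[OF f]
        internal_monoidD(9)[OF N])
qed

lemma right_action_restrict:
  assumes M: "internal_monoid V M" and N: "internal_monoid V N" and f: "monoid_morphism V M N f"
  shows "right_action V M (mobj N) (mmul N \<cdot> (\<iota> (mobj N) \<otimes> f))"
proof -
  interpret rev: monoidal_cat "rev_cat V" by (rule monoidal_rev_cat)
  show ?thesis
    using rev.left_action_restrict[of M N f] M N f
    by (simp add: internal_monoid_rev_cat left_action_rev_cat)
qed

text \<open>This is (f x) g = f (x g), that is, associativity; \<open>f\<close> and \<open>g\<close>
  are arbitrary arrows into the monoid. Used in \<open>H\<close> and in its opposite, it makes
  L-actions by left multiplication commute with R-actions by right multiplication.\<close>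

lemma actions_commute:
  assumes N: "internal_monoid V N" and f: "f \<in> Arr V" "Cod V f = mobj N"
    and g: "g \<in> Arr V" "Cod V g = mobj N"
  shows "(mmul N \<cdot> (\<iota> (mobj N) \<otimes> g)) \<cdot> ((mmul N \<cdot> (f \<otimes> \<iota> (mobj N))) \<otimes> \<iota> (Dom V g))
    = (mmul N \<cdot> (f \<otimes> \<iota> (mobj N))) \<cdot> (\<iota> (Dom V f) \<otimes> (mmul N \<cdot> (\<iota> (mobj N) \<otimes> g)))
      \<cdot> \<a> (Dom V f) (mobj N) (Dom V g)"
proof -
  note [simp] = internal_monoid_Arr[OF N] f g
  let ?n = "mobj N"
  have "(mmul N \<cdot> (\<iota> ?n \<otimes> g)) \<cdot> ((mmul N \<cdot> (f \<otimes> \<iota> ?n)) \<otimes> \<iota> (Dom V g))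
    = (mmul N \<cdot> (mmul N \<otimes> \<iota> ?n)) \<cdot> ((f \<otimes> \<iota> ?n) \<otimes> g)"
    by (simp add: comp_assoc interchange)
  also have "\<dots> = mmul N \<cdot> (\<iota> ?n \<otimes> mmul N) \<cdot> \<a> ?n ?n ?n \<cdot> ((f \<otimes> \<iota> ?n) \<otimes> g)"
    by (simp add: internal_monoidD(8)[OF N] comp_assoc)
  also have "\<a> ?n ?n ?n \<cdot> ((f \<otimes> \<iota> ?n) \<otimes> g) = (f \<otimes> \<iota> ?n \<otimes> g) \<cdot> \<a> (Dom V f) ?n (Dom V g)"
    using assoc_natural[of f "\<iota> ?n" g] by simp
  finally show ?thesis by (simp add: comp_assoc interchange_tail)
qed

end

context symmetric_monoidal_cat
begin

text \<open>The fourth fact follows from the third by precomposing with the symmetry. It is the form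
  that the commutation takes in the reversed category.\<close>

lemma commuting_pairD:
  assumes "commuting_pair V M H al be" "internal_monoid V M" "internal_monoid V H"
  shows "monoid_morphism V M H al" "monoid_morphism V M (op_monoid V H) be"
    "mmul H \<cdot> \<tau> (mobj H) (mobj H) \<cdot> (al \<otimes> be) = mmul H \<cdot> (al \<otimes> be)"
    "mmul H \<cdot> \<tau> (mobj H) (mobj H) \<cdot> (be \<otimes> al) = mmul H \<cdot> (be \<otimes> al)"
proof -
  show 1: "monoid_morphism V M H al"
    and 3: "mmul H \<cdot> \<tau> (mobj H) (mobj H) \<cdot> (al \<otimes> be) = mmul H \<cdot> (al \<otimes> be)"
    using assms by (simp_all add: commuting_pair_def)
  show 2: "monoid_morphism V M (op_monoid V H) be"
    using assms by (simp add: commuting_pair_def monoid_morphism_op)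
  note [simp] = internal_monoid_Arr[OF assms(2)] internal_monoid_Arr[OF assms(3)]
    monoid_morphismD(1-3)[OF 1] monoid_morphismD(1-3)[OF 2, simplified]
  have "mmul H \<cdot> \<tau> (mobj H) (mobj H) \<cdot> (be \<otimes> al) = mmul H \<cdot> (al \<otimes> be) \<cdot> \<tau> (mobj M) (mobj M)"
    using symm_natural[of be al] by simp
  also have "\<dots> = (mmul H \<cdot> \<tau> (mobj H) (mobj H) \<cdot> (al \<otimes> be)) \<cdot> \<tau> (mobj M) (mobj M)"
    by (simp only: 3) (simp add: comp_assoc)
  also have "\<dots> = mmul H \<cdot> \<tau> (mobj H) (mobj H) \<cdot> \<tau> (mobj H) (mobj H) \<cdot> (be \<otimes> al)"
    using symm_natural[of be al] by (simp add: comp_assoc)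
  finally show "mmul H \<cdot> \<tau> (mobj H) (mobj H) \<cdot> (be \<otimes> al) = mmul H \<cdot> (be \<otimes> al)" by simp
qed

lemma commuting_pair_rev_cat:
  assumes "commuting_pair V M H al be" "internal_monoid V M" "internal_monoid V H"
  shows "commuting_pair (rev_cat V) M H al be"
  using commuting_pairD(4)[OF assms] assms(1) by (simp add: commuting_pair_def)

text \<open>The left action is left multiplication in the opposite of \<open>H\<close>, restricted
  along \<open>be\<close>. With a = \<open>al\<close> and b = \<open>be\<close>, the two actions
  commute since (h b(r)) a(s) = h (a(s) b(r)) = (h a(s)) b(r).\<close>

lemma right_mult_bimodule:
  assumes c: "commuting_pair V M H al be" and M: "internal_monoid V M" and H: "internal_monoid V H"
  shows "bimodule V M (right_mult_bimodule V H al be)"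
proof -
  note cd = commuting_pairD[OF c M H]
  note [simp] = internal_monoid_Arr[OF M] internal_monoid_Arr[OF H]
    monoid_morphismD(1-3)[OF cd(1)] monoid_morphismD(1-3)[OF cd(2), simplified]
  let ?h = "mobj H" and ?m = "mobj M" and ?\<mu> = "mmul H"
  have "left_action V M ?h (?\<mu> \<cdot> \<tau> ?h ?h \<cdot> (be \<otimes> \<iota> ?h))"
    using left_action_restrict[OF M internal_monoid_op[OF H] cd(2)] by (simp add: comp_assoc)
  moreover have "(?\<mu> \<cdot> (\<iota> ?h \<otimes> al)) \<cdot> ((?\<mu> \<cdot> \<tau> ?h ?h \<cdot> (be \<otimes> \<iota> ?h)) \<otimes> \<iota> ?m)
    = (?\<mu> \<cdot> \<tau> ?h ?h \<cdot> (be \<otimes> \<iota> ?h)) \<cdot> (\<iota> ?m \<otimes> (?\<mu> \<cdot> (\<iota> ?h \<otimes> al))) \<cdot> \<a> ?m ?h ?m"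
  proof -
    have nat: "\<a> ?h ?h ?h \<cdot> ((\<iota> ?h \<otimes> be) \<otimes> al) = (\<iota> ?h \<otimes> be \<otimes> al) \<cdot> \<a> ?h ?m ?m"
      using assoc_natural[of "\<iota> ?h" be al] by simp
    have nat': "\<a> ?h ?h ?h \<cdot> ((\<iota> ?h \<otimes> al) \<otimes> be) = (\<iota> ?h \<otimes> al \<otimes> be) \<cdot> \<a> ?h ?m ?m"
      using assoc_natural[of "\<iota> ?h" al be] by simp
    have s: "\<tau> ?h ?h \<cdot> (be \<otimes> \<iota> ?h) = (\<iota> ?h \<otimes> be) \<cdot> \<tau> ?m ?h"
      using symm_natural[of be "\<iota> ?h"] by simp
    have s': "\<tau> ?m ?h \<cdot> (\<iota> ?m \<otimes> (?\<mu> \<cdot> (\<iota> ?h \<otimes> al))) = ((?\<mu> \<cdot> (\<iota> ?h \<otimes> al)) \<otimes> \<iota> ?m) \<cdot> \<tau> ?m (?h \<odot> ?m)"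
      using symm_natural[of "\<iota> ?m" "?\<mu> \<cdot> (\<iota> ?h \<otimes> al)"] by simp
    have t: "(al \<otimes> be) \<cdot> \<tau> ?m ?m = \<tau> ?h ?h \<cdot> (be \<otimes> al)"
      using symm_natural[of be al] by simp
    have "(?\<mu> \<cdot> (\<iota> ?h \<otimes> al)) \<cdot> ((?\<mu> \<cdot> \<tau> ?h ?h \<cdot> (be \<otimes> \<iota> ?h)) \<otimes> \<iota> ?m)
      = (?\<mu> \<cdot> (?\<mu> \<otimes> \<iota> ?h)) \<cdot> ((\<iota> ?h \<otimes> be) \<otimes> al) \<cdot> (\<tau> ?m ?h \<otimes> \<iota> ?m)"
      by (simp add: s comp_assoc interchange)
    also have "\<dots> = ?\<mu> \<cdot> (\<iota> ?h \<otimes> ?\<mu>) \<cdot> (\<a> ?h ?h ?h \<cdot> ((\<iota> ?h \<otimes> be) \<otimes> al)) \<cdot> (\<tau> ?m ?h \<otimes> \<iota> ?m)"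
      by (simp add: internal_monoidD(8)[OF H] comp_assoc)
    also have "\<dots> = ?\<mu> \<cdot> (\<iota> ?h \<otimes> (?\<mu> \<cdot> (be \<otimes> al))) \<cdot> \<a> ?h ?m ?m \<cdot> (\<tau> ?m ?h \<otimes> \<iota> ?m)"
      by (simp only: nat) (simp add: comp_assoc interchange_tail)
    \<comment> \<open>The commuting pair exchanges the two factors at the price of a symmetry on the
      acting copies of \<open>M\<close>.\<close>
    also have "?\<mu> \<cdot> (be \<otimes> al) = ?\<mu> \<cdot> (al \<otimes> be) \<cdot> \<tau> ?m ?m"
      by (simp only: t cd(4))
    also have "?\<mu> \<cdot> (\<iota> ?h \<otimes> (?\<mu> \<cdot> (al \<otimes> be) \<cdot> \<tau> ?m ?m)) \<cdot> \<a> ?h ?m ?m \<cdot> (\<tau> ?m ?h \<otimes> \<iota> ?m)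
      = ?\<mu> \<cdot> (\<iota> ?h \<otimes> (?\<mu> \<cdot> (al \<otimes> be))) \<cdot> ((\<iota> ?h \<otimes> \<tau> ?m ?m) \<cdot> \<a> ?h ?m ?m \<cdot> (\<tau> ?m ?h \<otimes> \<iota> ?m))"
      by (simp add: comp_assoc interchange_tail)
    \<comment> \<open>The hexagon merges two crossings into one of the left acting copy of
      \<open>M\<close> past \<open>?h \<odot> ?m\<close>.\<close>
    also have "\<dots> = ?\<mu> \<cdot> (\<iota> ?h \<otimes> ?\<mu>) \<cdot> ((\<iota> ?h \<otimes> al \<otimes> be) \<cdot> \<a> ?h ?m ?m) \<cdot> \<tau> ?m (?h \<odot> ?m) \<cdot> \<a> ?m ?h ?m"
      by (simp add: hexagon[symmetric] comp_assoc interchange_tail)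
    also have "\<dots> = (?\<mu> \<cdot> (?\<mu> \<otimes> \<iota> ?h)) \<cdot> ((\<iota> ?h \<otimes> al) \<otimes> be) \<cdot> \<tau> ?m (?h \<odot> ?m) \<cdot> \<a> ?m ?h ?m"
      by (simp add: nat'[symmetric] internal_monoidD(8)[OF H] comp_assoc)
    also have "\<dots> = ?\<mu> \<cdot> (\<iota> ?h \<otimes> be) \<cdot> (((?\<mu> \<cdot> (\<iota> ?h \<otimes> al)) \<otimes> \<iota> ?m) \<cdot> \<tau> ?m (?h \<odot> ?m)) \<cdot> \<a> ?m ?h ?m"
      by (simp add: comp_assoc interchange_tail)
    also have "\<dots> = ?\<mu> \<cdot> ((\<iota> ?h \<otimes> be) \<cdot> \<tau> ?m ?h) \<cdot> (\<iota> ?m \<otimes> (?\<mu> \<cdot> (\<iota> ?h \<otimes> al))) \<cdot> \<a> ?m ?h ?m"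
      by (simp only: s'[symmetric]) (simp add: comp_assoc)
    also have "\<dots> = (?\<mu> \<cdot> \<tau> ?h ?h \<cdot> (be \<otimes> \<iota> ?h)) \<cdot> (\<iota> ?m \<otimes> (?\<mu> \<cdot> (\<iota> ?h \<otimes> al))) \<cdot> \<a> ?m ?h ?m"
      by (simp only: s[symmetric]) (simp add: comp_assoc)
    finally show ?thesis .
  qed
  ultimately show ?thesis
    using right_action_restrict[OF M H cd(1)] by (simp add: bimodule_def)
qed

end

section \<open>Induced bimodules on balanced tensor products\<close>

context cat
begin

text \<open>Composing with \<open>e\<close> or its inverse shows that both pairs are coequalized by
  the same arrows. Balanced tensor products carry the associator on the leg of the left action;
  reversal makes that the other leg, with the inverse associator.\<close>

lemma coequalizer_switch:
  assumes q: "is_coequalizer V f (g \<cdot> e) q" and e: "iso_arrow V e"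
    and g: "g \<in> Arr V" "Dom V g = Cod V e"
  shows "is_coequalizer V g (f \<cdot> Inv V e) q"
proof -
  note [simp] = e g iso_Arr[OF e]
  have f: "f \<in> Arr V" "Dom V f = Dom V e" "Cod V f = Cod V g"
    and q': "q \<in> Arr V" "Dom V q = Cod V g" "q \<cdot> f = q \<cdot> g \<cdot> e"
    using coequalizer_Arr[OF q] by simp_all
  note [simp] = f q'(1,2)
  have eqv: "h \<cdot> g = h \<cdot> f \<cdot> Inv V e \<longleftrightarrow> h \<cdot> f = h \<cdot> g \<cdot> e" (is "?l \<longleftrightarrow> ?r")
    if [simp]: "h \<in> Arr V" "Dom V h = Cod V g" for h
  proof
    assume l: ?l
    have "h \<cdot> g \<cdot> e = (h \<cdot> g) \<cdot> e" by (simp add: comp_assoc)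
    also have "\<dots> = h \<cdot> f" by (simp only: l) (simp add: comp_assoc)
    finally show ?r ..
  next
    assume r: ?r
    have "h \<cdot> f \<cdot> Inv V e = (h \<cdot> f) \<cdot> Inv V e" by (simp add: comp_assoc)
    also have "\<dots> = h \<cdot> g" by (simp only: r) (simp add: comp_assoc)
    finally show ?l ..
  qed
  show ?thesis
    using q eqv[of q] q'(3) unfolding is_coequalizer_def by (simp add: parallel_def eqv cong: conj_cong)
qed

end

context monoidal_cat
begin

lemma bimoduleD:
  assumes "bimodule V M X"
  shows "bobj X \<in> Obj V"
    "lact X \<in> Arr V" "Dom V (lact X) = mobj M \<odot> bobj X" "Cod V (lact X) = bobj X"
    "ract X \<in> Arr V" "Dom V (ract X) = bobj X \<odot> mobj M" "Cod V (ract X) = bobj X"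
    "ract X \<cdot> (lact X \<otimes> \<iota> (mobj M))
       = lact X \<cdot> (\<iota> (mobj M) \<otimes> ract X) \<cdot> \<a> (mobj M) (bobj X) (mobj M)"
    "left_action V M (bobj X) (lact X)" "right_action V M (bobj X) (ract X)"
  using assms by (simp_all add: bimodule_def left_action_def right_action_def Hom_def)

lemmas bimodule_Arr = bimoduleD(1-7)

lemma compatible_actions_rev_cat:
  assumes [simp]: "x \<in> Obj V" "a \<in> Obj V" "b \<in> Obj V"
    "m \<in> Arr V" "Dom V m = a \<odot> x" "Cod V m = x" "n \<in> Arr V" "Dom V n = x \<odot> b" "Cod V n = x"
  shows "m \<cdot> (\<iota> a \<otimes> n) = n \<cdot> (m \<otimes> \<iota> b) \<cdot> Inv V (\<a> a x b)
    \<longleftrightarrow> n \<cdot> (m \<otimes> \<iota> b) = m \<cdot> (\<iota> a \<otimes> n) \<cdot> \<a> a x b" (is "?l \<longleftrightarrow> ?r")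
proof
  assume l: ?l
  have "m \<cdot> (\<iota> a \<otimes> n) \<cdot> \<a> a x b = (m \<cdot> (\<iota> a \<otimes> n)) \<cdot> \<a> a x b" by (simp add: comp_assoc)
  then show ?r by (simp only: l) (simp add: comp_assoc)
next
  assume r: ?r
  have "n \<cdot> (m \<otimes> \<iota> b) \<cdot> Inv V (\<a> a x b) = (n \<cdot> (m \<otimes> \<iota> b)) \<cdot> Inv V (\<a> a x b)"
    by (simp add: comp_assoc)
  then show ?l by (simp only: r) (simp add: comp_assoc)
qed

lemma bimodule_rev_cat:
  assumes M: "internal_monoid V M"
  shows "bimodule (rev_cat V) M (swap_bimod X) \<longleftrightarrow> bimodule V M X"
proof -
  note [simp] = internal_monoid_Arr[OF M]
  have "lact X \<cdot> (\<iota> (mobj M) \<otimes> ract X)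
      = ract X \<cdot> (lact X \<otimes> \<iota> (mobj M)) \<cdot> Inv V (\<a> (mobj M) (bobj X) (mobj M))
    \<longleftrightarrow> ract X \<cdot> (lact X \<otimes> \<iota> (mobj M))
      = lact X \<cdot> (\<iota> (mobj M) \<otimes> ract X) \<cdot> \<a> (mobj M) (bobj X) (mobj M)"
    if "left_action V M (bobj X) (lact X)" "right_action V M (bobj X) (ract X)"
    using that by (intro compatible_actions_rev_cat)
      (simp_all add: left_action_def right_action_def Hom_def)
  then show ?thesis
    by (auto simp: bimodule_def right_action_rev_cat[OF M] left_action_rev_cat[OF M])
qed

lemma bimodule_morphism_rev_cat:
  assumes M: "internal_monoid V M"
  shows "bimodule_morphism (rev_cat V) M (swap_bimod X) (swap_bimod Y) f \<longleftrightarrow> bimodule_morphism V M X Y f"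
  by (auto simp: bimodule_morphism_def bimodule_rev_cat[OF M])

lemma induced_bimodule_rev_cat:
  assumes "bobj X \<in> Obj V" "bobj Y \<in> Obj V" "mobj N \<in> Obj V"
  shows "induced_bimodule (rev_cat V) N p (swap_bimod Y) (swap_bimod X)
    = swap_bimod (induced_bimodule V N p X Y)"
  using assms by (simp add: induced_bimodule_def swap_bimod_def)

end

text \<open>The property for which \<open>bal_proj\<close> is chosen, free of the choice, so that
  one arrow \<open>p\<close> can serve in \<open>V\<close> and in \<open>rev_cat V\<close>.\<close>

definition balanced_coequalizer ::
  "('o, 'm) smcat \<Rightarrow> ('o, 'm, 'z) imon_scheme \<Rightarrow> ('o, 'm) bimod \<Rightarrow> ('o, 'm) bimod \<Rightarrow> 'm \<Rightarrow> bool" where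
  "balanced_coequalizer V M X Y p \<longleftrightarrow>
     is_coequalizer V (ract X \<otimes> \<iota> (bobj Y)) ((\<iota> (bobj X) \<otimes> lact Y) \<cdot> \<a> (bobj X) (mobj M) (bobj Y)) p"
  for V (structure)

locale tensor_coequalizers = monoidal_cat V for V :: "('o, 'm) smcat" (structure) +
  assumes coequalizers_commute: "coequalizers_commute_with_tensor V"
begin

lemma rev_tensor_coequalizers: "tensor_coequalizers (rev_cat V)"
proof -
  interpret rev: monoidal_cat "rev_cat V" by (rule monoidal_rev_cat)
  show ?thesis by unfold_locales (rule coequalizers_commute_rev_cat[OF coequalizers_commute])
qed

lemma tensor_coequalizer:
  assumes "is_coequalizer V f g q" "w \<in> Obj V"
  shows "is_coequalizer V (f \<otimes> \<iota> w) (g \<otimes> \<iota> w) (q \<otimes> \<iota> w)"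
    "is_coequalizer V (\<iota> w \<otimes> f) (\<iota> w \<otimes> g) (\<iota> w \<otimes> q)"
  using assms coequalizers_commute by (simp_all add: coequalizers_commute_with_tensor_def)

end

locale balanced_tensor = tensor_coequalizers V for V :: "('o, 'm) smcat" (structure) +
  fixes L :: "('o, 'm, 'z) imon_scheme" and X Y :: "('o, 'm) bimod" and p :: 'm
  assumes L: "internal_monoid V L"
    and X: "bimodule V L X" and Y: "bimodule V L Y"
    and p: "balanced_coequalizer V L X Y p"
begin

lemmas simps [simp] = internal_monoid_Arr[OF L] bimodule_Arr[OF X] bimodule_Arr[OF Y]

lemma p_coequalizer:
  "is_coequalizer V (ract X \<otimes> \<iota> (bobj Y)) ((\<iota> (bobj X) \<otimes> lact Y) \<cdot> \<a> (bobj X) (mobj L) (bobj Y)) p"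
  using p by (simp add: balanced_coequalizer_def)

lemma p_simps [simp]: "p \<in> Arr V" "Dom V p = bobj X \<odot> bobj Y"
  using coequalizer_Arr[OF p_coequalizer] by simp_all

lemma p_balanced:
  "p \<cdot> (ract X \<otimes> \<iota> (bobj Y)) = p \<cdot> (\<iota> (bobj X) \<otimes> lact Y) \<cdot> \<a> (bobj X) (mobj L) (bobj Y)"
  using coequalizer_Arr[OF p_coequalizer] by simp

text \<open>Tensoring preserves the coequalizer, and coequalizers are epi. With the next two
  variants, equations on the balanced tensor product can be checked on representatives in
  \<open>bobj X \<odot> bobj Y\<close>.\<close>

lemma p_tensor_epi:
  assumes "u \<cdot> (p \<otimes> \<iota> w) = v \<cdot> (p \<otimes> \<iota> w)" "w \<in> Obj V" "u \<in> Arr V" "v \<in> Arr V"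
    "Dom V u = Cod V p \<odot> w" "Dom V v = Cod V p \<odot> w"
  shows "u = v"
  by (rule coequalizer_epi[OF tensor_coequalizer(1)[OF p_coequalizer]]) (use assms in simp_all)

lemma p_tensor_tensor_epi:
  assumes "u \<cdot> ((p \<otimes> \<iota> w) \<otimes> \<iota> w') = v \<cdot> ((p \<otimes> \<iota> w) \<otimes> \<iota> w')" "w \<in> Obj V" "w' \<in> Obj V"
    "u \<in> Arr V" "v \<in> Arr V" "Dom V u = (Cod V p \<odot> w) \<odot> w'" "Dom V v = (Cod V p \<odot> w) \<odot> w'"
  shows "u = v"
  by (rule coequalizer_epi[OF tensor_coequalizer(1)[OF tensor_coequalizer(1)[OF p_coequalizer]]])
    (use assms in simp_all)

lemma tensor_p_tensor_epi:
  assumes "u \<cdot> ((\<iota> w \<otimes> p) \<otimes> \<iota> w') = v \<cdot> ((\<iota> w \<otimes> p) \<otimes> \<iota> w')" "w \<in> Obj V" "w' \<in> Obj V"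
    "u \<in> Arr V" "v \<in> Arr V" "Dom V u = (w \<odot> Cod V p) \<odot> w'" "Dom V v = (w \<odot> Cod V p) \<odot> w'"
  shows "u = v"
  by (rule coequalizer_epi[OF tensor_coequalizer(1)[OF tensor_coequalizer(2)[OF p_coequalizer]]])
    (use assms in simp_all)

text \<open>Reversal exchanges the two factors and leaves the quotient map alone: the two balanced
  pairs differ only by a transfer of the associator.\<close>

lemma rev_balanced_tensor:
  "balanced_tensor (rev_cat V) L (swap_bimod Y) (swap_bimod X) p"
proof -
  interpret rev: tensor_coequalizers "rev_cat V" by (rule rev_tensor_coequalizers)
  show ?thesis
  proof
    show "balanced_coequalizer (rev_cat V) L (swap_bimod Y) (swap_bimod X) p"
      using coequalizer_switch[OF p_coequalizer] by (simp add: balanced_coequalizer_def)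
  qed (simp_all add: internal_monoid_rev_cat[OF L] bimodule_rev_cat[OF L] X Y)
qed

text \<open>The acting monoid \<open>N\<close> may differ from \<open>L\<close>; \<open>X'\<close>
  and \<open>Y'\<close> carry N-actions on the objects of \<open>X\<close> and \<open>Y\<close>.
  Acting on the second factor respects the balancing relation because it commutes with the left
  L-action there, so it descends along \<open>p\<close>, and the action laws are inherited from
  \<open>Y'\<close>.\<close>

lemma induced_ract:
  fixes N :: "('o, 'm, 'y) imon_scheme"
  assumes N: "internal_monoid V N" and XY': "bobj X' = bobj X" "bobj Y' = bobj Y"
    and act: "right_action V N (bobj Y) (ract Y')"
    and comm: "ract Y' \<cdot> (lact Y \<otimes> \<iota> (mobj N))
      = lact Y \<cdot> (\<iota> (mobj L) \<otimes> ract Y') \<cdot> \<a> (mobj L) (bobj Y) (mobj N)"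
  defines "n \<equiv> ract (induced_bimodule V N p X' Y')"
  shows "n \<in> Arr V" "Dom V n = Cod V p \<odot> mobj N" "Cod V n = Cod V p"
    "n \<cdot> (p \<otimes> \<iota> (mobj N)) = p \<cdot> (\<iota> (bobj X) \<otimes> ract Y') \<cdot> \<a> (bobj X) (bobj Y) (mobj N)"
    "right_action V N (Cod V p) n"
proof -
  let ?X = "bobj X" and ?Y = "bobj Y" and ?L = "mobj L" and ?N = "mobj N" and ?r = "ract Y'"
  have r [simp]: "?r \<in> Arr V" "Dom V ?r = ?Y \<odot> ?N" "Cod V ?r = ?Y"
    and r_mult: "?r \<cdot> (?r \<otimes> \<iota> ?N) = ?r \<cdot> (\<iota> ?Y \<otimes> mmul N) \<cdot> \<a> ?Y ?N ?N"
    and r_unit: "?r \<cdot> (\<iota> ?Y \<otimes> mone N) = \<r> ?Y"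
    using act by (simp_all add: right_action_def Hom_def)
  note [simp] = internal_monoid_Arr[OF N] XY'
  let ?h = "p \<cdot> (\<iota> ?X \<otimes> ?r) \<cdot> \<a> ?X ?Y ?N"
  \<comment> \<open>\<open>?h\<close> acts on representatives. Balancing moves the L-action from the
    first factor to the second, and \<open>comm\<close> then moves it past the N-action.\<close>
  have "?h \<cdot> ((ract X \<otimes> \<iota> ?Y) \<otimes> \<iota> ?N) = p \<cdot> (\<iota> ?X \<otimes> ?r) \<cdot> (ract X \<otimes> \<iota> (?Y \<odot> ?N)) \<cdot> \<a> (?X \<odot> ?L) ?Y ?N"
    using assoc_natural[of "ract X" "\<iota> ?Y" "\<iota> ?N"] by (simp add: comp_assoc)
  also have "\<dots> = (p \<cdot> (ract X \<otimes> \<iota> ?Y)) \<cdot> (\<iota> (?X \<odot> ?L) \<otimes> ?r) \<cdot> \<a> (?X \<odot> ?L) ?Y ?N"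
    by (simp add: interchange_tail comp_assoc)
  also have "\<dots> = p \<cdot> (\<iota> ?X \<otimes> lact Y) \<cdot> (\<a> ?X ?L ?Y \<cdot> (\<iota> (?X \<odot> ?L) \<otimes> ?r)) \<cdot> \<a> (?X \<odot> ?L) ?Y ?N"
    by (simp only: p_balanced) (simp add: comp_assoc)
  also have "\<a> ?X ?L ?Y \<cdot> (\<iota> (?X \<odot> ?L) \<otimes> ?r) = (\<iota> ?X \<otimes> \<iota> ?L \<otimes> ?r) \<cdot> \<a> ?X ?L (?Y \<odot> ?N)"
    using assoc_natural[of "\<iota> ?X" "\<iota> ?L" ?r] by simp
  also have "p \<cdot> (\<iota> ?X \<otimes> lact Y) \<cdot> ((\<iota> ?X \<otimes> \<iota> ?L \<otimes> ?r) \<cdot> \<a> ?X ?L (?Y \<odot> ?N)) \<cdot> \<a> (?X \<odot> ?L) ?Y ?N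
    = p \<cdot> (\<iota> ?X \<otimes> (lact Y \<cdot> (\<iota> ?L \<otimes> ?r))) \<cdot> (\<a> ?X ?L (?Y \<odot> ?N) \<cdot> \<a> (?X \<odot> ?L) ?Y ?N)"
    by (simp add: interchange_tail comp_assoc)
  also have "\<dots> = p \<cdot> (\<iota> ?X \<otimes> (lact Y \<cdot> (\<iota> ?L \<otimes> ?r) \<cdot> \<a> ?L ?Y ?N)) \<cdot> \<a> ?X (?L \<odot> ?Y) ?N \<cdot> (\<a> ?X ?L ?Y \<otimes> \<iota> ?N)"
    by (simp add: pentagon[symmetric] interchange_tail comp_assoc)
  also have "\<dots> = p \<cdot> (\<iota> ?X \<otimes> ?r) \<cdot> ((\<iota> ?X \<otimes> lact Y \<otimes> \<iota> ?N) \<cdot> \<a> ?X (?L \<odot> ?Y) ?N) \<cdot> (\<a> ?X ?L ?Y \<otimes> \<iota> ?N)"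
    by (simp only: comm[symmetric]) (simp add: interchange_tail comp_assoc)
  also have "(\<iota> ?X \<otimes> lact Y \<otimes> \<iota> ?N) \<cdot> \<a> ?X (?L \<odot> ?Y) ?N = \<a> ?X ?Y ?N \<cdot> ((\<iota> ?X \<otimes> lact Y) \<otimes> \<iota> ?N)"
    using assoc_natural[of "\<iota> ?X" "lact Y" "\<iota> ?N"] by simp
  finally have "?h \<cdot> ((ract X \<otimes> \<iota> ?Y) \<otimes> \<iota> ?N) = ?h \<cdot> (((\<iota> ?X \<otimes> lact Y) \<cdot> \<a> ?X ?L ?Y) \<otimes> \<iota> ?N)"
    by (simp add: interchange comp_assoc)
  then obtain u where u: "u \<in> Arr V" "Dom V u = Cod V p \<odot> ?N" "Cod V u = Cod V p" "u \<cdot> (p \<otimes> \<iota> ?N) = ?h"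
    by (elim coequalizer_factor[OF tensor_coequalizer(1)[OF p_coequalizer], rotated 3]) simp_all
  \<comment> \<open>The factorization is unique because \<open>p \<otimes> \<iota> ?N\<close> is
    epi, which resolves the definite description.\<close>
  have "n = u"
    unfolding n_def induced_bimodule_def
    by (simp add: Hom_def, rule the_equality)
      (use u in \<open>auto intro: p_tensor_epi[where w = ?N]\<close>)
  then show n [simp]: "n \<in> Arr V" "Dom V n = Cod V p \<odot> ?N" "Cod V n = Cod V p"
    and np: "n \<cdot> (p \<otimes> \<iota> ?N) = ?h"
    using u by simp_all
  let ?C = "Cod V p"
  have "n \<cdot> (n \<otimes> \<iota> ?N) = n \<cdot> (\<iota> ?C \<otimes> mmul N) \<cdot> \<a> ?C ?N ?N"
  proof (rule p_tensor_tensor_epi[where w = ?N and w' = ?N])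
    have "(n \<cdot> (n \<otimes> \<iota> ?N)) \<cdot> ((p \<otimes> \<iota> ?N) \<otimes> \<iota> ?N) = n \<cdot> ((n \<cdot> (p \<otimes> \<iota> ?N)) \<otimes> \<iota> ?N)"
      by (simp add: comp_assoc interchange)
    also have "\<dots> = (n \<cdot> (p \<otimes> \<iota> ?N)) \<cdot> ((\<iota> ?X \<otimes> ?r) \<otimes> \<iota> ?N) \<cdot> (\<a> ?X ?Y ?N \<otimes> \<iota> ?N)"
      by (subst np) (simp add: interchange interchange_tail comp_assoc)
    also have "\<dots> = p \<cdot> (\<iota> ?X \<otimes> ?r) \<cdot> (\<a> ?X ?Y ?N \<cdot> ((\<iota> ?X \<otimes> ?r) \<otimes> \<iota> ?N)) \<cdot> (\<a> ?X ?Y ?N \<otimes> \<iota> ?N)"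
      by (simp only: np) (simp add: comp_assoc)
    also have "\<a> ?X ?Y ?N \<cdot> ((\<iota> ?X \<otimes> ?r) \<otimes> \<iota> ?N) = (\<iota> ?X \<otimes> ?r \<otimes> \<iota> ?N) \<cdot> \<a> ?X (?Y \<odot> ?N) ?N"
      using assoc_natural[of "\<iota> ?X" ?r "\<iota> ?N"] by simp
    also have "p \<cdot> (\<iota> ?X \<otimes> ?r) \<cdot> ((\<iota> ?X \<otimes> ?r \<otimes> \<iota> ?N) \<cdot> \<a> ?X (?Y \<odot> ?N) ?N) \<cdot> (\<a> ?X ?Y ?N \<otimes> \<iota> ?N)
      = p \<cdot> (\<iota> ?X \<otimes> (?r \<cdot> (?r \<otimes> \<iota> ?N))) \<cdot> \<a> ?X (?Y \<odot> ?N) ?N \<cdot> (\<a> ?X ?Y ?N \<otimes> \<iota> ?N)"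
      by (simp add: interchange_tail comp_assoc)
    also have "\<dots> = p \<cdot> (\<iota> ?X \<otimes> ?r) \<cdot> (\<iota> ?X \<otimes> \<iota> ?Y \<otimes> mmul N)
        \<cdot> ((\<iota> ?X \<otimes> \<a> ?Y ?N ?N) \<cdot> \<a> ?X (?Y \<odot> ?N) ?N \<cdot> (\<a> ?X ?Y ?N \<otimes> \<iota> ?N))"
      by (simp only: r_mult) (simp add: interchange_tail comp_assoc)
    also have "\<dots> = p \<cdot> (\<iota> ?X \<otimes> ?r) \<cdot> ((\<iota> ?X \<otimes> \<iota> ?Y \<otimes> mmul N) \<cdot> \<a> ?X ?Y (?N \<odot> ?N)) \<cdot> \<a> (?X \<odot> ?Y) ?N ?N"
      by (simp only: pentagon simps internal_monoid_Arr[OF N]) (simp add: comp_assoc)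
    also have "(\<iota> ?X \<otimes> \<iota> ?Y \<otimes> mmul N) \<cdot> \<a> ?X ?Y (?N \<odot> ?N) = \<a> ?X ?Y ?N \<cdot> (\<iota> (?X \<odot> ?Y) \<otimes> mmul N)"
      using assoc_natural[of "\<iota> ?X" "\<iota> ?Y" "mmul N"] by simp
    also have "p \<cdot> (\<iota> ?X \<otimes> ?r) \<cdot> (\<a> ?X ?Y ?N \<cdot> (\<iota> (?X \<odot> ?Y) \<otimes> mmul N)) \<cdot> \<a> (?X \<odot> ?Y) ?N ?N
      = ?h \<cdot> (\<iota> (?X \<odot> ?Y) \<otimes> mmul N) \<cdot> \<a> (?X \<odot> ?Y) ?N ?N"
      by (simp add: comp_assoc)
    also have "\<dots> = n \<cdot> (\<iota> ?C \<otimes> mmul N) \<cdot> ((p \<otimes> \<iota> (?N \<odot> ?N)) \<cdot> \<a> (?X \<odot> ?Y) ?N ?N)"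
      by (simp only: np[symmetric]) (simp add: comp_assoc interchange_tail)
    also have "(p \<otimes> \<iota> (?N \<odot> ?N)) \<cdot> \<a> (?X \<odot> ?Y) ?N ?N = \<a> ?C ?N ?N \<cdot> ((p \<otimes> \<iota> ?N) \<otimes> \<iota> ?N)"
      using assoc_natural[of p "\<iota> ?N" "\<iota> ?N"] by simp
    finally show "(n \<cdot> (n \<otimes> \<iota> ?N)) \<cdot> ((p \<otimes> \<iota> ?N) \<otimes> \<iota> ?N)
      = (n \<cdot> (\<iota> ?C \<otimes> mmul N) \<cdot> \<a> ?C ?N ?N) \<cdot> ((p \<otimes> \<iota> ?N) \<otimes> \<iota> ?N)"
      by (simp add: comp_assoc)
  qed simp_all
  moreover have "n \<cdot> (\<iota> ?C \<otimes> mone N) = \<r> ?C"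
  proof (rule p_tensor_epi[where w = \<k>])
    have "(n \<cdot> (\<iota> ?C \<otimes> mone N)) \<cdot> (p \<otimes> \<iota> \<k>) = (n \<cdot> (p \<otimes> \<iota> ?N)) \<cdot> (\<iota> (?X \<odot> ?Y) \<otimes> mone N)"
      by (simp add: comp_assoc interchange)
    also have "\<dots> = p \<cdot> (\<iota> ?X \<otimes> ?r) \<cdot> (\<a> ?X ?Y ?N \<cdot> (\<iota> (?X \<odot> ?Y) \<otimes> mone N))"
      by (simp only: np) (simp add: comp_assoc)
    also have "\<a> ?X ?Y ?N \<cdot> (\<iota> (?X \<odot> ?Y) \<otimes> mone N) = (\<iota> ?X \<otimes> \<iota> ?Y \<otimes> mone N) \<cdot> \<a> ?X ?Y \<k>"
      using assoc_natural[of "\<iota> ?X" "\<iota> ?Y" "mone N"] by simp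
    also have "p \<cdot> (\<iota> ?X \<otimes> ?r) \<cdot> (\<iota> ?X \<otimes> \<iota> ?Y \<otimes> mone N) \<cdot> \<a> ?X ?Y \<k> = p \<cdot> \<r> (?X \<odot> ?Y)"
      by (simp add: interchange_tail r_unit runit_tensor)
    finally show "(n \<cdot> (\<iota> ?C \<otimes> mone N)) \<cdot> (p \<otimes> \<iota> \<k>) = \<r> ?C \<cdot> (p \<otimes> \<iota> \<k>)"
      using runit_natural[of p] by simp
  qed simp_all
  ultimately show "right_action V N ?C n" by (simp add: right_action_def Hom_def)
qed

text \<open>This is \<open>induced_ract\<close> in the reversed category, with the commutation
  hypothesis rewritten for the inverse associator.\<close>

lemma induced_lact:
  fixes N :: "('o, 'm, 'y) imon_scheme"
  assumes N: "internal_monoid V N" and XY': "bobj X' = bobj X" "bobj Y' = bobj Y"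
    and act: "left_action V N (bobj X) (lact X')"
    and comm: "ract X \<cdot> (lact X' \<otimes> \<iota> (mobj L))
      = lact X' \<cdot> (\<iota> (mobj N) \<otimes> ract X) \<cdot> \<a> (mobj N) (bobj X) (mobj L)"
  defines "n \<equiv> lact (induced_bimodule V N p X' Y')"
  shows "n \<in> Arr V" "Dom V n = mobj N \<odot> Cod V p" "Cod V n = Cod V p"
    "n \<cdot> (\<iota> (mobj N) \<otimes> p)
      = p \<cdot> (lact X' \<otimes> \<iota> (bobj Y)) \<cdot> Inv V (\<a> (mobj N) (bobj X) (bobj Y))"
    "left_action V N (Cod V p) n"
proof -
  interpret rev: balanced_tensor "rev_cat V" L "swap_bimod Y" "swap_bimod X" p
    by (rule rev_balanced_tensor)
  note [simp] = internal_monoid_Arr[OF N] XY'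
  have l [simp]: "lact X' \<in> Arr V" "Dom V (lact X') = mobj N \<odot> bobj X" "Cod V (lact X') = bobj X"
    using act by (simp_all add: left_action_def Hom_def)
  have n: "ract (induced_bimodule (rev_cat V) N p (swap_bimod Y') (swap_bimod X')) = n"
    by (simp add: induced_bimodule_rev_cat n_def)
  have act': "right_action (rev_cat V) N (bobj (swap_bimod X)) (ract (swap_bimod X'))"
    using act by (simp add: right_action_rev_cat[OF N])
  have comm': "ract (swap_bimod X') \<cdot>\<^bsub>rev_cat V\<^esub> (lact (swap_bimod X) \<otimes>\<^bsub>rev_cat V\<^esub> \<iota>\<^bsub>rev_cat V\<^esub> (mobj N))
      = lact (swap_bimod X) \<cdot>\<^bsub>rev_cat V\<^esub> (\<iota>\<^bsub>rev_cat V\<^esub> (mobj L) \<otimes>\<^bsub>rev_cat V\<^esub> ract (swap_bimod X'))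
        \<cdot>\<^bsub>rev_cat V\<^esub> \<a>\<^bsub>rev_cat V\<^esub> (mobj L) (bobj (swap_bimod X)) (mobj N)"
    using comm by (simp add: compatible_actions_rev_cat)
  note rev = rev.induced_ract[OF internal_monoid_rev_cat[OF N] _ _ act' comm',
      of "swap_bimod Y'", unfolded n, simplified, simplified right_action_rev_cat[OF N]]
  show "n \<in> Arr V" "Dom V n = mobj N \<odot> Cod V p" "Cod V n = Cod V p"
    "n \<cdot> (\<iota> (mobj N) \<otimes> p)
      = p \<cdot> (lact X' \<otimes> \<iota> (bobj Y)) \<cdot> Inv V (\<a> (mobj N) (bobj X) (bobj Y))"
    "left_action V N (Cod V p) n"
    by (rule rev)+
qed

text \<open>The left action touches only the first factor and the right action only the second, so
  on representatives they commute by the interchange law; the epi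
  \<open>(\<iota> ?N \<otimes> p) \<otimes> \<iota> ?N\<close> carries this to the quotient.\<close>

lemma induced_bimodule:
  fixes N :: "('o, 'm, 'y) imon_scheme"
  assumes N: "internal_monoid V N" and XY': "bobj X' = bobj X" "bobj Y' = bobj Y"
    and lact: "left_action V N (bobj X) (lact X')"
    and ract: "right_action V N (bobj Y) (ract Y')"
    and lcomm: "ract X \<cdot> (lact X' \<otimes> \<iota> (mobj L))
      = lact X' \<cdot> (\<iota> (mobj N) \<otimes> ract X) \<cdot> \<a> (mobj N) (bobj X) (mobj L)"
    and rcomm: "ract Y' \<cdot> (lact Y \<otimes> \<iota> (mobj N))
      = lact Y \<cdot> (\<iota> (mobj L) \<otimes> ract Y') \<cdot> \<a> (mobj L) (bobj Y) (mobj N)"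
  shows "bimodule V N (induced_bimodule V N p X' Y')"
proof -
  define l where "l = lact (induced_bimodule V N p X' Y')"
  define r where "r = ract (induced_bimodule V N p X' Y')"
  note lD = induced_lact[OF N XY' lact lcomm, folded l_def]
  note rD = induced_ract[OF N XY' ract rcomm, folded r_def]
  note [simp] = internal_monoid_Arr[OF N] XY' lD(1-3) rD(1-3)
  have [simp]: "lact X' \<in> Arr V" "Dom V (lact X') = mobj N \<odot> bobj X" "Cod V (lact X') = bobj X"
    "ract Y' \<in> Arr V" "Dom V (ract Y') = bobj Y \<odot> mobj N" "Cod V (ract Y') = bobj Y"
    using lact ract by (simp_all add: left_action_def right_action_def Hom_def)
  let ?X = "bobj X" and ?Y = "bobj Y" and ?N = "mobj N" and ?C = "Cod V p"
  have "r \<cdot> (l \<otimes> \<iota> ?N) = l \<cdot> (\<iota> ?N \<otimes> r) \<cdot> \<a> ?N ?C ?N"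
  proof (rule tensor_p_tensor_epi[where w = ?N and w' = ?N])
    \<comment> \<open>A pentagon with two associators moved across: it links the bracketing in which
      the left action comes first to the one in which the right action does.\<close>
    have pent: "(Inv V (\<a> ?N ?X (?Y \<odot> ?N)) \<cdot> (\<iota> ?N \<otimes> \<a> ?X ?Y ?N)) \<cdot> \<a> ?N (?X \<odot> ?Y) ?N
      = \<a> (?N \<odot> ?X) ?Y ?N \<cdot> (Inv V (\<a> ?N ?X ?Y) \<otimes> \<iota> ?N)" (is "?l = ?r")
    proof (rule iso_cancel_right[where e = "\<a> ?N ?X ?Y \<otimes> \<iota> ?N"])
      show "?l \<cdot> (\<a> ?N ?X ?Y \<otimes> \<iota> ?N) = ?r \<cdot> (\<a> ?N ?X ?Y \<otimes> \<iota> ?N)"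
        by (simp add: comp_assoc pentagon interchange)
    qed simp_all
    have "(r \<cdot> (l \<otimes> \<iota> ?N)) \<cdot> ((\<iota> ?N \<otimes> p) \<otimes> \<iota> ?N) = r \<cdot> ((l \<cdot> (\<iota> ?N \<otimes> p)) \<otimes> \<iota> ?N)"
      by (simp add: comp_assoc interchange)
    also have "\<dots> = (r \<cdot> (p \<otimes> \<iota> ?N)) \<cdot> ((lact X' \<otimes> \<iota> ?Y) \<otimes> \<iota> ?N) \<cdot> (Inv V (\<a> ?N ?X ?Y) \<otimes> \<iota> ?N)"
      by (simp only: lD(4)) (simp add: comp_assoc interchange interchange_tail)
    also have "\<dots> = p \<cdot> (\<iota> ?X \<otimes> ract Y') \<cdot> (\<a> ?X ?Y ?N \<cdot> ((lact X' \<otimes> \<iota> ?Y) \<otimes> \<iota> ?N)) \<cdot> (Inv V (\<a> ?N ?X ?Y) \<otimes> \<iota> ?N)"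
      by (simp only: rD(4)) (simp add: comp_assoc)
    also have "\<a> ?X ?Y ?N \<cdot> ((lact X' \<otimes> \<iota> ?Y) \<otimes> \<iota> ?N) = (lact X' \<otimes> \<iota> (?Y \<odot> ?N)) \<cdot> \<a> (?N \<odot> ?X) ?Y ?N"
      using assoc_natural[of "lact X'" "\<iota> ?Y" "\<iota> ?N"] by simp
    also have "p \<cdot> (\<iota> ?X \<otimes> ract Y') \<cdot> ((lact X' \<otimes> \<iota> (?Y \<odot> ?N)) \<cdot> \<a> (?N \<odot> ?X) ?Y ?N) \<cdot> (Inv V (\<a> ?N ?X ?Y) \<otimes> \<iota> ?N)
      = p \<cdot> (lact X' \<otimes> ract Y') \<cdot> (\<a> (?N \<odot> ?X) ?Y ?N \<cdot> (Inv V (\<a> ?N ?X ?Y) \<otimes> \<iota> ?N))"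
      by (simp add: comp_assoc interchange_tail)
    also have "\<dots> = p \<cdot> (lact X' \<otimes> \<iota> ?Y) \<cdot> ((\<iota> (?N \<odot> ?X) \<otimes> ract Y') \<cdot> Inv V (\<a> ?N ?X (?Y \<odot> ?N)))
        \<cdot> (\<iota> ?N \<otimes> \<a> ?X ?Y ?N) \<cdot> \<a> ?N (?X \<odot> ?Y) ?N"
      by (simp only: pent[symmetric]) (simp add: comp_assoc interchange_tail)
    also have "(\<iota> (?N \<odot> ?X) \<otimes> ract Y') \<cdot> Inv V (\<a> ?N ?X (?Y \<odot> ?N)) = Inv V (\<a> ?N ?X ?Y) \<cdot> (\<iota> ?N \<otimes> \<iota> ?X \<otimes> ract Y')"
      using assoc_inv_natural[of "\<iota> ?N" "\<iota> ?X" "ract Y'"] by simp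
    also have "p \<cdot> (lact X' \<otimes> \<iota> ?Y) \<cdot> (Inv V (\<a> ?N ?X ?Y) \<cdot> (\<iota> ?N \<otimes> \<iota> ?X \<otimes> ract Y'))
        \<cdot> (\<iota> ?N \<otimes> \<a> ?X ?Y ?N) \<cdot> \<a> ?N (?X \<odot> ?Y) ?N
      = (p \<cdot> (lact X' \<otimes> \<iota> ?Y) \<cdot> Inv V (\<a> ?N ?X ?Y)) \<cdot> (\<iota> ?N \<otimes> ((\<iota> ?X \<otimes> ract Y') \<cdot> \<a> ?X ?Y ?N))
        \<cdot> \<a> ?N (?X \<odot> ?Y) ?N"
      by (simp add: comp_assoc interchange_tail)
    also have "\<dots> = l \<cdot> (\<iota> ?N \<otimes> (p \<cdot> (\<iota> ?X \<otimes> ract Y') \<cdot> \<a> ?X ?Y ?N)) \<cdot> \<a> ?N (?X \<odot> ?Y) ?N"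
      by (simp only: lD(4)[symmetric]) (simp add: comp_assoc interchange_tail)
    also have "\<dots> = l \<cdot> (\<iota> ?N \<otimes> r) \<cdot> ((\<iota> ?N \<otimes> p \<otimes> \<iota> ?N) \<cdot> \<a> ?N (?X \<odot> ?Y) ?N)"
      by (simp only: rD(4)[symmetric]) (simp add: comp_assoc interchange_tail)
    also have "(\<iota> ?N \<otimes> p \<otimes> \<iota> ?N) \<cdot> \<a> ?N (?X \<odot> ?Y) ?N = \<a> ?N ?C ?N \<cdot> ((\<iota> ?N \<otimes> p) \<otimes> \<iota> ?N)"
      using assoc_natural[of "\<iota> ?N" p "\<iota> ?N"] by simp
    finally show "(r \<cdot> (l \<otimes> \<iota> ?N)) \<cdot> ((\<iota> ?N \<otimes> p) \<otimes> \<iota> ?N)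
      = (l \<cdot> (\<iota> ?N \<otimes> r) \<cdot> \<a> ?N ?C ?N) \<cdot> ((\<iota> ?N \<otimes> p) \<otimes> \<iota> ?N)"
      by (simp add: comp_assoc)
  qed simp_all
  moreover have "bobj (induced_bimodule V N p X' Y') = ?C" by (simp add: induced_bimodule_def)
  ultimately show ?thesis
    using lD(5) rD(5) by (simp add: bimodule_def l_def r_def)
qed

end

context symmetric_monoidal_cat
begin

lemma left_mult_bimodule:
  assumes "commuting_pair V M H al be" and M: "internal_monoid V M" and "internal_monoid V H"
  shows "bimodule V M (left_mult_bimodule V H al be)"
proof -
  interpret rev: symmetric_monoidal_cat "rev_cat V" by (rule symm_rev_cat)
  show ?thesis
    using rev.right_mult_bimodule[of M H al be] assms
    by (simp add: commuting_pair_rev_cat internal_monoid_rev_cat mult_bimodule_rev_cat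
        bimodule_rev_cat[OF M])
qed

end

section \<open>Linearity of the comultiplication\<close>

text \<open>Formulated for any balanced coequalizer \<open>p\<close>, with \<open>rho\<close> and
  \<open>lam\<close> as parameters, so that a right bialgebroid gives an instance over
  \<open>rev_cat V\<close>: its left action of H \<otimes> H plays \<open>rho\<close>, its right
  action of H plays \<open>lam\<close>.\<close>

locale left_bialgebroid_data =
  symmetric_monoidal_cat V + tensor_coequalizers V for V :: "('o, 'm) smcat" (structure) +
  fixes L :: "('o, 'm, 'z) imon_scheme" and H :: "('o, 'm) bialgd" and p rho lam :: 'm
  assumes L: "internal_monoid V L" and H: "internal_monoid V H"
    and commuting: "commuting_pair V L H (alpha H) (beta H)"
    and p: "balanced_coequalizer V L (left_bimod V H) (left_bimod V H) p"
    and comul: "bimodule_morphism V L (left_bimod V H)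
      (induced_bimodule V L p (left_bimod V H) (left_bimod V H)) (comul H)"
    and counit: "counit H \<in> Hom V (mobj H) (mobj L)"
    and rho: "left_bialgebroid_rho V H p rho"
    and lam: "left_bialgebroid_lam V H p rho lam"
    and lam_action: "left_action V H (Cod V p) lam"
begin

abbreviation X where "X \<equiv> left_bimod V H"
abbreviation h where "h \<equiv> mobj H"
abbreviation C where "C \<equiv> Cod V p"
abbreviation \<mu> where "\<mu> \<equiv> mmul H"
abbreviation \<eta> where "\<eta> \<equiv> mone H"
abbreviation \<alpha> where "\<alpha> \<equiv> alpha H"
abbreviation \<beta> where "\<beta> \<equiv> beta H"
abbreviation \<Delta> where "\<Delta> \<equiv> comul H"
abbreviation \<epsilon> where "\<epsilon> \<equiv> counit H"

lemmas commutingD = commuting_pairD[OF commuting L H]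

lemmas arrow_simps [simp] = internal_monoid_Arr[OF L] internal_monoid_Arr[OF H]
  monoid_morphismD(1-3)[OF commutingD(1)] monoid_morphismD(1-3)[OF commutingD(2), simplified]

lemma bimodule_X: "bimodule V L X"
  by (rule left_mult_bimodule[OF commuting L H])

sublocale bal: balanced_tensor V L X X p
  by unfold_locales (rule L bimodule_X p)+

lemma Dom_p [simp]: "Dom V p = h \<odot> h"
  using bal.p_simps by simp

lemma comul_simps [simp]: "\<Delta> \<in> Arr V" "Dom V \<Delta> = h" "Cod V \<Delta> = C"
  using comul by (simp_all add: bimodule_morphism_def Hom_def induced_bimodule_def)

lemma counit_simps [simp]: "\<epsilon> \<in> Arr V" "Dom V \<epsilon> = h" "Cod V \<epsilon> = mobj L"
  using counit by (simp_all add: Hom_def)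

lemma rho_simps [simp]: "rho \<in> Arr V" "Dom V rho = C \<odot> h \<odot> h" "Cod V rho = C"
  and rho_p: "rho \<cdot> (p \<otimes> \<iota> (h \<odot> h)) = p \<cdot> tensor_square_mult V H"
  using rho by (simp_all add: left_bialgebroid_rho_def Hom_def)

lemma lam_simps [simp]: "lam \<in> Arr V" "Dom V lam = h \<odot> C" "Cod V lam = C"
  and lam_p: "lam \<cdot> (\<iota> h \<otimes> p) = rho \<cdot> (\<Delta> \<otimes> \<iota> (h \<odot> h))"
  using lam by (simp_all add: left_bialgebroid_lam_def Hom_def)

section \<open>Multiplication by 1 \<otimes> f and f \<otimes> 1\<close>

lemma mult_unit: "\<mu> \<cdot> (\<iota> h \<otimes> \<eta>) = \<r> h"
  by (rule internal_monoidD(10)[OF H])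

lemma tensor_square_mult_simps [simp]:
  "tensor_square_mult V H \<in> Arr V" "Dom V (tensor_square_mult V H) = (h \<odot> h) \<odot> h \<odot> h"
  "Cod V (tensor_square_mult V H) = h \<odot> h"
  by (simp_all add: tensor_square_mult_def)

text \<open>In elements, (a \<otimes> b)(1 \<otimes> f(r)) = a \<otimes> b f(r). Naturality moves
  the middle swap in front of \<open>\<eta>\<close> and \<open>f\<close>, where one of the crossing
  factors is the unit.\<close>

lemma tensor_square_mult_right:
  assumes [simp]: "f \<in> Arr V" "Dom V f = x" "Cod V f = h"
  shows "tensor_square_mult V H \<cdot> (\<iota> (h \<odot> h) \<otimes> \<eta> \<otimes> f)
    = (\<iota> h \<otimes> (\<mu> \<cdot> (\<iota> h \<otimes> f))) \<cdot> \<a> h h x \<cdot> (\<iota> (h \<odot> h) \<otimes> \<l> x)"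
proof -
  have [simp]: "x \<in> Obj V" using Dom_Cod_Obj(1)[of f] by simp
  have "tensor_square_mult V H \<cdot> (\<iota> (h \<odot> h) \<otimes> \<eta> \<otimes> f)
    = (\<mu> \<otimes> \<mu>) \<cdot> ((\<iota> h \<otimes> \<eta>) \<otimes> \<iota> h \<otimes> f) \<cdot> middle_swap V h h \<k> x"
    using middle_swap_natural[of "\<iota> h" "\<iota> h" \<eta> f] by (simp add: tensor_square_mult_def comp_assoc)
  also have "\<dots> = (\<iota> h \<otimes> (\<mu> \<cdot> (\<iota> h \<otimes> f))) \<cdot> (\<r> h \<otimes> \<iota> (h \<odot> x)) \<cdot> middle_swap V h h \<k> x"
    by (simp add: interchange_tail mult_unit)
  finally show ?thesis by (simp add: middle_swap_unit_left)
qed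

text \<open>In elements, (a \<otimes> b)(f(r) \<otimes> 1) = a f(r) \<otimes> b. The argument r has
  to pass b, hence the symmetry on the right-hand side.\<close>

lemma tensor_square_mult_left:
  assumes [simp]: "f \<in> Arr V" "Dom V f = x" "Cod V f = h"
  shows "tensor_square_mult V H \<cdot> (\<iota> (h \<odot> h) \<otimes> f \<otimes> \<eta>)
    = ((\<mu> \<cdot> (\<iota> h \<otimes> f)) \<otimes> \<iota> h) \<cdot> Inv V (\<a> h x h) \<cdot> (\<iota> h \<otimes> \<tau> h x) \<cdot> \<a> h h x
      \<cdot> (\<iota> (h \<odot> h) \<otimes> \<r> x)"
proof -
  have [simp]: "x \<in> Obj V" using Dom_Cod_Obj(1)[of f] by simp
  have "tensor_square_mult V H \<cdot> (\<iota> (h \<odot> h) \<otimes> f \<otimes> \<eta>)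
    = (\<mu> \<otimes> \<mu>) \<cdot> ((\<iota> h \<otimes> f) \<otimes> \<iota> h \<otimes> \<eta>) \<cdot> middle_swap V h h x \<k>"
    using middle_swap_natural[of "\<iota> h" "\<iota> h" f \<eta>] by (simp add: tensor_square_mult_def comp_assoc)
  also have "\<dots> = ((\<mu> \<cdot> (\<iota> h \<otimes> f)) \<otimes> \<iota> h) \<cdot> (\<iota> (h \<odot> x) \<otimes> \<r> h) \<cdot> middle_swap V h h x \<k>"
    by (simp add: interchange_tail mult_unit)
  finally show ?thesis by (simp add: middle_swap_unit_right)
qed

lemma rho_right:
  assumes [simp]: "f \<in> Arr V" "Dom V f = x" "Cod V f = h"
  shows "rho \<cdot> (p \<otimes> \<eta> \<otimes> f)
    = p \<cdot> (\<iota> h \<otimes> (\<mu> \<cdot> (\<iota> h \<otimes> f))) \<cdot> \<a> h h x \<cdot> (\<iota> (h \<odot> h) \<otimes> \<l> x)"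
proof -
  have [simp]: "x \<in> Obj V" using Dom_Cod_Obj(1)[of f] by simp
  have "rho \<cdot> (p \<otimes> \<eta> \<otimes> f) = (rho \<cdot> (p \<otimes> \<iota> (h \<odot> h))) \<cdot> (\<iota> (h \<odot> h) \<otimes> \<eta> \<otimes> f)"
    by (simp add: comp_assoc interchange)
  also have "\<dots> = p \<cdot> tensor_square_mult V H \<cdot> (\<iota> (h \<odot> h) \<otimes> \<eta> \<otimes> f)"
    by (simp only: rho_p) (simp add: comp_assoc)
  finally show ?thesis by (simp add: tensor_square_mult_right)
qed

lemma rho_left:
  assumes [simp]: "f \<in> Arr V" "Dom V f = x" "Cod V f = h"
  shows "rho \<cdot> (p \<otimes> f \<otimes> \<eta>)
    = p \<cdot> ((\<mu> \<cdot> (\<iota> h \<otimes> f)) \<otimes> \<iota> h) \<cdot> Inv V (\<a> h x h) \<cdot> (\<iota> h \<otimes> \<tau> h x) \<cdot> \<a> h h x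
      \<cdot> (\<iota> (h \<odot> h) \<otimes> \<r> x)"
proof -
  have [simp]: "x \<in> Obj V" using Dom_Cod_Obj(1)[of f] by simp
  have "rho \<cdot> (p \<otimes> f \<otimes> \<eta>) = (rho \<cdot> (p \<otimes> \<iota> (h \<odot> h))) \<cdot> (\<iota> (h \<odot> h) \<otimes> f \<otimes> \<eta>)"
    by (simp add: comp_assoc interchange)
  also have "\<dots> = p \<cdot> tensor_square_mult V H \<cdot> (\<iota> (h \<odot> h) \<otimes> f \<otimes> \<eta>)"
    by (simp only: rho_p) (simp add: comp_assoc)
  finally show ?thesis by (simp add: tensor_square_mult_left)
qed

text \<open>The case \<open>f = \<eta>\<close> of \<open>rho_right\<close>, transported from
  representatives along the epi \<open>p \<otimes> \<iota> (\<k> \<odot> \<k>)\<close>.\<close>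

lemma rho_unit: "rho \<cdot> (\<iota> C \<otimes> \<eta> \<otimes> \<eta>) = \<r> C \<cdot> (\<iota> C \<otimes> \<l> \<k>)"
proof (rule bal.p_tensor_epi[where w = "\<k> \<odot> \<k>"])
  have "(rho \<cdot> (\<iota> C \<otimes> \<eta> \<otimes> \<eta>)) \<cdot> (p \<otimes> \<iota> (\<k> \<odot> \<k>)) = rho \<cdot> (p \<otimes> \<eta> \<otimes> \<eta>)"
    by (simp add: comp_assoc interchange)
  also have "\<dots> = p \<cdot> ((\<iota> h \<otimes> \<r> h) \<cdot> \<a> h h \<k>) \<cdot> (\<iota> (h \<odot> h) \<otimes> \<l> \<k>)"
    by (simp add: rho_right[where x = \<k>] mult_unit comp_assoc)
  also have "\<dots> = (p \<cdot> \<r> (h \<odot> h)) \<cdot> (\<iota> (h \<odot> h) \<otimes> \<l> \<k>)"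
    by (simp only: runit_tensor arrow_simps) (simp add: comp_assoc)
  also have "\<dots> = (\<r> C \<cdot> (\<iota> C \<otimes> \<l> \<k>)) \<cdot> (p \<otimes> \<iota> (\<k> \<odot> \<k>))"
    using runit_natural[of p, symmetric] by (simp add: comp_assoc interchange)
  finally show "(rho \<cdot> (\<iota> C \<otimes> \<eta> \<otimes> \<eta>)) \<cdot> (p \<otimes> \<iota> (\<k> \<odot> \<k>))
    = (\<r> C \<cdot> (\<iota> C \<otimes> \<l> \<k>)) \<cdot> (p \<otimes> \<iota> (\<k> \<odot> \<k>))" .
qed simp_all

text \<open>Under \<open>lam\<close>, an element acts by multiplication with its coproduct through
  \<open>rho\<close>; this form evaluates \<open>lam\<close> on every arrow that factors through
  \<open>p\<close>.\<close>

lemma lam_p_comp: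
  assumes [simp]: "f \<in> Arr V" "Cod V f = h \<odot> h" "g \<in> Arr V" "Cod V g = h"
  shows "lam \<cdot> (g \<otimes> (p \<cdot> f)) = (rho \<cdot> (\<iota> C \<otimes> f)) \<cdot> ((\<Delta> \<cdot> g) \<otimes> \<iota> (Dom V f))"
proof -
  have "lam \<cdot> (g \<otimes> (p \<cdot> f)) = (lam \<cdot> (\<iota> h \<otimes> p)) \<cdot> (g \<otimes> f)"
    by (simp add: comp_assoc interchange)
  also have "\<dots> = (rho \<cdot> (\<iota> C \<otimes> f)) \<cdot> ((\<Delta> \<cdot> g) \<otimes> \<iota> (Dom V f))"
    by (simp only: lam_p) (simp add: comp_assoc interchange)
  finally show ?thesis .
qed

text \<open>In elements, p(1 \<otimes> 1) = 1.p(1 \<otimes> 1) = \<Delta>(1)(1 \<otimes> 1) =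
  \<Delta>(1), by the unit law of \<open>lam\<close>, its definition and
  \<open>rho_unit\<close>.\<close>

lemma comul_unit: "\<Delta> \<cdot> \<eta> \<cdot> \<l> \<k> = p \<cdot> (\<eta> \<otimes> \<eta>)"
\<comment> \<open>The unit law of \<open>lam\<close> brings in one more copy of \<open>\<k>\<close>,
  so the comparison takes place on \<open>\<k> \<odot> \<k> \<odot> \<k>\<close>.\<close>
proof (rule iso_cancel_right[where e = "\<l> (\<k> \<odot> \<k>)"])
  have "(p \<cdot> (\<eta> \<otimes> \<eta>)) \<cdot> \<l> (\<k> \<odot> \<k>) = \<l> C \<cdot> (\<iota> \<k> \<otimes> (p \<cdot> (\<eta> \<otimes> \<eta>)))"
    using lunit_natural[of "p \<cdot> (\<eta> \<otimes> \<eta>)"] by simp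
  also have "\<l> C = lam \<cdot> (\<eta> \<otimes> \<iota> C)"
    using lam_action by (simp add: left_action_def)
  also have "(lam \<cdot> (\<eta> \<otimes> \<iota> C)) \<cdot> (\<iota> \<k> \<otimes> (p \<cdot> (\<eta> \<otimes> \<eta>))) = lam \<cdot> (\<eta> \<otimes> (p \<cdot> (\<eta> \<otimes> \<eta>)))"
    by (simp add: comp_assoc interchange)
  also have "\<dots> = (\<r> C \<cdot> ((\<Delta> \<cdot> \<eta>) \<otimes> \<iota> \<k>)) \<cdot> (\<iota> \<k> \<otimes> \<l> \<k>)"
    by (simp add: lam_p_comp rho_unit comp_assoc interchange)
  also have "\<dots> = (\<Delta> \<cdot> \<eta> \<cdot> \<l> \<k>) \<cdot> \<l> (\<k> \<odot> \<k>)"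
    using runit_natural[of "\<Delta> \<cdot> \<eta>"] by (simp add: lunit_unit_tensor lunit_unit comp_assoc)
  finally show "(\<Delta> \<cdot> \<eta> \<cdot> \<l> \<k>) \<cdot> \<l> (\<k> \<odot> \<k>) = (p \<cdot> (\<eta> \<otimes> \<eta>)) \<cdot> \<l> (\<k> \<odot> \<k>)" ..
qed simp_all

text \<open>In elements, a.\<Delta>(1) = a.p(1 \<otimes> 1) = \<Delta>(a)(1 \<otimes> 1) =
  \<Delta>(a).\<close>

lemma lam_comul_unit: "lam \<cdot> (\<iota> h \<otimes> (\<Delta> \<cdot> \<eta>)) = \<Delta> \<cdot> \<r> h"
proof (rule iso_cancel_right[where e = "\<iota> h \<otimes> \<l> \<k>"])
  have "(lam \<cdot> (\<iota> h \<otimes> (\<Delta> \<cdot> \<eta>))) \<cdot> (\<iota> h \<otimes> \<l> \<k>) = lam \<cdot> (\<iota> h \<otimes> (p \<cdot> (\<eta> \<otimes> \<eta>)))"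
    by (simp add: comul_unit comp_assoc interchange)
  also have "\<dots> = (\<r> C \<cdot> (\<Delta> \<otimes> \<iota> \<k>)) \<cdot> (\<iota> h \<otimes> \<l> \<k>)"
    by (simp add: lam_p_comp rho_unit comp_assoc interchange)
  also have "\<dots> = (\<Delta> \<cdot> \<r> h) \<cdot> (\<iota> h \<otimes> \<l> \<k>)"
    using runit_natural[of \<Delta>] by simp
  finally show "(lam \<cdot> (\<iota> h \<otimes> (\<Delta> \<cdot> \<eta>))) \<cdot> (\<iota> h \<otimes> \<l> \<k>) = (\<Delta> \<cdot> \<r> h) \<cdot> (\<iota> h \<otimes> \<l> \<k>)" .
qed simp_all

text \<open>Multiplicativity of \<open>\<Delta>\<close> is the associativity of the action \<open>lam\<close> evaluated at \<open>\<Delta> \<cdot> \<eta>\<close>.\<close>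

lemma comul_mult: "\<Delta> \<cdot> \<mu> = lam \<cdot> (\<iota> h \<otimes> \<Delta>)"
proof (rule iso_cancel_right[where e = "\<r> (h \<odot> h)"])
  have "(\<Delta> \<cdot> \<mu>) \<cdot> \<r> (h \<odot> h) = (\<Delta> \<cdot> \<r> h) \<cdot> (\<mu> \<otimes> \<iota> \<k>)"
    using runit_natural[of \<mu>] by (simp add: comp_assoc)
  also have "\<dots> = (lam \<cdot> (\<mu> \<otimes> \<iota> C)) \<cdot> (\<iota> (h \<odot> h) \<otimes> (\<Delta> \<cdot> \<eta>))"
    by (simp only: lam_comul_unit[symmetric]) (simp add: comp_assoc interchange)
  also have "lam \<cdot> (\<mu> \<otimes> \<iota> C) = lam \<cdot> (\<iota> h \<otimes> lam) \<cdot> \<a> h h C"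
    using lam_action by (simp add: left_action_def)
  also have "(lam \<cdot> (\<iota> h \<otimes> lam) \<cdot> \<a> h h C) \<cdot> (\<iota> (h \<odot> h) \<otimes> (\<Delta> \<cdot> \<eta>))
    = lam \<cdot> (\<iota> h \<otimes> (lam \<cdot> (\<iota> h \<otimes> (\<Delta> \<cdot> \<eta>)))) \<cdot> \<a> h h \<k>"
    using assoc_natural[of "\<iota> h" "\<iota> h" "\<Delta> \<cdot> \<eta>"] by (simp add: comp_assoc interchange_tail)
  also have "\<dots> = lam \<cdot> (\<iota> h \<otimes> \<Delta>) \<cdot> (\<iota> h \<otimes> \<r> h) \<cdot> \<a> h h \<k>"
    by (simp only: lam_comul_unit) (simp add: interchange_tail)
  finally show "(\<Delta> \<cdot> \<mu>) \<cdot> \<r> (h \<odot> h) = (lam \<cdot> (\<iota> h \<otimes> \<Delta>)) \<cdot> \<r> (h \<odot> h)"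
    by (simp add: runit_tensor comp_assoc)
qed simp_all

text \<open>\<beta>(l) is the right action of l on 1 (\<open>act\<close> below), and on the balanced
  tensor product that action hits only the second factor: \<Delta>(1.l) = (1 \<otimes> 1).l = 1
  \<otimes> \<beta>(l).\<close>

lemma comul_beta: "\<Delta> \<cdot> \<beta> \<cdot> \<l> (mobj L) = p \<cdot> (\<eta> \<otimes> \<beta>)"
proof (rule iso_cancel_right[where e = "\<l> \<k> \<otimes> \<iota> (mobj L)"])
  let ?n = "ract (induced_bimodule V L p X X)"
  note n = bal.induced_ract[OF L refl refl bimoduleD(10,8)[OF bimodule_X]]
  note [simp] = n(1-3)
  have act: "ract X \<cdot> (\<eta> \<otimes> \<iota> (mobj L)) = \<beta> \<cdot> \<l> (mobj L)"
  proof -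
    have "ract X \<cdot> (\<eta> \<otimes> \<iota> (mobj L)) = \<mu> \<cdot> \<tau> h h \<cdot> (\<eta> \<otimes> \<beta>)"
      by (simp add: comp_assoc interchange)
    also have "\<dots> = (\<mu> \<cdot> (\<iota> h \<otimes> \<eta>)) \<cdot> (\<beta> \<otimes> \<iota> \<k>) \<cdot> \<tau> \<k> (mobj L)"
      using symm_natural[of \<eta> \<beta>] by (simp add: comp_assoc interchange_tail)
    also have "\<dots> = (\<beta> \<cdot> \<r> (mobj L)) \<cdot> \<tau> \<k> (mobj L)"
      using runit_natural[of \<beta>, symmetric] by (simp only: mult_unit) (simp add: comp_assoc)
    finally show ?thesis by (simp add: comp_assoc runit_symm)
  qed
  have "(\<Delta> \<cdot> \<beta> \<cdot> \<l> (mobj L)) \<cdot> (\<l> \<k> \<otimes> \<iota> (mobj L))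
    = (\<Delta> \<cdot> ract X) \<cdot> ((\<eta> \<cdot> \<l> \<k>) \<otimes> \<iota> (mobj L))"
    by (simp only: act[symmetric]) (simp add: comp_assoc interchange)
  also have "\<Delta> \<cdot> ract X = ?n \<cdot> (\<Delta> \<otimes> \<iota> (mobj L))"
    using comul by (simp add: bimodule_morphism_def)
  also have "(?n \<cdot> (\<Delta> \<otimes> \<iota> (mobj L))) \<cdot> ((\<eta> \<cdot> \<l> \<k>) \<otimes> \<iota> (mobj L))
    = ?n \<cdot> ((p \<cdot> (\<eta> \<otimes> \<eta>)) \<otimes> \<iota> (mobj L))"
    by (simp add: comp_assoc interchange comul_unit)
  also have "\<dots> = (?n \<cdot> (p \<otimes> \<iota> (mobj L))) \<cdot> ((\<eta> \<otimes> \<eta>) \<otimes> \<iota> (mobj L))"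
    by (simp add: comp_assoc interchange)
  also have "\<dots> = (p \<cdot> (\<iota> h \<otimes> ract X) \<cdot> \<a> h h (mobj L)) \<cdot> ((\<eta> \<otimes> \<eta>) \<otimes> \<iota> (mobj L))"
    using n(4) by simp
  also have "\<dots> = p \<cdot> (\<eta> \<otimes> (ract X \<cdot> (\<eta> \<otimes> \<iota> (mobj L)))) \<cdot> \<a> \<k> \<k> (mobj L)"
    using assoc_natural[of \<eta> \<eta> "\<iota> (mobj L)"] by (simp add: comp_assoc interchange_tail)
  also have "\<dots> = p \<cdot> (\<eta> \<otimes> \<beta>) \<cdot> (\<iota> \<k> \<otimes> \<l> (mobj L)) \<cdot> \<a> \<k> \<k> (mobj L)"
    by (simp only: act) (simp add: interchange_tail)
  also have "\<dots> = (p \<cdot> (\<eta> \<otimes> \<beta>)) \<cdot> (\<l> \<k> \<otimes> \<iota> (mobj L))"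
    by (simp add: triangle lunit_unit comp_assoc)
  finally show "(\<Delta> \<cdot> \<beta> \<cdot> \<l> (mobj L)) \<cdot> (\<l> \<k> \<otimes> \<iota> (mobj L)) = (p \<cdot> (\<eta> \<otimes> \<beta>)) \<cdot> (\<l> \<k> \<otimes> \<iota> (mobj L))" .
qed simp_all

text \<open>Likewise \<alpha>(l) is the left action of l on 1, which hits the first factor. Reversal
  would lead from left to right bialgebroids, so this case is computed directly.\<close>

lemma comul_alpha: "\<Delta> \<cdot> \<alpha> \<cdot> \<r> (mobj L) = p \<cdot> (\<alpha> \<otimes> \<eta>)"
proof (rule iso_cancel_right[where e = "\<iota> (mobj L) \<otimes> \<l> \<k>"])
  let ?n = "lact (induced_bimodule V L p X X)"
  note n = bal.induced_lact[OF L refl refl bimoduleD(9,8)[OF bimodule_X]]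
  note [simp] = n(1-3)
  have act: "lact X \<cdot> (\<iota> (mobj L) \<otimes> \<eta>) = \<alpha> \<cdot> \<r> (mobj L)"
  proof -
    have "lact X \<cdot> (\<iota> (mobj L) \<otimes> \<eta>) = (\<mu> \<cdot> (\<iota> h \<otimes> \<eta>)) \<cdot> (\<alpha> \<otimes> \<iota> \<k>)"
      by (simp add: comp_assoc interchange)
    then show ?thesis using runit_natural[of \<alpha>] by (simp add: mult_unit)
  qed
  have "(\<Delta> \<cdot> \<alpha> \<cdot> \<r> (mobj L)) \<cdot> (\<iota> (mobj L) \<otimes> \<l> \<k>)
    = (\<Delta> \<cdot> lact X) \<cdot> (\<iota> (mobj L) \<otimes> (\<eta> \<cdot> \<l> \<k>))"
    by (simp only: act[symmetric]) (simp add: comp_assoc interchange)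
  also have "\<Delta> \<cdot> lact X = ?n \<cdot> (\<iota> (mobj L) \<otimes> \<Delta>)"
    using comul by (simp add: bimodule_morphism_def)
  also have "(?n \<cdot> (\<iota> (mobj L) \<otimes> \<Delta>)) \<cdot> (\<iota> (mobj L) \<otimes> (\<eta> \<cdot> \<l> \<k>))
    = ?n \<cdot> (\<iota> (mobj L) \<otimes> (p \<cdot> (\<eta> \<otimes> \<eta>)))"
    by (simp add: comp_assoc interchange comul_unit)
  also have "\<dots> = (?n \<cdot> (\<iota> (mobj L) \<otimes> p)) \<cdot> (\<iota> (mobj L) \<otimes> \<eta> \<otimes> \<eta>)"
    by (simp add: comp_assoc interchange)
  also have "\<dots> = (p \<cdot> (lact X \<otimes> \<iota> h) \<cdot> Inv V (\<a> (mobj L) h h)) \<cdot> (\<iota> (mobj L) \<otimes> \<eta> \<otimes> \<eta>)"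
    using n(4) by simp
  also have "\<dots> = p \<cdot> ((lact X \<cdot> (\<iota> (mobj L) \<otimes> \<eta>)) \<otimes> \<eta>) \<cdot> Inv V (\<a> (mobj L) \<k> \<k>)"
    using assoc_inv_natural[of "\<iota> (mobj L)" \<eta> \<eta>] by (simp add: comp_assoc interchange_tail)
  also have "\<dots> = p \<cdot> (\<alpha> \<otimes> \<eta>) \<cdot> (\<r> (mobj L) \<otimes> \<iota> \<k>) \<cdot> Inv V (\<a> (mobj L) \<k> \<k>)"
    by (simp only: act) (simp add: interchange_tail)
  also have "\<dots> = (p \<cdot> (\<alpha> \<otimes> \<eta>)) \<cdot> (\<iota> (mobj L) \<otimes> \<l> \<k>)"
    by (simp add: triangle_inv comp_assoc)
  finally show "(\<Delta> \<cdot> \<alpha> \<cdot> \<r> (mobj L)) \<cdot> (\<iota> (mobj L) \<otimes> \<l> \<k>) = (p \<cdot> (\<alpha> \<otimes> \<eta>)) \<cdot> (\<iota> (mobj L) \<otimes> \<l> \<k>)" .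
qed simp_all

text \<open>\<open>f\<close> stands for \<open>alphaR\<close>, and \<open>n\<close> for the induced
  action, known through its value on representatives. In elements, \<Delta>(a f(r)) =
  a.\<Delta>(f(r)) = a.(1 \<otimes> f(r)) = \<Delta>(a)(1 \<otimes> f(r)), which is \<open>n\<close>
  applied to \<Delta>(a) and r.\<close>

lemma comul_right_linear:
  assumes [simp]: "f \<in> Arr V" "Dom V f = x" "Cod V f = h" and f: "\<beta> \<cdot> \<epsilon> \<cdot> f = f"
    and [simp]: "n \<in> Arr V" "Dom V n = C \<odot> x" "Cod V n = C"
    and n: "n \<cdot> (p \<otimes> \<iota> x) = p \<cdot> (\<iota> h \<otimes> (\<mu> \<cdot> (\<iota> h \<otimes> f))) \<cdot> \<a> h h x"
  shows "\<Delta> \<cdot> \<mu> \<cdot> (\<iota> h \<otimes> f) = n \<cdot> (\<Delta> \<otimes> \<iota> x)"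
proof (rule iso_cancel_right[where e = "\<iota> h \<otimes> \<l> x"])
  have [simp]: "x \<in> Obj V" using Dom_Cod_Obj(1)[of f] by simp
  have comul_f: "\<Delta> \<cdot> f \<cdot> \<l> x = p \<cdot> (\<eta> \<otimes> f)"
  proof -
    \<comment> \<open>The hypothesis routes \<open>f\<close> through \<open>\<beta>\<close>, where
      \<open>comul_beta\<close> applies.\<close>
    have "\<Delta> \<cdot> f \<cdot> \<l> x = \<Delta> \<cdot> \<beta> \<cdot> (\<epsilon> \<cdot> f) \<cdot> \<l> x"
      by (subst f[symmetric]) (simp add: comp_assoc)
    also have "\<dots> = (\<Delta> \<cdot> \<beta> \<cdot> \<l> (mobj L)) \<cdot> (\<iota> \<k> \<otimes> (\<epsilon> \<cdot> f))"
      using lunit_natural[of "\<epsilon> \<cdot> f"] by (simp add: comp_assoc)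
    also have "\<dots> = p \<cdot> (\<eta> \<otimes> f)"
      by (simp only: comul_beta) (simp add: comp_assoc interchange f)
    finally show ?thesis .
  qed
  \<comment> \<open>Acting through \<open>rho\<close> by 1 \<otimes> f agrees with \<open>n\<close>,
    since both have the same value on representatives.\<close>
  have rho_n: "rho \<cdot> (\<iota> C \<otimes> \<eta> \<otimes> f) = n \<cdot> (\<iota> C \<otimes> \<l> x)"
  proof (rule bal.p_tensor_epi[where w = "\<k> \<odot> x"])
    have "(rho \<cdot> (\<iota> C \<otimes> \<eta> \<otimes> f)) \<cdot> (p \<otimes> \<iota> (\<k> \<odot> x)) = rho \<cdot> (p \<otimes> \<eta> \<otimes> f)"
      by (simp add: comp_assoc interchange)
    also have "\<dots> = (p \<cdot> (\<iota> h \<otimes> (\<mu> \<cdot> (\<iota> h \<otimes> f))) \<cdot> \<a> h h x) \<cdot> (\<iota> (h \<odot> h) \<otimes> \<l> x)"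
      by (simp add: rho_right[where x = x] comp_assoc)
    also have "\<dots> = (n \<cdot> (\<iota> C \<otimes> \<l> x)) \<cdot> (p \<otimes> \<iota> (\<k> \<odot> x))"
      by (simp only: n[symmetric]) (simp add: comp_assoc interchange)
    finally show "(rho \<cdot> (\<iota> C \<otimes> \<eta> \<otimes> f)) \<cdot> (p \<otimes> \<iota> (\<k> \<odot> x)) = (n \<cdot> (\<iota> C \<otimes> \<l> x)) \<cdot> (p \<otimes> \<iota> (\<k> \<odot> x))" .
  qed simp_all
  have "(\<Delta> \<cdot> \<mu> \<cdot> (\<iota> h \<otimes> f)) \<cdot> (\<iota> h \<otimes> \<l> x) = (\<Delta> \<cdot> \<mu>) \<cdot> (\<iota> h \<otimes> (f \<cdot> \<l> x))"
    by (simp add: comp_assoc interchange)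
  also have "\<dots> = lam \<cdot> (\<iota> h \<otimes> (p \<cdot> (\<eta> \<otimes> f)))"
    by (simp add: comul_mult comp_assoc interchange comul_f)
  also have "\<dots> = (n \<cdot> (\<Delta> \<otimes> \<iota> x)) \<cdot> (\<iota> h \<otimes> \<l> x)"
    by (simp add: lam_p_comp rho_n comp_assoc interchange)
  finally show "(\<Delta> \<cdot> \<mu> \<cdot> (\<iota> h \<otimes> f)) \<cdot> (\<iota> h \<otimes> \<l> x) = (n \<cdot> (\<Delta> \<otimes> \<iota> x)) \<cdot> (\<iota> h \<otimes> \<l> x)" .
qed (use Dom_Cod_Obj(1)[of f] in simp_all)

text \<open>Although \<open>n\<close> is a left action, r multiplies from the right. The argument of
  \<open>comul_right_linear\<close> is therefore run with r placed last, using
  \<open>n \<cdot> \<tau> C x\<close>, and the symmetry brings r to the front afterwards.\<close>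

lemma comul_left_linear:
  assumes [simp]: "f \<in> Arr V" "Dom V f = x" "Cod V f = h" and f: "\<alpha> \<cdot> \<epsilon> \<cdot> f = f"
    and [simp]: "n \<in> Arr V" "Dom V n = x \<odot> C" "Cod V n = C"
    and n: "n \<cdot> (\<iota> x \<otimes> p) = p \<cdot> ((\<mu> \<cdot> \<tau> h h \<cdot> (f \<otimes> \<iota> h)) \<otimes> \<iota> h) \<cdot> Inv V (\<a> x h h)"
  shows "\<Delta> \<cdot> \<mu> \<cdot> \<tau> h h \<cdot> (f \<otimes> \<iota> h) = n \<cdot> (\<iota> x \<otimes> \<Delta>)"
proof -
  have [simp]: "x \<in> Obj V" using Dom_Cod_Obj(1)[of f] by simp
  have comul_f: "\<Delta> \<cdot> f \<cdot> \<r> x = p \<cdot> (f \<otimes> \<eta>)"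
  proof -
    have "\<Delta> \<cdot> f \<cdot> \<r> x = \<Delta> \<cdot> \<alpha> \<cdot> (\<epsilon> \<cdot> f) \<cdot> \<r> x"
      by (subst f[symmetric]) (simp add: comp_assoc)
    also have "\<dots> = (\<Delta> \<cdot> \<alpha> \<cdot> \<r> (mobj L)) \<cdot> ((\<epsilon> \<cdot> f) \<otimes> \<iota> \<k>)"
      using runit_natural[of "\<epsilon> \<cdot> f"] by (simp add: comp_assoc)
    also have "\<dots> = p \<cdot> (f \<otimes> \<eta>)"
      by (simp only: comul_alpha) (simp add: comp_assoc interchange f)
    finally show ?thesis .
  qed
  have symm_f: "\<tau> h h \<cdot> (f \<otimes> \<iota> h) = (\<iota> h \<otimes> f) \<cdot> \<tau> x h"
    using symm_natural[of f "\<iota> h"] by simp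
  have rho_n: "rho \<cdot> (\<iota> C \<otimes> f \<otimes> \<eta>) = n \<cdot> \<tau> C x \<cdot> (\<iota> C \<otimes> \<r> x)"
  proof (rule bal.p_tensor_epi[where w = "x \<odot> \<k>"])
    have "(rho \<cdot> (\<iota> C \<otimes> f \<otimes> \<eta>)) \<cdot> (p \<otimes> \<iota> (x \<odot> \<k>)) = rho \<cdot> (p \<otimes> f \<otimes> \<eta>)"
      by (simp add: comp_assoc interchange)
    \<comment> \<open>The hexagon completes the crossing of r past the second factor to a crossing
      past both; the one past the first factor is undone by \<open>symm_f\<close>.\<close>
    also have "\<dots> = (p \<cdot> ((\<mu> \<cdot> \<tau> h h \<cdot> (f \<otimes> \<iota> h)) \<otimes> \<iota> h) \<cdot> Inv V (\<a> x h h))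
        \<cdot> \<tau> (h \<odot> h) x \<cdot> (\<iota> (h \<odot> h) \<otimes> \<r> x)"
      by (simp add: rho_left[where x = x] hexagon_left symm_f comp_assoc interchange_tail)
    also have "\<dots> = n \<cdot> ((\<iota> x \<otimes> p) \<cdot> \<tau> (h \<odot> h) x) \<cdot> (\<iota> (h \<odot> h) \<otimes> \<r> x)"
      by (simp only: n[symmetric]) (simp add: comp_assoc)
    also have "\<dots> = (n \<cdot> \<tau> C x \<cdot> (\<iota> C \<otimes> \<r> x)) \<cdot> (p \<otimes> \<iota> (x \<odot> \<k>))"
      using symm_natural[of p "\<iota> x", symmetric] by (simp add: comp_assoc interchange)
    finally show "(rho \<cdot> (\<iota> C \<otimes> f \<otimes> \<eta>)) \<cdot> (p \<otimes> \<iota> (x \<odot> \<k>))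
      = (n \<cdot> \<tau> C x \<cdot> (\<iota> C \<otimes> \<r> x)) \<cdot> (p \<otimes> \<iota> (x \<odot> \<k>))" .
  qed simp_all
  have "\<Delta> \<cdot> \<mu> \<cdot> (\<iota> h \<otimes> f) = n \<cdot> \<tau> C x \<cdot> (\<Delta> \<otimes> \<iota> x)"
  proof (rule iso_cancel_right[where e = "\<iota> h \<otimes> \<r> x"])
    have "(\<Delta> \<cdot> \<mu> \<cdot> (\<iota> h \<otimes> f)) \<cdot> (\<iota> h \<otimes> \<r> x) = (\<Delta> \<cdot> \<mu>) \<cdot> (\<iota> h \<otimes> (f \<cdot> \<r> x))"
      by (simp add: comp_assoc interchange)
    also have "\<dots> = lam \<cdot> (\<iota> h \<otimes> (p \<cdot> (f \<otimes> \<eta>)))"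
      by (simp add: comul_mult comp_assoc interchange comul_f)
    also have "\<dots> = (n \<cdot> \<tau> C x \<cdot> (\<Delta> \<otimes> \<iota> x)) \<cdot> (\<iota> h \<otimes> \<r> x)"
      by (simp add: lam_p_comp rho_n comp_assoc interchange)
    finally show "(\<Delta> \<cdot> \<mu> \<cdot> (\<iota> h \<otimes> f)) \<cdot> (\<iota> h \<otimes> \<r> x) = (n \<cdot> \<tau> C x \<cdot> (\<Delta> \<otimes> \<iota> x)) \<cdot> (\<iota> h \<otimes> \<r> x)" .
  qed simp_all
  also have "\<tau> C x \<cdot> (\<Delta> \<otimes> \<iota> x) = (\<iota> x \<otimes> \<Delta>) \<cdot> \<tau> h x"
    using symm_natural[of \<Delta> "\<iota> x"] by simp
  finally have lin: "\<Delta> \<cdot> \<mu> \<cdot> (\<iota> h \<otimes> f) = n \<cdot> (\<iota> x \<otimes> \<Delta>) \<cdot> \<tau> h x" .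
  have "\<Delta> \<cdot> \<mu> \<cdot> \<tau> h h \<cdot> (f \<otimes> \<iota> h) = (\<Delta> \<cdot> \<mu> \<cdot> (\<iota> h \<otimes> f)) \<cdot> \<tau> x h"
    by (simp add: symm_f comp_assoc)
  also have "\<dots> = n \<cdot> (\<iota> x \<otimes> \<Delta>)"
    by (simp only: lin) (simp add: comp_assoc)
  finally show ?thesis .
qed

text \<open>L multiplies from the left and R from the right, so associativity lets the R-actions
  descend along \<open>p\<close>; the two linearity lemmas then apply to the descended
  actions.\<close>

theorem comul_bimodule_morphism:
  fixes R :: "('o, 'm, 'y) imon_scheme"
  assumes R: "internal_monoid V R" and c: "commuting_pair V R H alphaR betaR"
    and b: "\<alpha> \<cdot> \<epsilon> \<cdot> betaR = betaR" and a: "\<beta> \<cdot> \<epsilon> \<cdot> alphaR = alphaR"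
  defines "Y \<equiv> right_mult_bimodule V H alphaR betaR"
  shows "bimodule_morphism V R Y (induced_bimodule V R p Y Y) \<Delta>"
proof -
  note cD = commuting_pairD[OF c R H]
  note [simp] = internal_monoid_Arr[OF R] monoid_morphismD(1-3)[OF cD(1)]
    monoid_morphismD(1-3)[OF cD(2), simplified]
  have Y: "bimodule V R Y"
    unfolding Y_def by (rule right_mult_bimodule[OF c R H])
  have bY: "bobj Y = bobj X" by (simp add: Y_def)
  have lact: "left_action V R (bobj X) (lact Y)" and ract: "right_action V R (bobj X) (ract Y)"
    using bimoduleD(9,10)[OF Y] by (simp_all add: bY)
  have rcomm: "ract Y \<cdot> (lact X \<otimes> \<iota> (mobj R))
      = lact X \<cdot> (\<iota> (mobj L) \<otimes> ract Y) \<cdot> \<a> (mobj L) (bobj X) (mobj R)"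
    using actions_commute[OF H, of \<alpha> alphaR] by (simp add: Y_def)
  \<comment> \<open>Both of these actions pass through the symmetry, so their commutation is
    associativity in the opposite of \<open>H\<close>.\<close>
  have lcomm: "ract X \<cdot> (lact Y \<otimes> \<iota> (mobj L))
      = lact Y \<cdot> (\<iota> (mobj R) \<otimes> ract X) \<cdot> \<a> (mobj R) (bobj X) (mobj L)"
    using actions_commute[OF internal_monoid_op[OF H], of betaR \<beta>] by (simp add: Y_def comp_assoc)
  note r = bal.induced_ract[OF R bY bY ract rcomm]
  note l = bal.induced_lact[OF R bY bY lact lcomm]
  have "bimodule V R (induced_bimodule V R p Y Y)"
    by (rule bal.induced_bimodule[OF R bY bY lact ract lcomm rcomm])
  moreover have "\<Delta> \<cdot> \<mu> \<cdot> (\<iota> h \<otimes> alphaR) = ract (induced_bimodule V R p Y Y) \<cdot> (\<Delta> \<otimes> \<iota> (mobj R))"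
    using r(4) by (intro comul_right_linear a r(1-3)) (simp_all add: Y_def)
  moreover have "\<Delta> \<cdot> \<mu> \<cdot> \<tau> h h \<cdot> (betaR \<otimes> \<iota> h) = lact (induced_bimodule V R p Y Y) \<cdot> (\<iota> (mobj R) \<otimes> \<Delta>)"
    using l(4) by (intro comul_left_linear b l(1-3)) (simp_all add: Y_def)
  moreover have "bobj (induced_bimodule V R p Y Y) = C" "bobj Y = h"
    "lact Y = \<mu> \<cdot> \<tau> h h \<cdot> (betaR \<otimes> \<iota> h)" "ract Y = \<mu> \<cdot> (\<iota> h \<otimes> alphaR)"
    by (simp_all add: induced_bimodule_def Y_def)
  ultimately show ?thesis
    using Y by (simp add: bimodule_morphism_def Hom_def)
qed

end

theorem theorem3p1:
  fixes V :: "('o, 'm) smcat" (structure)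
    and L R :: "('o, 'm) imon"
  assumes "symmetric_monoidal_cat V"
    and "has_coequalizers V"
    and "coequalizers_commute_with_tensor V"
    and "internal_monoid V L"
    and "internal_monoid V R"
  shows
    "(\<forall>(H :: ('o, 'm) bialgd) alphaR betaR.
        left_bialgebroid V L H \<longrightarrow>
        commuting_pair V R H alphaR betaR \<longrightarrow>
        alpha H \<cdot> counit H \<cdot> betaR = betaR \<longrightarrow>
        beta H \<cdot> counit H \<cdot> alphaR = alphaR \<longrightarrow>
        bimodule_morphism V R
          (right_mult_bimodule V H alphaR betaR)
          (induced_bimodule V R (bal_proj V L (left_bimod V H) (left_bimod V H))
             (right_mult_bimodule V H alphaR betaR) (right_mult_bimodule V H alphaR betaR))
          (comul H))
     \<and>
     (\<forall>(H :: ('o, 'm) bialgd) alphaL betaL.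
        right_bialgebroid V R H \<longrightarrow>
        commuting_pair V L H alphaL betaL \<longrightarrow>
        alpha H \<cdot> counit H \<cdot> betaL = betaL \<longrightarrow>
        beta H \<cdot> counit H \<cdot> alphaL = alphaL \<longrightarrow>
        bimodule_morphism V L
          (left_mult_bimodule V H alphaL betaL)
          (induced_bimodule V L (bal_proj V R (right_bimod V H) (right_bimod V H))
             (left_mult_bimodule V H alphaL betaL) (left_mult_bimodule V H alphaL betaL))
          (comul H))"
proof (intro conjI allI impI)
  interpret symmetric_monoidal_cat V by fact
  interpret tensor_coequalizers V by unfold_locales fact
  interpret rev: symmetric_monoidal_cat "rev_cat V" by (rule symm_rev_cat)
  interpret rev: tensor_coequalizers "rev_cat V" by (rule rev_tensor_coequalizers)
  \<comment> \<open>Existence of coequalizers makes the \<open>SOME\<close> choice in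
    \<open>bal_proj\<close> an actual coequalizer.\<close>
  have bal_proj: "balanced_coequalizer V M X X (bal_proj V M X X)"
    if M: "internal_monoid V M" and X: "bimodule V M X" for M :: "('o, 'm) imon" and X
  proof -
    note [simp] = internal_monoid_Arr[OF M] bimodule_Arr[OF X]
    have "parallel V (ract X \<otimes> \<iota> (bobj X)) ((\<iota> (bobj X) \<otimes> lact X) \<cdot> \<a> (bobj X) (mobj M) (bobj X))"
      by (simp add: parallel_def)
    then show ?thesis
      using \<open>has_coequalizers V\<close> unfolding has_coequalizers_def balanced_coequalizer_def bal_proj_def coeq_def
      by (blast intro: someI_ex)
  qed
  fix H :: "('o, 'm) bialgd" and al be
  assume ab: "alpha H \<cdot> counit H \<cdot> be = be" "beta H \<cdot> counit H \<cdot> al = al"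
  {
    assume H: "left_bialgebroid V L H" and c: "commuting_pair V R H al be"
    let ?X = "left_bimod V H"
    let ?p = "bal_proj V L ?X ?X"
    have comul: "bimodule_morphism V L ?X (induced_bimodule V L ?p ?X ?X) (comul H)"
      and counit: "counit H \<in> Hom V (mobj H) (mobj L)"
      and mon: "internal_monoid V H" and comm: "commuting_pair V L H (alpha H) (beta H)"
      using H by (simp_all add: left_bialgebroid_def bimodule_comonoid_def bal_tensor_def
          bimodule_morphism_def regular_bimodule_def)
    obtain rho lam where rho: "left_bialgebroid_rho V H ?p rho"
      and lam: "left_bialgebroid_lam V H ?p rho lam" "left_action V H (Cod V ?p) lam"
      using H unfolding left_bialgebroid_def by blast
    interpret left_bialgebroid_data V L H ?p rho lam
      by unfold_locales
        (rule \<open>internal_monoid V L\<close> mon comm comul counit rho lam bal_proj left_mult_bimodule)+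
    show "bimodule_morphism V R (right_mult_bimodule V H al be)
      (induced_bimodule V R ?p (right_mult_bimodule V H al be) (right_mult_bimodule V H al be)) (comul H)"
      by (rule comul_bimodule_morphism[OF \<open>internal_monoid V R\<close> c ab])
  }
  {
    assume H: "right_bialgebroid V R H" and c: "commuting_pair V L H al be"
    let ?X = "right_bimod V H"
    let ?p = "bal_proj V R ?X ?X"
    have comul: "bimodule_morphism V R ?X (induced_bimodule V R ?p ?X ?X) (comul H)"
      and counit: "counit H \<in> Hom V (mobj H) (mobj R)"
      and mon: "internal_monoid V H" and comm: "commuting_pair V R H (alpha H) (beta H)"
      using H by (simp_all add: right_bialgebroid_def bimodule_comonoid_def bal_tensor_def
          bimodule_morphism_def regular_bimodule_def)
    obtain rho lam where lam: "right_bialgebroid_lam V H ?p lam"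
      and rho: "right_bialgebroid_rho V H ?p lam rho" "right_action V H (Cod V ?p) rho"
      using H unfolding right_bialgebroid_def by blast
    note R = \<open>internal_monoid V R\<close> and L = \<open>internal_monoid V L\<close>
    note [simp] = internal_monoid_Arr[OF R] internal_monoid_Arr[OF L] internal_monoid_Arr[OF mon]
    have X: "bimodule V R ?X" by (rule right_mult_bimodule[OF comm R mon])
    interpret bal: balanced_tensor V R ?X ?X ?p
      by unfold_locales (rule R X bal_proj)+
    \<comment> \<open>The arrow chosen in \<open>V\<close> is kept; no new choice is made in the
      reversed category.\<close>
    interpret rbal: balanced_tensor "rev_cat V" R "swap_bimod ?X" "swap_bimod ?X" ?p
      by (rule bal.rev_balanced_tensor)
    \<comment> \<open>Read in the reversed category, the right bialgebroid becomes a left one, with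
      \<open>lam\<close> and \<open>rho\<close> exchanged.\<close>
    interpret rev: left_bialgebroid_data "rev_cat V" R H ?p lam rho
    proof unfold_locales
      show "internal_monoid (rev_cat V) R" "internal_monoid (rev_cat V) H"
        by (rule internal_monoid_rev_cat R mon)+
      show "commuting_pair (rev_cat V) R H (alpha H) (beta H)"
        by (rule commuting_pair_rev_cat[OF comm R mon])
      show "balanced_coequalizer (rev_cat V) R (left_bimod (rev_cat V) H) (left_bimod (rev_cat V) H) ?p"
        using rbal.p by (simp add: mult_bimodule_rev_cat)
      show "bimodule_morphism (rev_cat V) R (left_bimod (rev_cat V) H)
        (induced_bimodule (rev_cat V) R ?p (left_bimod (rev_cat V) H) (left_bimod (rev_cat V) H)) (comul H)"
        using comul by (simp add: mult_bimodule_rev_cat induced_bimodule_rev_cat bimodule_morphism_rev_cat[OF R])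
      show "counit H \<in> Hom (rev_cat V) (mobj H) (mobj R)" using counit by simp
      show "left_bialgebroid_rho (rev_cat V) H ?p lam"
        using lam by (simp add: left_bialgebroid_rho_def right_bialgebroid_lam_def
            tensor_square_mult_def middle_swap_rev_cat)
      show "left_bialgebroid_lam (rev_cat V) H ?p lam rho"
        using rho(1) by (simp add: left_bialgebroid_lam_def right_bialgebroid_rho_def)
      show "left_action (rev_cat V) H (Cod (rev_cat V) ?p) rho"
        using rho(2) by (simp add: left_action_rev_cat[OF mon])
    qed
    \<comment> \<open>\<open>alpha\<close> and \<open>beta\<close> keep their roles under reversal,
      so the hypotheses on \<open>al\<close> and \<open>be\<close> carry over verbatim; what remains
      is to translate the bimodules back to \<open>V\<close>.\<close>
    show "bimodule_morphism V L (left_mult_bimodule V H al be)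
      (induced_bimodule V L ?p (left_mult_bimodule V H al be) (left_mult_bimodule V H al be)) (comul H)"
      using rev.comul_bimodule_morphism[OF internal_monoid_rev_cat[OF L] commuting_pair_rev_cat[OF c L mon]] ab
      by (simp add: mult_bimodule_rev_cat induced_bimodule_rev_cat bimodule_morphism_rev_cat[OF L])
  }
qed

end
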